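(* Let $\Omega\subset\mathbb{R}^n$ be a smooth bounded domain, let $b>0$ be a constant, let $\lambda>0$ be a parameter, and let $g$ satisfy $g\ge0$ and $g'>0$ on $[0,+\infty)$. Let $u$ be a positive classical solution of $$-\Delta u-b|\nabla u|^2=\lambda g(u)\ \text{ in }\Omega,\qquad u=0\ \text{ on }\partial\Omega,$$ and assume that $u$ is stable. If $$\liminf_{s\to\infty}\frac{g'(s)(e^{bs}-1)}{b\,g(s)}>1,$$ then $\|u\|_{H^1(\Omega)}\le C$, where $C$ is independent of $\lambda$.
   Context: The nonlinearity is a function $g:[0,+\infty)\to\mathbb{R}$. Stability: a classical solution $u$ of the problem $-\Delta u-b|\nabla u|^2=\lambda g(u)$ in $\Omega$, $u=0$ on $\partial\Omega$, is called stable if there exists a function $\phi\in W^{2,p}(\Omega)$ for some $p>n$ such that $\phi>0$ in $\overline{\Omega}$ and $-\Delta\phi-2b\nabla u\cdot\nabla\phi\ge\lambda g'(u)\phi$ in $\Omega$. *)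

theory Defs
  imports "HOL-Analysis.Analysis"
begin

section \<open>Classical derivatives\<close>

text \<open>Partial derivatives are meaningful only at points where the function is differentiable; below
  they are used only at points of open sets on which this is guaranteed.\<close>

definition partial :: "'n::finite \<Rightarrow> (real^'n \<Rightarrow> real) \<Rightarrow> real^'n \<Rightarrow> real" where
  "partial i f x = frechet_derivative f (at x) (axis i 1)"

text \<open>A list of coordinates plays the role of a multi-index; its length is the order.\<close>

definition partials :: "'n::finite list \<Rightarrow> (real^'n \<Rightarrow> real) \<Rightarrow> real^'n \<Rightarrow> real" where
  "partials is f = foldr partial is f"

definition grad :: "(real^'n::finite \<Rightarrow> real) \<Rightarrow> real^'n \<Rightarrow> real^'n" where
  "grad f x = (\<chi> i. partial i f x)"

definition laplacian :: "(real^'n::finite \<Rightarrow> real) \<Rightarrow> real^'n \<Rightarrow> real" where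
  "laplacian f x = (\<Sum>i\<in>UNIV. partials [i, i] f x)"

text \<open>The class \<open>C\<^sup>k(S)\<close>, for open \<open>S\<close>.\<close>

primrec Ck_on :: "nat \<Rightarrow> (real^'n::finite) set \<Rightarrow> (real^'n \<Rightarrow> real) \<Rightarrow> bool" where
  "Ck_on 0 S f \<longleftrightarrow> continuous_on S f"
| "Ck_on (Suc k) S f \<longleftrightarrow> f differentiable_on S \<and> (\<forall>i. Ck_on k S (partial i f))"

definition smooth_on :: "(real^'n::finite) set \<Rightarrow> (real^'n \<Rightarrow> real) \<Rightarrow> bool" where
  "smooth_on S f \<longleftrightarrow> (\<forall>k. Ck_on k S f)"


section \<open>Smooth bounded domains\<close>

text \<open>Near each boundary point, a smooth diffeomorphism with smooth inverse straightens the boundary: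
  it carries the domain to the part of an open set above a coordinate hyperplane, and the
  boundary to the part in that hyperplane.\<close>

definition smooth_bounded_domain :: "(real^'n::finite) set \<Rightarrow> bool" where
  "smooth_bounded_domain \<Omega> \<longleftrightarrow>
     open \<Omega> \<and> connected \<Omega> \<and> \<Omega> \<noteq> {} \<and> bounded \<Omega> \<and>
     (\<forall>x\<in>frontier \<Omega>. \<exists>U (D :: (real^'n) set) \<psi> \<psi>' k.
        open U \<and> x \<in> U \<and> open D \<and> homeomorphism U D \<psi> \<psi>' \<and>
        (\<forall>i. smooth_on U (\<lambda>y. \<psi> y $ i)) \<and> (\<forall>i. smooth_on D (\<lambda>y. \<psi>' y $ i)) \<and>
        \<psi> ` (\<Omega> \<inter> U) = {y \<in> D. y $ k > 0} \<and>
        \<psi> ` (frontier \<Omega> \<inter> U) = {y \<in> D. y $ k = 0})"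


section \<open>Weak derivatives and Sobolev spaces\<close>

definition test_function :: "(real^'n::finite) set \<Rightarrow> (real^'n \<Rightarrow> real) \<Rightarrow> bool" where
  "test_function \<Omega> \<eta> \<longleftrightarrow>
     smooth_on UNIV \<eta> \<and> compact (closure {x. \<eta> x \<noteq> 0}) \<and> closure {x. \<eta> x \<noteq> 0} \<subseteq> \<Omega>"

definition locally_integrable :: "(real^'n::finite) set \<Rightarrow> (real^'n \<Rightarrow> real) \<Rightarrow> bool" where
  "locally_integrable \<Omega> f \<longleftrightarrow> (\<forall>K. compact K \<and> K \<subseteq> \<Omega> \<longrightarrow> set_integrable lebesgue K f)"

definition has_weak_deriv ::
  "(real^'n::finite) set \<Rightarrow> 'n list \<Rightarrow> (real^'n \<Rightarrow> real) \<Rightarrow> (real^'n \<Rightarrow> real) \<Rightarrow> bool" where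
  "has_weak_deriv \<Omega> is f w \<longleftrightarrow>
     locally_integrable \<Omega> f \<and> locally_integrable \<Omega> w \<and>
     (\<forall>\<eta>. test_function \<Omega> \<eta> \<longrightarrow>
        (LINT x:\<Omega>|lebesgue. f x * partials is \<eta> x) =
        (-1) ^ length is * (LINT x:\<Omega>|lebesgue. w x * \<eta> x))"

text \<open>A weak derivative is determined only almost everywhere; this picks a representative. It is
  used only almost everywhere or under an integral.\<close>

definition weak_deriv ::
  "(real^'n::finite) set \<Rightarrow> 'n list \<Rightarrow> (real^'n \<Rightarrow> real) \<Rightarrow> real^'n \<Rightarrow> real" where
  "weak_deriv \<Omega> is f = (SOME w. has_weak_deriv \<Omega> is f w)"

definition weak_grad :: "(real^'n::finite) set \<Rightarrow> (real^'n \<Rightarrow> real) \<Rightarrow> real^'n \<Rightarrow> real^'n" where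
  "weak_grad \<Omega> f x = (\<chi> i. weak_deriv \<Omega> [i] f x)"

definition weak_laplacian :: "(real^'n::finite) set \<Rightarrow> (real^'n \<Rightarrow> real) \<Rightarrow> real^'n \<Rightarrow> real" where
  "weak_laplacian \<Omega> f x = (\<Sum>i\<in>UNIV. weak_deriv \<Omega> [i, i] f x)"

definition Lp_space :: "real \<Rightarrow> (real^'n::finite) set \<Rightarrow> (real^'n \<Rightarrow> real) set" where
  "Lp_space p \<Omega> = {f. set_borel_measurable lebesgue \<Omega> f \<and>
                      set_integrable lebesgue \<Omega> (\<lambda>x. \<bar>f x\<bar> powr p)}"

definition sobolev :: "nat \<Rightarrow> real \<Rightarrow> (real^'n::finite) set \<Rightarrow> (real^'n \<Rightarrow> real) set" where
  "sobolev k p \<Omega> = {f \<in> Lp_space p \<Omega>. \<forall>is. length is \<le> k \<longrightarrow>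
                       (\<exists>w \<in> Lp_space p \<Omega>. has_weak_deriv \<Omega> is f w)}"

definition H1_norm :: "(real^'n::finite) set \<Rightarrow> (real^'n \<Rightarrow> real) \<Rightarrow> real" where
  "H1_norm \<Omega> f = sqrt ((LINT x:\<Omega>|lebesgue. (f x)\<^sup>2) +
                        (LINT x:\<Omega>|lebesgue. (norm (weak_grad \<Omega> f x))\<^sup>2))"


section \<open>Solutions and stability\<close>

text \<open>Classical solutions are taken in \<open>C\<^sup>2(\<Omega>) \<inter> C(closure \<Omega>)\<close>. Values of \<open>u\<close> outside the closure of
  \<open>\<Omega>\<close> play no role.\<close>

definition classical_solution ::
  "(real^'n::finite) set \<Rightarrow> real \<Rightarrow> (real \<Rightarrow> real) \<Rightarrow> real \<Rightarrow> (real^'n \<Rightarrow> real) \<Rightarrow> bool" where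
  "classical_solution \<Omega> b g lam u \<longleftrightarrow>
     Ck_on 2 \<Omega> u \<and> continuous_on (closure \<Omega>) u \<and>
     (\<forall>x\<in>\<Omega>. - laplacian u x - b * (norm (grad u x))\<^sup>2 = lam * g (u x)) \<and>
     (\<forall>x\<in>frontier \<Omega>. u x = 0)"

text \<open>For \<open>p > n\<close> an element of \<open>W\<^sup>2\<^sup>,\<^sup>p(\<Omega>)\<close> has a unique representative continuous on the closure of
  \<open>\<Omega>\<close>, and it is for this one that positivity up to the boundary is meant. The differential
  inequality is between functions defined almost everywhere. The argument \<open>g'\<close> is the derivative
  of the nonlinearity.\<close>

definition stable_solution ::
  "(real^'n::finite) set \<Rightarrow> real \<Rightarrow> (real \<Rightarrow> real) \<Rightarrow> real \<Rightarrow> (real^'n \<Rightarrow> real) \<Rightarrow> bool" where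
  "stable_solution \<Omega> b g' lam u \<longleftrightarrow>
     (\<exists>p \<phi>. p > real CARD('n) \<and> \<phi> \<in> sobolev 2 p \<Omega> \<and>
        continuous_on (closure \<Omega>) \<phi> \<and> (\<forall>x\<in>closure \<Omega>. \<phi> x > 0) \<and>
        (AE x in lebesgue. x \<in> \<Omega> \<longrightarrow>
           - weak_laplacian \<Omega> \<phi> x - 2 * b * (grad u x \<bullet> weak_grad \<Omega> \<phi> x)
             \<ge> lam * g' (u x) * \<phi> x))"

end

theory Submission
  imports Defs
begin

text \<open>With \<open>w = (1 - e\<^bsup>-b u\<^esup>) / b\<close>, testing \<open>- div (e\<^bsup>b u\<^esup> grad u) = lam e\<^bsup>b u\<^esup> g(u)\<close> with \<open>w\<close> gives
  \<open>\<integral> |grad u|\<^sup>2 = lam \<integral> e\<^bsup>b u\<^esup> g(u) w\<close>. Stability says that \<open>\<phi>\<close> is a positive supersolution of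
  \<open>- div (e\<^bsup>2 b u\<^esup> grad \<phi>) = lam e\<^bsup>2 b u\<^esup> g'(u) \<phi>\<close>, and Picone's inequality with the test function \<open>w\<close> gives
  \<open>lam \<integral> e\<^bsup>2 b u\<^esup> g'(u) w\<^sup>2 \<le> \<integral> |grad u|\<^sup>2\<close>. The liminf condition reads \<open>e\<^bsup>b u\<^esup> g'(u) w \<ge> (1 + d) g(u)\<close>
  for large \<open>u\<close>, so the part of the first integral where \<open>u\<close> is large is controlled by the part where
  \<open>u\<close> is bounded, hence by \<open>lam\<close>. Picone's inequality for \<open>e\<^bsup>b u\<^esup> - 1\<close> and a fixed bump function bounds
  \<open>lam\<close>, and for \<open>\<rho>\<^sup>2 - |x|\<^sup>2\<close> it is the Poincare inequality. Since \<open>u\<close> is only continuous up to the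
  boundary, \<open>w\<close> is truncated near \<open>0\<close> and the truncation is removed by Fatou's lemma; since \<open>\<phi>\<close> is only a
  Sobolev function, Picone's inequality is applied to mollifications of \<open>\<phi>\<close>.\<close>

section \<open>Partial derivatives and integration by parts\<close>

text \<open>The estimate closes only if the gradient terms coming from the equation and from
  stability still agree exactly after truncation. Since dw/du = exp(-b u), testing the equation with
  Q(w) and stability with R(w) produces the integrals of Q'(w) |grad u|^2 and of R'(w)^2 |grad u|^2,
  so the pair has to satisfy Q' = R'^2. Both functions must vanish at the truncation value e
  together with their derivatives, so that freezing them below e leaves a C^1 function of compact
  support in \<Omega>. The choice R = (w - e)^2 / w does this, is close to w once w is much larger
  than e, and has an explicit Q. The superlevel sets of u are compact in \<Omega>, so nothing about
  grad u near the boundary enters.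

  Differentiation is handled along one coordinate line at a time, with continuity of the derivative
  in place of total differentiability: integration by parts and Picone's inequality hold in each
  direction separately, and the directions are summed afterwards.\<close>

definition cont_partial ::
  "'n::finite \<Rightarrow> (real^'n) set \<Rightarrow> (real^'n \<Rightarrow> real) \<Rightarrow> (real^'n \<Rightarrow> real) \<Rightarrow> bool" where
  "cont_partial i S f f' \<longleftrightarrow> continuous_on S f \<and> continuous_on S f' \<and>
     (\<forall>x\<in>S. ((\<lambda>t. f (x + t *\<^sub>R axis i 1)) has_real_derivative f' x) (at 0))"

lemma cont_partial_const [intro]: "cont_partial i S (\<lambda>x. c) (\<lambda>x. 0)"
  by (auto simp: cont_partial_def intro!: continuous_intros)

lemma cont_partial_add:
  assumes "cont_partial i S f f'" "cont_partial i S g g'"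
  shows "cont_partial i S (\<lambda>x. f x + g x) (\<lambda>x. f' x + g' x)"
  using assms unfolding cont_partial_def
  by (auto intro!: continuous_intros derivative_eq_intros)

lemma cont_partial_mult:
  assumes "cont_partial i S f f'" "cont_partial i S g g'"
  shows "cont_partial i S (\<lambda>x. f x * g x) (\<lambda>x. f x * g' x + f' x * g x)"
  using assms unfolding cont_partial_def
  by (auto intro!: continuous_intros derivative_eq_intros)

lemma cont_partial_divide:
  assumes "cont_partial i S f f'" "cont_partial i S g g'" "\<And>x. x \<in> S \<Longrightarrow> g x \<noteq> 0"
  shows "cont_partial i S (\<lambda>x. f x / g x) (\<lambda>x. (f' x * g x - f x * g' x) / (g x * g x))"
  using assms unfolding cont_partial_def
  by (auto intro!: continuous_intros derivative_eq_intros)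

lemma cont_partial_compose:
  assumes "cont_partial i S f f'" and h: "\<And>x. x \<in> S \<Longrightarrow> (h has_real_derivative h' (f x)) (at (f x))"
    and h': "continuous_on (f ` S) h'"
  shows "cont_partial i S (\<lambda>x. h (f x)) (\<lambda>x. h' (f x) * f' x)"
  unfolding cont_partial_def
proof (intro conjI ballI)
  have f: "continuous_on S f" "continuous_on S f'"
    using assms(1) by (auto simp: cont_partial_def)
  have "continuous_on (f ` S) h"
    by (intro DERIV_continuous_on[of _ _ h'] ballI) (use h in \<open>auto intro: has_field_derivative_at_within\<close>)
  then show "continuous_on S (\<lambda>x. h (f x))"
    using continuous_on_compose2 f(1) by blast
  show "continuous_on S (\<lambda>x. h' (f x) * f' x)"
    by (intro continuous_on_mult f(2) continuous_on_compose2[OF h' f(1)]) auto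
  fix x assume x: "x \<in> S"
  have "((\<lambda>t. f (x + t *\<^sub>R axis i 1)) has_real_derivative f' x) (at 0)"
    using x assms(1) by (auto simp: cont_partial_def)
  then show "((\<lambda>t. h (f (x + t *\<^sub>R axis i 1))) has_real_derivative h' (f x) * f' x) (at 0)"
    by (intro DERIV_chain2[of h "h' (f x)"]) (use h[OF x] in auto)
qed

lemma line_in_open:
  fixes x v :: "'a::real_normed_vector"
  assumes "open S" "x \<in> S"
  shows "eventually (\<lambda>t. x + t *\<^sub>R v \<in> S) (nhds (0::real))"
proof -
  have "isCont (\<lambda>t::real. x + t *\<^sub>R v) 0"
    by (intro continuous_intros)
  then have "((\<lambda>t::real. x + t *\<^sub>R v) \<longlongrightarrow> x) (at 0)"
    by (simp add: isCont_def)
  then have "eventually (\<lambda>t. x + t *\<^sub>R v \<in> S) (at (0::real))"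
    using assms topological_tendstoD by blast
  then show ?thesis
    using assms(2) by (simp add: eventually_nhds_conv_at)
qed

lemma cont_partial_cong:
  assumes "cont_partial i S f f'" "open S" "\<And>x. x \<in> S \<Longrightarrow> f x = g x" "\<And>x. x \<in> S \<Longrightarrow> f' x = g' x"
  shows "cont_partial i S g g'"
  unfolding cont_partial_def
proof (intro conjI ballI)
  show "continuous_on S g" "continuous_on S g'"
    using assms continuous_on_cong[of S S] by (auto simp: cont_partial_def)
  fix x assume x: "x \<in> S"
  have "eventually (\<lambda>t. f (x + t *\<^sub>R axis i 1) = g (x + t *\<^sub>R axis i 1)) (nhds (0::real))"
    using line_in_open[OF assms(2) x] by (rule eventually_mono) (use assms(3) in auto)
  then have "((\<lambda>t. f (x + t *\<^sub>R axis i 1)) has_real_derivative f' x) (at 0) \<longleftrightarrow>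
    ((\<lambda>t. g (x + t *\<^sub>R axis i 1)) has_real_derivative g' x) (at 0)"
    by (intro DERIV_cong_ev) (use assms(4)[OF x] in auto)
  then show "((\<lambda>t. g (x + t *\<^sub>R axis i 1)) has_real_derivative g' x) (at 0)"
    using x assms(1) by (auto simp: cont_partial_def)
qed

lemma cont_partial_Un:
  assumes "cont_partial i S f f'" "cont_partial i T f f'" "open S" "open T"
  shows "cont_partial i (S \<union> T) f f'"
  using assms unfolding cont_partial_def by (auto intro: continuous_on_open_Un)

lemma cont_partial_subset:
  "cont_partial i S f f' \<Longrightarrow> T \<subseteq> S \<Longrightarrow> cont_partial i T f f'"
  unfolding cont_partial_def by (auto intro: continuous_on_subset)

text \<open>On the open set \<open>S - K\<close> the function is locally zero, and a derivative
  along a line is unique.\<close>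

lemma cont_partial_zero_off:
  assumes "cont_partial i S f f'" "open S" "closed K" "\<And>x. x \<in> S \<Longrightarrow> x \<notin> K \<Longrightarrow> f x = 0"
    and "x \<in> S" "x \<notin> K"
  shows "f' x = 0"
proof -
  have "cont_partial i (S - K) f (\<lambda>x. 0)"
    by (rule cont_partial_cong[OF cont_partial_const[of i _ 0]])
      (use assms in \<open>auto intro: open_Diff\<close>)
  moreover have "cont_partial i (S - K) f f'"
    using assms(1) by (rule cont_partial_subset) auto
  ultimately show ?thesis
    using DERIV_unique assms(5,6) unfolding cont_partial_def by blast
qed

text \<open>\<open>S\<close> and the complement of \<open>K\<close> form an open cover, and both
  extended functions vanish on the second set. Integrands known only inside \<open>S\<close> thus
  become functions on the whole space, where translation invariance is available.\<close>

lemma cont_partial_extend_zero: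
  assumes "cont_partial i S f f'" "open S" "compact K" "K \<subseteq> S"
    and z: "\<And>x. x \<in> S \<Longrightarrow> x \<notin> K \<Longrightarrow> f x = 0"
  shows "cont_partial i UNIV (\<lambda>x. if x \<in> S then f x else 0) (\<lambda>x. if x \<in> S then f' x else 0)"
    (is "cont_partial i UNIV ?f ?f'")
proof -
  note K = compact_imp_closed[OF assms(3)]
  have "cont_partial i S ?f ?f'"
    by (rule cont_partial_cong[OF assms(1,2)]) auto
  moreover have "cont_partial i (-K) ?f ?f'"
    by (rule cont_partial_cong[OF cont_partial_const[of i _ 0]])
      (use z cont_partial_zero_off[OF assms(1,2) K z] K in \<open>auto simp: open_Compl\<close>)
  moreover have "S \<union> - K = UNIV" using assms(4) by auto
  ultimately show ?thesis
    using cont_partial_Un[of i S ?f ?f' "-K"] assms(2) K by (simp add: open_Compl)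
qed

lemma continuous_on_extend_zero:
  fixes f :: "'a::t2_space \<Rightarrow> real"
  assumes "continuous_on S f" "open S" "compact K" "K \<subseteq> S"
    and z: "\<And>x. x \<in> S \<Longrightarrow> x \<notin> K \<Longrightarrow> f x = 0"
  shows "continuous_on UNIV (\<lambda>x. if x \<in> S then f x else 0)" (is "continuous_on _ ?f")
proof -
  have "continuous_on S ?f"
    by (rule continuous_on_eq[OF assms(1)]) auto
  moreover have "continuous_on (-K) ?f"
    by (rule continuous_on_eq[of _ "\<lambda>x. 0"]) (use z in \<open>auto intro: continuous_intros\<close>)
  moreover have "S \<union> - K = UNIV" using assms(4) by auto
  ultimately show ?thesis
    using continuous_on_open_Un[of S "-K" ?f] assms(2,3) by (simp add: open_Compl compact_imp_closed)
qed

lemma DERIV_line: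
  fixes f :: "'a::real_normed_vector \<Rightarrow> real"
  assumes "\<And>x. ((\<lambda>t. f (x + t *\<^sub>R v)) has_real_derivative f' x) (at (0::real))"
  shows "((\<lambda>t. f (x + t *\<^sub>R v)) has_real_derivative f' (x + s *\<^sub>R v)) (at s)"
proof -
  have "((\<lambda>t. f ((x + s *\<^sub>R v) + (t - s) *\<^sub>R v)) has_real_derivative f' (x + s *\<^sub>R v) * 1) (at s)"
    by (rule DERIV_chain2[of "\<lambda>t. f ((x + s *\<^sub>R v) + t *\<^sub>R v)"])
      (use assms[of "x + s *\<^sub>R v"] in \<open>auto intro!: derivative_eq_intros\<close>)
  then show ?thesis by (simp add: algebra_simps)
qed

text \<open>The mean value inequality on the line through \<open>x\<close>; it dominates difference
  quotients uniformly in the step.\<close>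

lemma line_lipschitz:
  fixes f :: "'a::real_normed_vector \<Rightarrow> real"
  assumes "\<And>x. ((\<lambda>t. f (x + t *\<^sub>R v)) has_real_derivative f' x) (at (0::real))"
    and "\<And>x. \<bar>f' x\<bar> \<le> B"
  shows "\<bar>f (x + t *\<^sub>R v) - f x\<bar> \<le> B * \<bar>t\<bar>"
proof -
  have "norm (f (x + t *\<^sub>R v) - f (x + 0 *\<^sub>R v)) \<le> B * norm (t - 0)"
    by (rule field_differentiable_bound[of UNIV "\<lambda>t. f (x + t *\<^sub>R v)" "\<lambda>t. f' (x + t *\<^sub>R v)"])
       (use DERIV_line[OF assms(1)] assms(2) in auto)
  then show ?thesis by simp
qed

section \<open>Integrals of compactly supported functions over the whole space\<close>

lemma integrable_compact_support:
  fixes f :: "'a::euclidean_space \<Rightarrow> real"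
  assumes "continuous_on UNIV f" "compact K" "\<And>x. x \<notin> K \<Longrightarrow> f x = 0"
  shows "integrable lborel f"
proof -
  have "integrable lborel (\<lambda>x. indicator K x *\<^sub>R f x)"
    by (rule borel_integrable_compact[OF assms(2) continuous_on_subset[OF assms(1)]]) auto
  also have "(\<lambda>x. indicator K x *\<^sub>R f x) = f"
    by (intro ext) (metis assms(3) indicator_simps scaleR_one scaleR_zero_left)
  finally show ?thesis .
qed

lemma lborel_integral_translate:
  fixes f :: "'a::euclidean_space \<Rightarrow> real"
  assumes "f \<in> borel_measurable borel"
  shows "integral\<^sup>L lborel (\<lambda>x. f (x + a)) = integral\<^sup>L lborel f"
proof -
  have "integral\<^sup>L (distr lborel borel ((+) a)) f = integral\<^sup>L lborel (\<lambda>x. f (a + x))"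
    by (rule integral_distr) (use assms in auto)
  then show ?thesis by (simp add: lborel_distr_plus add.commute)
qed

lemma integrable_translate:
  fixes f :: "'a::euclidean_space \<Rightarrow> real"
  assumes "integrable lborel f"
  shows "integrable lborel (\<lambda>x. f (x + a))"
proof -
  have "integrable (distr lborel borel ((+) a)) f"
    using assms by (simp add: lborel_distr_plus)
  then have "integrable lborel (\<lambda>x. f (a + x))"
    by (subst (asm) integrable_distr_eq) (use assms in auto)
  then show ?thesis by (simp add: add.commute)
qed

lemma integrable_extend_zero:
  fixes f :: "'a::euclidean_space \<Rightarrow> real"
  assumes "continuous_on S f" "open S" "compact K" "K \<subseteq> S"
    and z: "\<And>x. x \<in> S \<Longrightarrow> x \<notin> K \<Longrightarrow> f x = 0"
  shows "integrable lborel (\<lambda>x. if x \<in> S then f x else 0)"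
  by (rule integrable_compact_support[OF continuous_on_extend_zero[OF assms] assms(3)])
    (use z in auto)

text \<open>The integral of a difference quotient vanishes by translation invariance.\<close>

lemma integral_cont_partial_zero:
  assumes "cont_partial i UNIV f f'" "compact K" "\<And>x. x \<notin> K \<Longrightarrow> f x = 0"
  shows "integrable lborel f' \<and> integral\<^sup>L lborel f' = 0"
proof -
  let ?e = "axis i (1::real)"
  have d: "((\<lambda>t. f (x + t *\<^sub>R ?e)) has_real_derivative f' x) (at 0)" for x
    using assms(1) by (auto simp: cont_partial_def)
  have cf: "continuous_on UNIV f" "continuous_on UNIV f'"
    using assms(1) by (auto simp: cont_partial_def)
  have f'0: "f' x = 0" if "x \<notin> K" for x
    by (rule cont_partial_zero_off[OF assms(1) open_UNIV compact_imp_closed[OF assms(2)] assms(3) _ that]) auto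
  have "bounded (f' ` K)"
    by (intro compact_imp_bounded compact_continuous_image continuous_on_subset[OF cf(2)] assms(2)) auto
  then obtain B where B: "B > 0" "\<And>x. x \<in> K \<Longrightarrow> \<bar>f' x\<bar> \<le> B"
    unfolding bounded_pos by auto
  have B': "\<bar>f' x\<bar> \<le> B" for x
    using B f'0[of x] by (cases "x \<in> K") auto
  obtain M where M: "\<And>x. x \<in> K \<Longrightarrow> norm x \<le> M"
    using assms(2) compact_imp_bounded bounded_iff by metis
  define t where "t k = 1 / real (Suc k)" for k
  have t: "t k > 0" "t k \<le> 1" for k by (auto simp: t_def)
  have t0: "t \<longlonglongrightarrow> 0" unfolding t_def by (rule LIMSEQ_Suc[OF lim_1_over_n])
  define q where "q k x = (f (x + t k *\<^sub>R ?e) - f x) / t k" for k x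
  have if': "integrable lborel f'" "integrable lborel f"
    using integrable_compact_support[OF cf(2) assms(2) f'0]
      integrable_compact_support[OF cf(1) assms(2,3)] by auto
  \<comment> \<open>The steps \<open>t k\<close> are at most 1, so every quotient is supported in
    the ball of radius \<open>M + 1\<close>, and it is bounded by \<open>B\<close> there.\<close>
  have lim: "(\<lambda>k. integral\<^sup>L lborel (q k)) \<longlonglongrightarrow> integral\<^sup>L lborel f'"
  proof (rule integral_dominated_convergence[where w = "\<lambda>x. B * indicator (cball 0 (M + 1)) x"])
    show "f' \<in> borel_measurable lborel" using if' by auto
    show "q k \<in> borel_measurable lborel" for k
      unfolding q_def using if'(2) integrable_translate[OF if'(2), of "t k *\<^sub>R ?e"] by measurable
    show "integrable lborel (\<lambda>x. B * indicator (cball 0 (M + 1)) x)"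
      using borel_integrable_compact[of "cball 0 (M + 1)" "\<lambda>x. B"]
      by (simp add: mult.commute)
    show "AE x in lborel. (\<lambda>k. q k x) \<longlonglongrightarrow> f' x"
    proof (rule AE_I2)
      fix x
      have "((\<lambda>s. (f (x + s *\<^sub>R ?e) - f x) / s) \<longlongrightarrow> f' x) (at 0)"
        using d[of x] by (simp add: has_field_derivative_iff)
      then show "(\<lambda>k. q k x) \<longlonglongrightarrow> f' x"
        unfolding q_def by (rule filterlim_compose) (use t t0 in \<open>auto simp: filterlim_at less_imp_neq[symmetric] intro!: eventuallyI\<close>)
    qed
    show "AE x in lborel. norm (q k x) \<le> B * indicator (cball 0 (M + 1)) x" for k
    proof (rule AE_I2)
      fix x
      have n: "norm (q k x) \<le> B"
        using line_lipschitz[of f ?e f' B x "t k", OF d B'] t[of k]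
        by (simp add: q_def field_simps)
      show "norm (q k x) \<le> B * indicator (cball 0 (M + 1)) x"
      proof (cases "x \<in> cball 0 (M + 1)")
        case False
        then have "norm x > M + 1" by auto
        moreover have "norm x \<le> norm (x + t k *\<^sub>R ?e) + norm (t k *\<^sub>R ?e)"
          by (metis add_diff_cancel norm_triangle_ineq4)
        moreover have "norm (t k *\<^sub>R ?e) \<le> 1" using t[of k] by simp
        ultimately have "x \<notin> K" "x + t k *\<^sub>R ?e \<notin> K"
          using M[of x] M[of "x + t k *\<^sub>R ?e"] by linarith+
        then have "f x = 0" "f (x + t k *\<^sub>R ?e) = 0"
          by (simp_all add: assms(3))
        then show ?thesis using B by (simp add: q_def)
      qed (use n in simp)
    qed
  qed
  have "integral\<^sup>L lborel (q k) = 0" for k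
  proof -
    have "integral\<^sup>L lborel (q k) =
        (integral\<^sup>L lborel (\<lambda>x. f (x + t k *\<^sub>R ?e)) - integral\<^sup>L lborel f) / t k"
      unfolding q_def using if'(2) integrable_translate[OF if'(2), of "t k *\<^sub>R ?e"] by simp
    then show ?thesis using lborel_integral_translate[of f] if'(2) by simp
  qed
  then have "(\<lambda>k::nat. 0::real) \<longlonglongrightarrow> integral\<^sup>L lborel f'"
    using lim by simp
  then show ?thesis using if' LIMSEQ_unique[OF _ tendsto_const] by metis
qed

lemma integral_partial_extend_zero:
  assumes "cont_partial i S f f'" "open S" "compact K" "K \<subseteq> S"
    and z: "\<And>x. x \<in> S \<Longrightarrow> x \<notin> K \<Longrightarrow> f x = 0"
  shows "integrable lborel (\<lambda>x. if x \<in> S then f' x else 0)"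
    and "integral\<^sup>L lborel (\<lambda>x. if x \<in> S then f' x else 0) = 0"
  using integral_cont_partial_zero[OF cont_partial_extend_zero[OF assms] assms(3)] z by auto

text \<open>Picone's identity in one direction: the test function is \<open>\<eta>\<^sup>2 / P\<close>.\<close>

lemma picone_partial:
  assumes S: "open S" "compact K" "K \<subseteq> S"
    and a: "cont_partial i S a a'" "\<And>x. x \<in> S \<Longrightarrow> a x > 0"
    and P: "cont_partial i S P P'" "cont_partial i S P' P''" "\<And>x. x \<in> S \<Longrightarrow> P x > 0"
    and e: "cont_partial i S e e'" "\<And>x. x \<in> S \<Longrightarrow> x \<notin> K \<Longrightarrow> e x = 0"
  defines "G \<equiv> \<lambda>x. if x \<in> S then (a x * P'' x + a' x * P' x) * (e x)\<^sup>2 / P x + a x * (e' x)\<^sup>2 else 0"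
  shows "integrable lborel G" "integral\<^sup>L lborel G \<ge> 0"
proof -
  have e': "e' x = 0" if "x \<in> S" "x \<notin> K" for x
    using cont_partial_zero_off[OF e(1) S(1) compact_imp_closed[OF S(2)] e(2)] that by blast
  have P0: "P x \<noteq> 0" if "x \<in> S" for x using P(3)[OF that] by simp
  have c: "continuous_on S a" "continuous_on S a'" "continuous_on S P" "continuous_on S P'"
    "continuous_on S P''" "continuous_on S e" "continuous_on S e'"
    using a(1) P(1,2) e(1) by (auto simp: cont_partial_def)
  show iG: "integrable lborel G"
    unfolding G_def
  proof (rule integrable_extend_zero[OF _ S])
    show "continuous_on S (\<lambda>x. (a x * P'' x + a' x * P' x) * (e x)\<^sup>2 / P x + a x * (e' x)\<^sup>2)"
      by (intro continuous_intros c) (use P0 in blast)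
  qed (simp add: e(2) e')
  define F' where "F' = (\<lambda>x. a x * P' x * (2 * e x * e' x) / P x + (a x * P'' x + a' x * P' x) * (e x)\<^sup>2 / P x
      - a x * P' x * (e x)\<^sup>2 * P' x / (P x * P x))"
  have F: "cont_partial i S (\<lambda>x. a x * P' x * (e x * e x) / P x) F'"
  proof (rule cont_partial_cong[OF cont_partial_divide[OF
          cont_partial_mult[OF cont_partial_mult[OF a(1) P(2)] cont_partial_mult[OF e(1) e(1)]] P(1) P0] S(1)])
    fix x assume "x \<in> S"
    have "((a x * P' x * (e x * e' x + e' x * e x) + (a x * P'' x + a' x * P' x) * (e x * e x)) * P x
        - a x * P' x * (e x * e x) * P' x) / (P x * P x)
      = (a x * P' x * (e x * e' x + e' x * e x) + (a x * P'' x + a' x * P' x) * (e x * e x)) / P x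
        - a x * P' x * (e x * e x) * P' x / (P x * P x)"
      using P0[OF \<open>x \<in> S\<close>] by (simp add: diff_divide_distrib)
    also have "\<dots> = F' x"
      unfolding F'_def by (simp add: add_divide_distrib[symmetric] power2_eq_square)
    finally show "((a x * P' x * (e x * e' x + e' x * e x) + (a x * P'' x + a' x * P' x) * (e x * e x)) * P x
        - a x * P' x * (e x * e x) * P' x) / (P x * P x) = F' x" .
  qed auto
  note F' = integral_partial_extend_zero[OF F S]
  have "integral\<^sup>L lborel (\<lambda>x. if x \<in> S then F' x else 0) \<le> integral\<^sup>L lborel G"
  proof (rule integral_mono)
    show "integrable lborel (\<lambda>x. if x \<in> S then F' x else 0)"
      by (rule F') (simp add: e)
    fix x
    have "F' x \<le> (a x * P'' x + a' x * P' x) * (e x)\<^sup>2 / P x + a x * (e' x)\<^sup>2" if "x \<in> S"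
    proof -
      have "(a x * P'' x + a' x * P' x) * (e x)\<^sup>2 / P x + a x * (e' x)\<^sup>2 - F' x
          = a x * (e x * P' x / P x - e' x)\<^sup>2"
        unfolding F'_def divide_inverse inverse_mult_distrib by algebra
      moreover have "\<dots> \<ge> 0" using a(2)[OF that] by simp
      ultimately show ?thesis by linarith
    qed
    then show "(if x \<in> S then F' x else 0) \<le> G x" by (simp add: G_def)
  qed (rule iG)
  moreover have "integral\<^sup>L lborel (\<lambda>x. if x \<in> S then F' x else 0) = 0"
    by (rule F') (simp add: e)
  ultimately show "integral\<^sup>L lborel G \<ge> 0" by simp
qed


section \<open>A smooth bump function\<close>

text \<open>The function exp(-1/t) together with its quotients by powers of t: the span of the
  family is closed under differentiation, so a first-derivative formula already gives
  smoothness.\<close>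

definition flat :: "nat \<Rightarrow> real \<Rightarrow> real" where
  "flat k t = (if t > 0 then exp (- 1 / t) / t ^ k else 0)"

lemma flat_tendsto_0: "((flat k) \<longlongrightarrow> 0) (at_right 0)"
proof -
  have "((\<lambda>t::real. (inverse t) ^ k / exp (inverse t)) \<longlongrightarrow> 0) (at_right 0)"
    by (rule filterlim_compose[OF tendsto_power_div_exp_0 filterlim_inverse_at_top_right])
  then show ?thesis
    by (rule Lim_transform_eventually)
      (auto simp: flat_def eventually_at_filter exp_minus field_simps intro!: eventuallyI)
qed

text \<open>At 0 the right difference quotient of \<open>flat k\<close> is
  \<open>flat (k + 1)\<close>, which tends to 0 because the exponential beats every power; elsewhere
  the ordinary rules apply.\<close>

lemma flat_DERIV:
  "(flat k has_real_derivative flat (k + 2) t - real k * flat (k + 1) t) (at t)"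
proof -
  consider "t > 0" | "t < 0" | "t = 0" by linarith
  then show ?thesis
  proof cases
    case 1
    have "eventually (\<lambda>s. s \<in> {0<..}) (nhds t)"
      using 1 by (intro eventually_nhds_in_open) auto
    then have ev: "eventually (\<lambda>s. flat k s = exp (- 1 / s) * inverse (s ^ k)) (nhds t)"
      by eventually_elim (simp add: flat_def divide_inverse)
    have "((\<lambda>s. exp (- 1 / s) * inverse (s ^ k)) has_real_derivative
        exp (- 1 / t) * (1 / t ^ 2) * inverse (t ^ k)
        + exp (- 1 / t) * (- (inverse (t ^ k) * (real k * t ^ (k - 1)) * inverse (t ^ k)))) (at t)"
      using 1 by (auto intro!: derivative_eq_intros simp: power2_eq_square divide_simps)
    also have "exp (- 1 / t) * (1 / t ^ 2) * inverse (t ^ k)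
        + exp (- 1 / t) * (- (inverse (t ^ k) * (real k * t ^ (k - 1)) * inverse (t ^ k)))
        = flat (k + 2) t - real k * flat (k + 1) t"
      using 1 by (cases k) (auto simp: flat_def field_simps power2_eq_square)
    finally show ?thesis
      by (subst DERIV_cong_ev[OF refl ev refl])
  next
    case 2
    have "eventually (\<lambda>s. s \<in> {..<0}) (nhds t)"
      using 2 by (intro eventually_nhds_in_open) auto
    then have ev: "eventually (\<lambda>s. flat k s = 0) (nhds t)"
      by eventually_elim (simp add: flat_def)
    show ?thesis
      using 2 by (subst DERIV_cong_ev[OF refl ev refl]) (simp add: flat_def)
  next
    case 3
    have r: "((\<lambda>h. (flat k h - flat k 0) / h) \<longlongrightarrow> 0) (at_right 0)"
      by (rule Lim_transform_eventually[OF flat_tendsto_0[of "k + 1"]])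
        (auto simp: flat_def eventually_at_filter field_simps intro!: eventuallyI)
    have l: "((\<lambda>h. (flat k h - flat k 0) / h) \<longlongrightarrow> 0) (at_left 0)"
      by (rule tendsto_eventually) (auto simp: flat_def eventually_at_filter)
    have "((\<lambda>h. (flat k h - flat k 0) / h) \<longlongrightarrow> 0) (at 0)"
      using r l by (simp add: filterlim_split_at)
    then show ?thesis
      using 3 by (simp add: DERIV_def flat_def)
  qed
qed

lemma flat_continuous: "continuous_on UNIV (flat k)"
  by (rule DERIV_continuous_on[OF has_field_derivative_at_within[OF flat_DERIV]])

lemma flat_continuous' [continuous_intros]:
  "continuous_on S f \<Longrightarrow> continuous_on S (\<lambda>x. flat k (f x))"
  by (rule continuous_on_compose2[OF flat_continuous]) auto

lemma flat_nonpos [simp]: "t \<le> 0 \<Longrightarrow> flat k t = 0"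
  by (simp add: flat_def)

lemma flat_pos: "t > 0 \<Longrightarrow> flat k t > 0"
  by (simp add: flat_def)

lemma flat_radial_has_derivative:
  fixes y :: "'a::real_inner"
  shows "((\<lambda>x. flat k (r\<^sup>2 - (norm (x - y))\<^sup>2)) has_derivative
    (\<lambda>h. (flat (k + 2) (r\<^sup>2 - (norm (x - y))\<^sup>2) - real k * flat (k + 1) (r\<^sup>2 - (norm (x - y))\<^sup>2))
       * (- 2 * ((x - y) \<bullet> h)))) (at x)"
proof -
  have "((\<lambda>x. r\<^sup>2 - (x - y) \<bullet> (x - y)) has_derivative (\<lambda>h. - 2 * ((x - y) \<bullet> h))) (at x)"
    by (auto intro!: derivative_eq_intros simp: inner_commute)
  then have "((\<lambda>x. r\<^sup>2 - (norm (x - y))\<^sup>2) has_derivative (\<lambda>h. - 2 * ((x - y) \<bullet> h))) (at x)"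
    by (simp add: dot_square_norm)
  from has_derivative_compose[OF this flat_DERIV[of k, unfolded has_field_derivative_def]]
  show ?thesis .
qed

text \<open>Partial derivatives do not leave this set, so that its members are smooth.\<close>

inductive_set flat_algebra :: "real \<Rightarrow> real^'n \<Rightarrow> (real^'n::finite \<Rightarrow> real) set"
  for r :: real and y :: "real^'n::finite" where
  flat: "(\<lambda>x. flat k (r\<^sup>2 - (norm (x - y))\<^sup>2)) \<in> flat_algebra r y"
| coord: "(\<lambda>x. x $ i) \<in> flat_algebra r y"
| const: "(\<lambda>x. c) \<in> flat_algebra r y"
| add: "f \<in> flat_algebra r y \<Longrightarrow> g \<in> flat_algebra r y \<Longrightarrow> (\<lambda>x. f x + g x) \<in> flat_algebra r y"
| mult: "f \<in> flat_algebra r y \<Longrightarrow> g \<in> flat_algebra r y \<Longrightarrow> (\<lambda>x. f x * g x) \<in> flat_algebra r y"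

text \<open>The derivative is written as a sum over coordinates so that a single induction gives
  both total differentiability, which \<open>Ck_on\<close> demands, and the membership of every
  partial derivative in the set.\<close>

lemma flat_algebra_derivative:
  fixes y :: "real^'n::finite"
  assumes "f \<in> flat_algebra r y"
  shows "\<exists>f'. (\<forall>x. (f has_derivative (\<lambda>h. \<Sum>j\<in>UNIV. f' j x * h $ j)) (at x)) \<and>
    (\<forall>j. f' j \<in> flat_algebra r y)"
  using assms
proof induction
  case (flat k)
  define f' where "f' j x = (flat (k + 2) (r\<^sup>2 - (norm (x - y))\<^sup>2)
      + (- real k) * flat (k + 1) (r\<^sup>2 - (norm (x - y))\<^sup>2)) * (- 2 * (x $ j + - (y $ j)))" for j x
  have "((\<lambda>x. flat k (r\<^sup>2 - (norm (x - y))\<^sup>2)) has_derivative (\<lambda>h. \<Sum>j\<in>UNIV. f' j x * h $ j)) (at x)" for x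
  proof (rule has_derivative_eq_rhs[OF flat_radial_has_derivative], rule ext)
    fix h :: "real^'n"
    let ?D = "flat (k + 2) (r\<^sup>2 - (norm (x - y))\<^sup>2) - real k * flat (k + 1) (r\<^sup>2 - (norm (x - y))\<^sup>2)"
    have "?D * (- 2 * ((x - y) \<bullet> h)) = (\<Sum>j\<in>UNIV. ?D * (- 2 * ((x $ j - y $ j) * h $ j)))"
      by (simp only: inner_vec_def sum_distrib_left inner_real_def vector_minus_component)
    also have "\<dots> = (\<Sum>j\<in>UNIV. f' j x * h $ j)"
      by (intro sum.cong refl) (simp add: f'_def algebra_simps)
    finally show "?D * (- 2 * ((x - y) \<bullet> h)) = (\<Sum>j\<in>UNIV. f' j x * h $ j)" .
  qed
  moreover have "f' j \<in> flat_algebra r y" for j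
    unfolding f'_def by (intro flat_algebra.intros)
  ultimately show ?case by blast
next
  case (coord i)
  have "((\<lambda>x::real^'n. x $ i) has_derivative (\<lambda>h. \<Sum>j\<in>UNIV. (if j = i then 1 else 0) * h $ j)) (at x)" for x
    by (rule has_derivative_eq_rhs[OF bounded_linear_imp_has_derivative[OF bounded_linear_vec_nth]])
      (simp add: if_distrib[of "\<lambda>c. c * _"] cong: if_cong)
  then show ?case
    by (intro exI[of _ "\<lambda>j x. if j = i then 1 else 0"]) (auto intro: flat_algebra.const)
next
  case (const c)
  have "((\<lambda>x::real^'n. c) has_derivative (\<lambda>h. \<Sum>j\<in>UNIV. 0 * h $ j)) (at x)" for x
    by simp
  then show ?case
    by (intro exI[of _ "\<lambda>j x. 0"]) (auto intro: flat_algebra.const)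
next
  case (add f g)
  from add.IH(1) obtain f' where
    f: "\<And>x. (f has_derivative (\<lambda>h. \<Sum>j\<in>UNIV. f' j x * h $ j)) (at x)" "\<And>j. f' j \<in> flat_algebra r y"
    by blast
  from add.IH(2) obtain g' where
    g: "\<And>x. (g has_derivative (\<lambda>h. \<Sum>j\<in>UNIV. g' j x * h $ j)) (at x)" "\<And>j. g' j \<in> flat_algebra r y"
    by blast
  have "((\<lambda>x. f x + g x) has_derivative (\<lambda>h. \<Sum>j\<in>UNIV. (f' j x + g' j x) * h $ j)) (at x)" for x
    by (rule has_derivative_eq_rhs[OF has_derivative_add[OF f(1) g(1)]])
      (simp add: sum.distrib[symmetric] distrib_right)
  then show ?case
    using f(2) g(2) by (intro exI[of _ "\<lambda>j x. f' j x + g' j x"]) (auto intro: flat_algebra.add)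
next
  case (mult f g)
  from mult.IH(1) obtain f' where
    f: "\<And>x. (f has_derivative (\<lambda>h. \<Sum>j\<in>UNIV. f' j x * h $ j)) (at x)" "\<And>j. f' j \<in> flat_algebra r y"
    by blast
  from mult.IH(2) obtain g' where
    g: "\<And>x. (g has_derivative (\<lambda>h. \<Sum>j\<in>UNIV. g' j x * h $ j)) (at x)" "\<And>j. g' j \<in> flat_algebra r y"
    by blast
  have "((\<lambda>x. f x * g x) has_derivative (\<lambda>h. \<Sum>j\<in>UNIV. (f x * g' j x + f' j x * g x) * h $ j)) (at x)" for x
  proof (rule has_derivative_eq_rhs[OF has_derivative_mult[OF f(1) g(1)]], rule ext)
    fix h :: "real^'n"
    have "f x * (\<Sum>j\<in>UNIV. g' j x * h $ j) + (\<Sum>j\<in>UNIV. f' j x * h $ j) * g x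
      = (\<Sum>j\<in>UNIV. f x * (g' j x * h $ j) + f' j x * h $ j * g x)"
      by (simp only: sum_distrib_left sum_distrib_right sum.distrib)
    also have "\<dots> = (\<Sum>j\<in>UNIV. (f x * g' j x + f' j x * g x) * h $ j)"
      by (intro sum.cong refl) (simp add: algebra_simps)
    finally show "f x * (\<Sum>j\<in>UNIV. g' j x * h $ j) + (\<Sum>j\<in>UNIV. f' j x * h $ j) * g x
      = (\<Sum>j\<in>UNIV. (f x * g' j x + f' j x * g x) * h $ j)" .
  qed
  then show ?case
    using f(2) g(2) mult.hyps
    by (intro exI[of _ "\<lambda>j x. f x * g' j x + f' j x * g x"]) (auto intro!: flat_algebra.add flat_algebra.mult)
qed

lemma partial_has_derivative:
  assumes "(f has_derivative f') (at x)"
  shows "partial i f x = f' (axis i 1)"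
  unfolding partial_def using frechet_derivative_at[OF assms] by simp

lemma line_has_derivative:
  fixes f :: "'a::real_normed_vector \<Rightarrow> real"
  assumes "(f has_derivative f') (at x)"
  shows "((\<lambda>t. f (x + t *\<^sub>R v)) has_real_derivative f' v) (at 0)"
proof -
  have "((\<lambda>t::real. x + t *\<^sub>R v) has_derivative (\<lambda>h. h *\<^sub>R v)) (at 0)"
    by (auto intro!: derivative_eq_intros)
  from has_derivative_compose[OF this, of f f']
  have "((\<lambda>t. f (x + t *\<^sub>R v)) has_derivative (\<lambda>h. f' (h *\<^sub>R v))) (at 0)"
    using assms by simp
  moreover have "f' (h *\<^sub>R v) = f' v * h" for h
    using linear_scale[OF has_derivative_linear[OF assms], of h v] by (simp add: mult.commute)
  ultimately show ?thesis by (simp add: has_field_derivative_def)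
qed

lemma flat_algebra_smooth:
  assumes "f \<in> flat_algebra r y"
  shows "smooth_on UNIV f"
  unfolding smooth_on_def
proof
  fix k
  show "Ck_on k UNIV f"
    using assms
  proof (induction k arbitrary: f)
    case 0
    then obtain f' where "\<And>x. (f has_derivative (\<lambda>h. \<Sum>j\<in>UNIV. f' j x * h $ j)) (at x)"
      using flat_algebra_derivative by blast
    then show ?case
      by (auto intro!: has_derivative_continuous_on simp: has_derivative_at_withinI)
  next
    case (Suc k)
    then obtain f' where f: "\<And>x. (f has_derivative (\<lambda>h. \<Sum>j\<in>UNIV. f' j x * h $ j)) (at x)"
      "\<And>j. f' j \<in> flat_algebra r y"
      using flat_algebra_derivative by blast
    have "partial i f = f' i" for i
      by (rule ext) (simp add: partial_has_derivative[OF f(1)] axis_def if_distrib[of "\<lambda>c. _ * c"] cong: if_cong)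
    then show ?case
      using Suc f by (auto simp: differentiable_on_def differentiable_def intro: has_derivative_at_withinI)
  qed
qed

text \<open>The mollifier, not normalised, and its first two derivatives in a coordinate direction.\<close>

definition ker :: "real \<Rightarrow> real^'n::finite \<Rightarrow> real" where
  "ker r z = flat 0 (r\<^sup>2 - (norm z)\<^sup>2)"

definition ker1 :: "'n \<Rightarrow> real \<Rightarrow> real^'n::finite \<Rightarrow> real" where
  "ker1 i r z = flat 2 (r\<^sup>2 - (norm z)\<^sup>2) * (- 2 * z $ i)"

definition ker2 :: "'n \<Rightarrow> real \<Rightarrow> real^'n::finite \<Rightarrow> real" where
  "ker2 i r z = (flat 4 (r\<^sup>2 - (norm z)\<^sup>2) - 2 * flat 3 (r\<^sup>2 - (norm z)\<^sup>2)) * (2 * z $ i)\<^sup>2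
     - 2 * flat 2 (r\<^sup>2 - (norm z)\<^sup>2)"

lemma ker_deriv:
  "((\<lambda>y. ker r (y - x)) has_derivative (\<lambda>h. flat 2 (r\<^sup>2 - (norm (y - x))\<^sup>2) * (- 2 * ((y - x) \<bullet> h)))) (at y)"
  using flat_radial_has_derivative[of 0 r x y] by (simp add: ker_def numeral_eq_Suc)

lemma ker1_deriv:
  "((\<lambda>y. ker1 i r (y - x)) has_derivative
    (\<lambda>h. flat 2 (r\<^sup>2 - (norm (y - x))\<^sup>2) * (- 2 * h $ i) +
      (flat 4 (r\<^sup>2 - (norm (y - x))\<^sup>2) - 2 * flat 3 (r\<^sup>2 - (norm (y - x))\<^sup>2)) * (- 2 * ((y - x) \<bullet> h)) * (- 2 * (y - x) $ i))) (at y)"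
proof -
  have "((\<lambda>y. - 2 * (y - x) $ i) has_derivative (\<lambda>h. - 2 * h $ i)) (at y)"
    by (auto intro!: derivative_eq_intros bounded_linear_imp_has_derivative[OF bounded_linear_vec_nth])
  from has_derivative_mult[OF flat_radial_has_derivative[of 2 r x y] this]
  show ?thesis unfolding ker1_def
    by (rule has_derivative_eq_rhs) (simp add: fun_eq_iff numeral_eq_Suc)
qed

lemma partial_ker: "partial i (\<lambda>y. ker r (y - x)) = (\<lambda>y. ker1 i r (y - x))"
  by (rule ext) (simp add: partial_has_derivative[OF ker_deriv] ker1_def inner_axis)

lemma partial_ker1: "partial i (\<lambda>y. ker1 i r (y - x)) = (\<lambda>y. ker2 i r (y - x))"
  by (rule ext) (simp add: partial_has_derivative[OF ker1_deriv] ker2_def inner_axis power2_eq_square algebra_simps)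

lemma ker_continuous:
  "continuous_on UNIV (ker r)" "continuous_on UNIV (ker1 i r)" "continuous_on UNIV (ker2 i r)"
  unfolding ker_def ker1_def ker2_def by (intro continuous_intros; simp)+

lemma line_ker:
  "((\<lambda>t. ker r (z + t *\<^sub>R axis i 1)) has_real_derivative ker1 i r z) (at 0)"
  "((\<lambda>t. ker1 i r (z + t *\<^sub>R axis i 1)) has_real_derivative ker2 i r z) (at 0)"
  using line_has_derivative[OF ker_deriv[of r 0 z], of "axis i 1"]
    line_has_derivative[OF ker1_deriv[of i r 0 z], of "axis i 1"]
  by (simp_all add: ker1_def ker2_def inner_axis power2_eq_square algebra_simps)

lemma ker_zero:
  assumes "norm z \<ge> r" "r > 0"
  shows "ker r z = 0" "ker1 i r z = 0" "ker2 i r z = 0"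
proof -
  have "r\<^sup>2 \<le> (norm z)\<^sup>2" using assms by (intro power_mono) auto
  then show "ker r z = 0" "ker1 i r z = 0" "ker2 i r z = 0"
    by (auto simp: ker_def ker1_def ker2_def)
qed

lemma ker_nonneg: "ker r z \<ge> 0"
  by (simp add: ker_def flat_def)

lemma ker_pos: "norm z < r \<Longrightarrow> ker r z > 0"
  by (auto simp: ker_def intro!: flat_pos power_strict_mono)

text \<open>These parities convert a convolution, in \<open>x - y\<close>, into an integral against
  a test function of \<open>y\<close> centred at \<open>x\<close>; the odd one absorbs the sign in
  the definition of a first weak derivative.\<close>

lemma ker_minus [simp]: "ker r (- z) = ker r z" "ker1 i r (- z) = - ker1 i r z" "ker2 i r (- z) = ker2 i r z"
  by (simp_all add: ker_def ker1_def ker2_def)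

lemma compact_support_bounded:
  fixes f :: "'a::real_normed_vector \<Rightarrow> real"
  assumes "continuous_on UNIV f" "compact K" "\<And>x. x \<notin> K \<Longrightarrow> f x = 0"
  shows "\<exists>B>0. \<forall>x. \<bar>f x\<bar> \<le> B"
proof -
  have "bounded (f ` K)"
    by (intro compact_imp_bounded compact_continuous_image continuous_on_subset[OF assms(1)] assms(2)) auto
  then obtain B where B: "B > 0" "\<And>x. x \<in> K \<Longrightarrow> \<bar>f x\<bar> \<le> B"
    unfolding bounded_pos by auto
  have "\<bar>f x\<bar> \<le> B" for x
    using B assms(3)[of x] by (cases "x \<in> K") auto
  then show ?thesis using B(1) by blast
qed

lemma ker_bounded:
  fixes i :: "'n::finite"
  assumes "r > 0"
  obtains B where "B > 0" "\<And>z::real^'n. \<bar>ker r z\<bar> \<le> B" "\<And>z. \<bar>ker1 i r z\<bar> \<le> B" "\<And>z. \<bar>ker2 i r z\<bar> \<le> B"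
proof -
  have z: "ker r z = 0" "ker1 i r z = 0" "ker2 i r z = 0" if "z \<notin> cball 0 r" for z :: "real^'n"
    using ker_zero[of r z] assms that by auto
  obtain B0 where 0: "B0 > 0" "\<And>z::real^'n. \<bar>ker r z\<bar> \<le> B0"
    using compact_support_bounded[OF ker_continuous(1) compact_cball[of 0 r] z(1)] by auto
  obtain B1 where 1: "B1 > 0" "\<And>z. \<bar>ker1 i r z\<bar> \<le> B1"
    using compact_support_bounded[OF ker_continuous(2) compact_cball[of 0 r] z(2)] by auto
  obtain B2 where 2: "B2 > 0" "\<And>z. \<bar>ker2 i r z\<bar> \<le> B2"
    using compact_support_bounded[OF ker_continuous(3) compact_cball[of 0 r] z(3)] by auto
  have "\<bar>ker r z\<bar> \<le> B0 + B1 + B2" "\<bar>ker1 i r z\<bar> \<le> B0 + B1 + B2" "\<bar>ker2 i r z\<bar> \<le> B0 + B1 + B2" for z :: "real^'n"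
    using 0(1) 1(1) 2(1) 0(2)[of z] 1(2)[of z] 2(2)[of z] by linarith+
  then show ?thesis using that[of "B0 + B1 + B2"] 0(1) 1(1) 2(1) by simp
qed

lemma test_function_ker:
  assumes "r > 0" "cball x r \<subseteq> \<Omega>"
  shows "test_function \<Omega> (\<lambda>y. ker r (y - x))"
proof -
  have "{y. ker r (y - x) \<noteq> 0} = ball x r"
  proof -
    have "ker r (y - x) \<noteq> 0 \<longleftrightarrow> norm (y - x) < r" for y
    proof (cases "norm (y - x) < r")
      case True
      then show ?thesis using ker_pos[of "y - x" r] by simp
    next
      case False
      then show ?thesis using ker_zero(1)[of r "y - x"] assms(1) by simp
    qed
    then show ?thesis by (simp add: ball_def dist_norm norm_minus_commute[of x])
  qed
  moreover have "smooth_on UNIV (\<lambda>y. ker r (y - x))"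
    using flat_algebra_smooth[OF flat_algebra.flat[of 0 r x]] by (simp add: ker_def)
  ultimately show ?thesis
    using assms by (simp add: test_function_def)
qed


section \<open>Mollification\<close>

text \<open>One radius serves all of \<open>K\<close>, and the union of the closed balls is compact
  as the sum of \<open>K\<close> and a closed ball.\<close>

lemma compact_neighbourhood:
  fixes K :: "'a::euclidean_space set"
  assumes "compact K" "open S" "K \<subseteq> S"
  shows "\<exists>K' e. e > 0 \<and> compact K' \<and> K \<subseteq> K' \<and> K' \<subseteq> S \<and> (\<forall>x\<in>K. cball x e \<subseteq> K')"
proof -
  obtain e where e: "e > 0" "(\<Union>x\<in>K. cball x e) \<subseteq> S"
    using compact_subset_open_imp_cball_epsilon_subset[OF assms] by auto
  have "compact {x + y |x y. x \<in> K \<and> y \<in> cball 0 e}"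
    using assms(1) by (intro compact_sums) auto
  also have "{x + y |x y. x \<in> K \<and> y \<in> cball 0 e} = (\<Union>x\<in>K. cball x e)"
  proof (intro set_eqI iffI)
    fix z assume "z \<in> (\<Union>x\<in>K. cball x e)"
    then obtain x where "x \<in> K" "dist x z \<le> e" by auto
    then have "z = x + (z - x) \<and> x \<in> K \<and> z - x \<in> cball 0 e"
      by (simp add: dist_norm norm_minus_commute[of x])
    then show "z \<in> {x + y |x y. x \<in> K \<and> y \<in> cball 0 e}" by blast
  next
    fix z assume "z \<in> {x + y |x y. x \<in> K \<and> y \<in> cball 0 e}"
    then obtain x y where "z = x + y" "x \<in> K" "norm y \<le> e" by auto
    then show "z \<in> (\<Union>x\<in>K. cball x e)" by (auto simp: dist_norm intro!: bexI[of _ x])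
  qed
  finally have "compact (\<Union>x\<in>K. cball x e)" .
  moreover have "K \<subseteq> (\<Union>x\<in>K. cball x e)" using e(1) by force
  ultimately show ?thesis using e by blast
qed

section \<open>Convolution with a bounded continuous kernel\<close>

lemma borel_measurable_reflect:
  fixes h :: "'a::euclidean_space \<Rightarrow> real"
  assumes "continuous_on UNIV h"
  shows "(\<lambda>y. h (x - y)) \<in> borel_measurable borel"
  by (intro borel_measurable_continuous_onI continuous_on_compose2[OF assms]) (auto intro!: continuous_intros)

lemma integrable_convolution:
  fixes f k :: "'a::euclidean_space \<Rightarrow> real"
  assumes f: "integrable lborel f" and k: "continuous_on UNIV k" and B: "\<And>z. \<bar>k z\<bar> \<le> B"
  shows "integrable lborel (\<lambda>y. f y * k (x - y))"
proof (rule Bochner_Integration.integrable_bound)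
  show "integrable lborel (\<lambda>y. B * \<bar>f y\<bar>)" using f by auto
  show "(\<lambda>y. f y * k (x - y)) \<in> borel_measurable lborel"
    using f borel_measurable_reflect[OF k, of x] by measurable
  have "norm (f y * k (x - y)) \<le> B * \<bar>f y\<bar>" for y
    using mult_left_mono[OF B, of "\<bar>f y\<bar>"] by (simp add: abs_mult mult.commute)
  then show "AE y in lborel. norm (f y * k (x - y)) \<le> norm (B * \<bar>f y\<bar>)"
    unfolding real_norm_def[of "B * _"] by (intro AE_I2 order_trans[OF _ abs_ge_self])
qed

text \<open>The derivative falls on the kernel. Its difference quotients are bounded by
  \<open>B\<close>, so everything is dominated by \<open>B * \<bar>f y\<bar>\<close> and no
  regularity of \<open>f\<close> beyond integrability is involved.\<close>

lemma cont_partial_convolution: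
  fixes f k k' :: "real^'n::finite \<Rightarrow> real"
  assumes f: "integrable lborel f" and k: "cont_partial i UNIV k k'"
    and B: "\<And>z. \<bar>k z\<bar> \<le> B" "\<And>z. \<bar>k' z\<bar> \<le> B"
  shows "cont_partial i UNIV (\<lambda>x. LINT y|lborel. f y * k (x - y)) (\<lambda>x. LINT y|lborel. f y * k' (x - y))"
proof -
  let ?e = "axis i (1::real)"
  have [measurable]: "f \<in> borel_measurable borel"
    using f by auto
  have ck: "continuous_on UNIV k" "continuous_on UNIV k'"
    using k by (auto simp: cont_partial_def)
  note meas = borel_measurable_reflect
  have dom: "integrable lborel (\<lambda>y. B * \<bar>f y\<bar>)" using f by auto
  have bnd: "norm (f y * z) \<le> B * \<bar>f y\<bar>" if "\<bar>z\<bar> \<le> B" for y z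
    using mult_left_mono[OF that, of "\<bar>f y\<bar>"] by (simp add: abs_mult mult.commute)
  have cont: "continuous_on UNIV (\<lambda>x. LINT y|lborel. f y * h (x - y))"
    if h: "continuous_on UNIV h" "\<And>z. \<bar>h z\<bar> \<le> B" for h :: "real^'n \<Rightarrow> real"
    unfolding continuous_on_sequentially o_def
  proof (intro ballI allI impI, elim conjE)
    fix X :: "nat \<Rightarrow> real^'n" and x assume X: "X \<longlonglongrightarrow> x"
    show "(\<lambda>n. LINT y|lborel. f y * h (X n - y)) \<longlonglongrightarrow> (LINT y|lborel. f y * h (x - y))"
    proof (rule integral_dominated_convergence[OF _ _ dom])
      show "(\<lambda>y. f y * h (x - y)) \<in> borel_measurable lborel" for x
        using meas[OF h(1)] by measurable
      then show "(\<lambda>y. f y * h (X n - y)) \<in> borel_measurable lborel" for n .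
      show "AE y in lborel. (\<lambda>n. f y * h (X n - y)) \<longlonglongrightarrow> f y * h (x - y)"
      proof (intro AE_I2 tendsto_mult tendsto_const)
        fix y
        have "(\<lambda>n. X n - y) \<longlonglongrightarrow> x - y" using X by (intro tendsto_intros)
        then show "(\<lambda>n. h (X n - y)) \<longlonglongrightarrow> h (x - y)"
          by (intro continuous_on_tendsto_compose[OF h(1)]) auto
      qed
      show "AE y in lborel. norm (f y * h (X n - y)) \<le> B * \<bar>f y\<bar>" for n
        using bnd h(2) by blast
    qed
  qed
  note int = integrable_convolution[OF f ck(1) B(1)]
  have d: "((\<lambda>t. k (z + t *\<^sub>R ?e)) has_real_derivative k' z) (at 0)" for z
    using k by (auto simp: cont_partial_def)
  have "((\<lambda>t. LINT y|lborel. f y * k (x + t *\<^sub>R ?e - y)) has_real_derivative (LINT y|lborel. f y * k' (x - y))) (at 0)" for x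
    unfolding DERIV_def tendsto_at_iff_sequentially o_def
  proof (intro allI impI)
    fix t :: "nat \<Rightarrow> real" assume t: "\<forall>n. t n \<in> UNIV - {0}" "t \<longlonglongrightarrow> 0"
    let ?q = "\<lambda>n y. f y * ((k ((x - y) + t n *\<^sub>R ?e) - k (x - y)) / t n)"
    have "(\<lambda>n. LINT y|lborel. ?q n y) \<longlonglongrightarrow> (LINT y|lborel. f y * k' (x - y))"
    proof (rule integral_dominated_convergence[OF _ _ dom])
      show "(\<lambda>y. f y * k' (x - y)) \<in> borel_measurable lborel"
        using meas[OF ck(2), of x] by measurable
      show "?q n \<in> borel_measurable lborel" for n
        using meas[OF ck(1), of x] meas[OF ck(1), of "x + t n *\<^sub>R ?e"] by (simp add: algebra_simps)
      show "AE y in lborel. (\<lambda>n. ?q n y) \<longlonglongrightarrow> f y * k' (x - y)"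
      proof (intro AE_I2 tendsto_mult tendsto_const)
        fix y
        have "((\<lambda>s. (k ((x - y) + s *\<^sub>R ?e) - k (x - y)) / s) \<longlongrightarrow> k' (x - y)) (at 0)"
          using d[of "x - y"] by (simp add: DERIV_def)
        then show "(\<lambda>n. (k ((x - y) + t n *\<^sub>R ?e) - k (x - y)) / t n) \<longlonglongrightarrow> k' (x - y)"
          by (rule filterlim_compose) (use t in \<open>auto simp: filterlim_at\<close>)
      qed
      show "AE y in lborel. norm (?q n y) \<le> B * \<bar>f y\<bar>" for n
      proof (intro AE_I2 bnd)
        fix y
        have "t n \<noteq> 0" using t by auto
        then show "\<bar>(k ((x - y) + t n *\<^sub>R ?e) - k (x - y)) / t n\<bar> \<le> B"
          using line_lipschitz[of k ?e k' B "x - y" "t n", OF d B(2)] by (simp add: field_simps)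
      qed
    qed
    moreover have "(LINT y|lborel. ?q n y) =
        ((LINT y|lborel. f y * k (x + (0 + t n) *\<^sub>R ?e - y)) - (LINT y|lborel. f y * k (x + 0 *\<^sub>R ?e - y))) / t n" for n
    proof -
      have "((LINT y|lborel. f y * k (x + (0 + t n) *\<^sub>R ?e - y)) - (LINT y|lborel. f y * k (x + 0 *\<^sub>R ?e - y))) / t n
        = (LINT y|lborel. (f y * k (x + t n *\<^sub>R ?e - y) - f y * k (x - y)) / t n)"
        using int[of "x + t n *\<^sub>R ?e"] int[of x] by simp
      also have "\<dots> = (LINT y|lborel. ?q n y)"
        by (intro Bochner_Integration.integral_cong refl) (simp add: algebra_simps)
      finally show ?thesis ..
    qed
    ultimately show "(\<lambda>n. ((LINT y|lborel. f y * k (x + (0 + t n) *\<^sub>R ?e - y)) - (LINT y|lborel. f y * k (x + 0 *\<^sub>R ?e - y))) / t n)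
        \<longlonglongrightarrow> (LINT y|lborel. f y * k' (x - y))" by (simp only:)
  qed
  then show ?thesis
    unfolding cont_partial_def using cont[OF ck(1) B(1)] cont[OF ck(2) B(2)] by blast
qed

lemma borel_measurable_convolution:
  fixes F k :: "'a::euclidean_space \<Rightarrow> real"
  assumes F: "integrable lborel F" and k: "continuous_on UNIV k"
  shows "(\<lambda>y. LINT x|lborel. F x * k (y - x)) \<in> borel_measurable borel"
proof -
  have [measurable]: "F \<in> borel_measurable borel" "k \<in> borel_measurable borel"
    using F borel_measurable_continuous_onI[OF k] by auto
  have "(\<lambda>(y, x). F x * k (y - x)) \<in> borel_measurable (borel \<Otimes>\<^sub>M lborel)" by measurable
  from lborel.borel_measurable_lebesgue_integral[OF this] show ?thesis by simp
qed

text \<open>\<open>d\<close> is only Lebesgue measurable, while Fubini's theorem is applied to the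
  product of Borel measures. So \<open>d\<close> is replaced by a Borel function equal to it almost
  everywhere, and the replacement is undone at the end; the bound on \<open>k\<close> gives
  integrability on the product.\<close>

lemma Fubini_convolution:
  fixes d F k :: "real^'n::finite \<Rightarrow> real"
  assumes d: "integrable lebesgue d" and F: "integrable lborel F"
    and k: "continuous_on UNIV k" "\<And>z. \<bar>k z\<bar> \<le> B"
  shows "(LINT x|lborel. F x * (LINT y|lebesgue. d y * k (y - x))) =
    (LINT y|lebesgue. d y * (LINT x|lborel. F x * k (y - x)))"
proof -
  obtain e where e [measurable]: "e \<in> borel_measurable lborel" and ae: "AE y in lborel. d y = e y"
    using completion_ex_borel_measurable_real[of d lborel] d by auto
  have ae': "AE y in lebesgue. d y = e y" using ae by (rule AE_completion)
  have [measurable]: "F \<in> borel_measurable borel" "k \<in> borel_measurable borel"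
    using F borel_measurable_continuous_onI[OF k(1)] by auto
  have e': "e \<in> borel_measurable lebesgue" by (rule measurable_completion[OF e])
  have "integrable lebesgue e"
    using d ae' e' by (subst integrable_cong_AE[of e lebesgue d]) auto
  then have ie: "integrable lborel e" by (simp add: integrable_completion)
  have p1: "integrable (lborel \<Otimes>\<^sub>M lborel) (\<lambda>(x, y). F x * e y)"
  proof (rule lborel_pair.Fubini_integrable)
    show "(\<lambda>(x, y). F x * e y) \<in> borel_measurable (lborel \<Otimes>\<^sub>M lborel)" by measurable
    have "(\<lambda>x. LINT y|lborel. norm (case (x, y) of (x, y) \<Rightarrow> F x * e y)) = (\<lambda>x. \<bar>F x\<bar> * (LINT y|lborel. \<bar>e y\<bar>))"
      by (simp add: abs_mult)
    then show "integrable lborel (\<lambda>x. LINT y|lborel. norm (case (x, y) of (x, y) \<Rightarrow> F x * e y))"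
      using F by simp
    show "AE x in lborel. integrable lborel (\<lambda>y. case (x, y) of (x, y) \<Rightarrow> F x * e y)"
      using ie by simp
  qed
  have p: "integrable (lborel \<Otimes>\<^sub>M lborel) (\<lambda>(x, y). F x * e y * k (y - x))"
  proof (rule Bochner_Integration.integrable_bound[OF integrable_mult_right[of B, OF integrable_abs[OF p1]]])
    show "(\<lambda>(x, y). F x * e y * k (y - x)) \<in> borel_measurable (lborel \<Otimes>\<^sub>M lborel)" by measurable
    have "B \<ge> 0" using k(2)[of 0] by linarith
    then show "AE x in lborel \<Otimes>\<^sub>M lborel. norm (case x of (x, y) \<Rightarrow> F x * e y * k (y - x))
        \<le> norm (B * \<bar>case x of (x, y) \<Rightarrow> F x * e y\<bar>)"
      using k(2) by (auto simp: abs_mult mult.commute[of B] intro!: AE_I2 mult_left_mono)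
  qed
  have L: "(LINT y|lebesgue. d y * h y) = (LINT y|lborel. e y * h y)" if [measurable]: "h \<in> borel_measurable borel" for h
  proof -
    have h: "h \<in> borel_measurable lebesgue" by (rule measurable_completion) simp
    have "(LINT y|lebesgue. d y * h y) = (LINT y|lebesgue. e y * h y)"
      using ae' d e' h by (intro integral_cong_AE) auto
    also have "\<dots> = (LINT y|lborel. e y * h y)"
      by (rule integral_completion) measurable
    finally show ?thesis .
  qed
  note m = borel_measurable_convolution[OF F k(1)]
  have "(LINT x|lborel. F x * (LINT y|lebesgue. d y * k (y - x))) = (LINT x|lborel. LINT y|lborel. F x * e y * k (y - x))"
    by (subst L) (measurable, simp add: mult.assoc)
  also have "\<dots> = (LINT y|lborel. LINT x|lborel. F x * e y * k (y - x))"
    using lborel_pair.Fubini_integral[OF p] by simp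
  also have "\<dots> = (LINT y|lborel. e y * (LINT x|lborel. F x * k (y - x)))"
    by (simp add: mult.assoc mult.left_commute[of "F _"])
  also have "\<dots> = (LINT y|lebesgue. d y * (LINT x|lborel. F x * k (y - x)))"
    by (rule L[OF m, symmetric])
  finally show ?thesis .
qed

text \<open>The mass by which the kernel is divided to obtain averages. The type argument carries
  the dimension, which \<open>r\<close> alone does not determine.\<close>

definition ker_mass :: "'n::finite itself \<Rightarrow> real \<Rightarrow> real" where
  "ker_mass _ r = (LINT z|lborel. ker r (z :: real^'n))"

lemma ker_integrable: "r > 0 \<Longrightarrow> integrable lborel (ker r :: real^'n::finite \<Rightarrow> real)"
  by (rule integrable_compact_support[OF ker_continuous(1) compact_cball[of 0 r]]) (auto intro: ker_zero)

lemma ker_mass_pos: "r > 0 \<Longrightarrow> ker_mass TYPE('n::finite) r > 0"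
proof -
  assume r: "r > 0"
  have "ker_mass TYPE('n) r \<noteq> 0"
  proof
    assume "ker_mass TYPE('n) r = 0"
    then have "AE z in lborel. ker r (z :: real^'n) = 0"
      using integral_nonneg_eq_0_iff_AE[OF ker_integrable[OF r, where 'n='n]] by (simp add: ker_mass_def ker_nonneg)
    then have "AE z in lborel. z \<notin> ball (0 :: real^'n) r"
      by eventually_elim (use ker_pos in force)
    then have "emeasure lborel (ball (0 :: real^'n) r) = 0"
      by (subst (asm) AE_iff_measurable[of "ball 0 r"]) auto
    then show False
      using content_ball_pos[OF r, of "0 :: real^'n"] by (simp add: measure_def)
  qed
  moreover have "ker_mass TYPE('n) r \<ge> 0"
    unfolding ker_mass_def by (intro integral_nonneg_AE AE_I2 ker_nonneg)
  ultimately show ?thesis by simp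
qed

lemma ker_shift_integral:
  fixes y :: "real^'n::finite"
  assumes "r > 0"
  shows "integrable lborel (\<lambda>x. ker r (y - x))" "(LINT x|lborel. ker r (y - x)) = ker_mass TYPE('n) r"
proof -
  have *: "(\<lambda>x. ker r (y - x)) = (\<lambda>x. ker r (x + - y))"
  proof
    fix x show "ker r (y - x) = ker r (x + - y)"
      using ker_minus(1)[of r "x - y"] by simp
  qed
  show "integrable lborel (\<lambda>x. ker r (y - x))"
    unfolding * by (rule integrable_translate[OF ker_integrable[OF assms]])
  show "(LINT x|lborel. ker r (y - x)) = ker_mass TYPE('n) r"
    unfolding * ker_mass_def
    by (rule lborel_integral_translate) (intro borel_measurable_continuous_onI ker_continuous)
qed

text \<open>The normalised kernel is a probability density on the ball of radius \<open>r\<close>,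
  and an average of values within \<open>e\<close> of \<open>v\<close> is within \<open>e\<close> of
  \<open>v\<close>. With \<open>v = 0\<close> this is a uniform bound; with \<open>v\<close> the
  value at the centre it gives convergence.\<close>

lemma mollify_average:
  fixes H :: "real^'n::finite \<Rightarrow> real"
  assumes r: "r > 0" and i: "integrable lborel (\<lambda>x. H x * ker r (y - x))"
    and e: "\<And>x. dist y x < r \<Longrightarrow> \<bar>H x - v\<bar> \<le> e"
  shows "\<bar>(LINT x|lborel. H x * ker r (y - x)) / ker_mass TYPE('n) r - v\<bar> \<le> e"
proof -
  let ?c = "ker_mass TYPE('n) r"
  note k = ker_shift_integral[OF r, of y]
  have "(LINT x|lborel. H x * ker r (y - x)) - v * ?c = (LINT x|lborel. (H x - v) * ker r (y - x))"
    using i k by (simp add: left_diff_distrib)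
  also have "\<bar>\<dots>\<bar> \<le> (LINT x|lborel. \<bar>(H x - v) * ker r (y - x)\<bar>)"
    by (rule integral_abs_bound)
  also have "\<dots> \<le> (LINT x|lborel. e * ker r (y - x))"
  proof (rule integral_mono)
    show "integrable lborel (\<lambda>x. \<bar>(H x - v) * ker r (y - x)\<bar>)"
      using i k by (simp add: left_diff_distrib)
    show "integrable lborel (\<lambda>x. e * ker r (y - x))" using k by simp
    fix x
    show "\<bar>(H x - v) * ker r (y - x)\<bar> \<le> e * ker r (y - x)"
    proof (cases "dist y x < r")
      case True
      then show ?thesis
        using mult_right_mono[OF e[OF True] ker_nonneg[of r "y - x"]] by (simp add: abs_mult ker_nonneg)
    next
      case False
      then have "ker r (y - x) = 0" using r by (intro ker_zero) (simp_all add: dist_norm)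
      then show ?thesis by simp
    qed
  qed
  also have "\<dots> = e * ?c" using k by simp
  finally have "\<bar>(LINT x|lborel. H x * ker r (y - x)) - v * ?c\<bar> \<le> e * ?c" .
  moreover have "(LINT x|lborel. H x * ker r (y - x)) / ?c - v = ((LINT x|lborel. H x * ker r (y - x)) - v * ?c) / ?c"
    using ker_mass_pos[OF r, where 'n='n] by (simp add: field_simps)
  ultimately show ?thesis
    using ker_mass_pos[OF r, where 'n='n] by (simp add: pos_divide_le_eq)
qed


section \<open>Uniqueness of weak derivatives\<close>

lemma integrable_mult_continuous:
  fixes d F :: "'a::euclidean_space \<Rightarrow> real"
  assumes d: "integrable lebesgue d" and F: "continuous_on UNIV F" "\<And>x. \<bar>F x\<bar> \<le> B"
  shows "integrable lebesgue (\<lambda>y. d y * F y)"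
proof (rule Bochner_Integration.integrable_bound)
  show "integrable lebesgue (\<lambda>y. B * \<bar>d y\<bar>)" using d by auto
  have [measurable]: "F \<in> borel_measurable lebesgue"
    by (rule measurable_completion) (simp add: borel_measurable_continuous_onI[OF F(1)])
  show "(\<lambda>y. d y * F y) \<in> borel_measurable lebesgue"
    using borel_measurable_integrable[OF d] by measurable
  have "norm (d y * F y) \<le> B * \<bar>d y\<bar>" for y
    using mult_left_mono[OF F(2), of "\<bar>d y\<bar>"] by (simp add: abs_mult mult.commute)
  then show "AE y in lebesgue. norm (d y * F y) \<le> norm (B * \<bar>d y\<bar>)"
    unfolding real_norm_def[of "B * _"] by (intro AE_I2 order_trans[OF _ abs_ge_self])
qed

text \<open>By Fubini the mollification is moved from \<open>d\<close>, which is merely integrable,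
  onto the continuous weights. Averages of the weights converge pointwise and boundedly, so
  dominated convergence applies. The weights may vary with \<open>k\<close> because Picone's
  inequality will divide by the mollified function.\<close>

lemma mollify_limit:
  fixes d F :: "real^'n::finite \<Rightarrow> real"
  assumes d: "integrable lebesgue d"
    and K: "compact K" "\<And>k x. x \<notin> K \<Longrightarrow> Fs k x = 0" "\<And>x. x \<notin> K \<Longrightarrow> F x = 0"
    and c: "\<And>k. continuous_on UNIV (Fs k)" "continuous_on UNIV F"
    and u: "uniform_limit UNIV Fs F sequentially"
    and r: "\<And>k. r k > 0" "r \<longlonglongrightarrow> 0"
  shows "(\<lambda>k. LINT x|lborel. Fs k x * ((LINT y|lebesgue. d y * ker (r k) (y - x)) / ker_mass TYPE('n) (r k)))
    \<longlonglongrightarrow> (LINT y|lebesgue. d y * F y)"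
proof -
  let ?c = "\<lambda>k. ker_mass TYPE('n) (r k)"
  define G where "G k y = (LINT x|lborel. Fs k x * ker (r k) (y - x)) / ?c k" for k and y :: "real^'n"
  have iF: "integrable lborel (Fs k)" for k
    by (rule integrable_compact_support[OF c(1) K(1,2)])
  have kb: "\<exists>B. \<forall>z::real^'n. \<bar>ker (r k) z\<bar> \<le> B" for k
    by (rule ker_bounded[OF r(1)[of k]]) blast
  have eq: "(LINT x|lborel. Fs k x * ((LINT y|lebesgue. d y * ker (r k) (y - x)) / ?c k))
     = (LINT y|lebesgue. d y * G k y)" for k
  proof -
    obtain B where "\<And>z::real^'n. \<bar>ker (r k) z\<bar> \<le> B" using kb by blast
    from Fubini_convolution[OF d iF ker_continuous(1) this, of k]
    show ?thesis unfolding G_def by simp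
  qed
  have avg: "\<bar>G k y - v\<bar> \<le> e" if "\<And>x. dist y x < r k \<Longrightarrow> \<bar>Fs k x - v\<bar> \<le> e" for k y v e
  proof -
    obtain B where B: "\<And>z::real^'n. \<bar>ker (r k) z\<bar> \<le> B" using kb by blast
    show ?thesis unfolding G_def
      by (rule mollify_average[OF r(1) integrable_convolution[OF iF ker_continuous(1) B] that])
  qed
  obtain B where B: "\<And>x. \<bar>F x\<bar> \<le> B" using compact_support_bounded[OF c(2) K(1,3)] by blast
  have u': "eventually (\<lambda>k. \<forall>x. \<bar>Fs k x - F x\<bar> < e) sequentially" if "e > 0" for e
    using uniform_limitD[OF u that] by (simp add: dist_real_def)
  \<comment> \<open>Uniform convergence bounds the weights by \<open>B + 1\<close> only from some
    index on; the sequence is shifted so that the domination holds for every index.\<close>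
  obtain N where N: "\<And>k x. k \<ge> N \<Longrightarrow> \<bar>Fs k x - F x\<bar> < 1"
    using u'[of 1] unfolding eventually_sequentially by auto
  have "(\<lambda>k. LINT y|lebesgue. d y * G (k + N) y) \<longlonglongrightarrow> (LINT y|lebesgue. d y * F y)"
  proof (rule integral_dominated_convergence[where w = "\<lambda>y. (B + 1) * \<bar>d y\<bar>"])
    have dm [measurable]: "d \<in> borel_measurable lebesgue" using d by auto
    have [measurable]: "F \<in> borel_measurable lebesgue"
      by (rule measurable_completion) (simp add: borel_measurable_continuous_onI[OF c(2)])
    show "(\<lambda>y. d y * F y) \<in> borel_measurable lebesgue" by measurable
    show "(\<lambda>y. d y * G (k + N) y) \<in> borel_measurable lebesgue" for k
    proof -
      have [measurable]: "(\<lambda>y. LINT x|lborel. Fs (k + N) x * ker (r (k + N)) (y - x)) \<in> borel_measurable lebesgue"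
        by (rule measurable_completion) (simp add: borel_measurable_convolution[OF iF ker_continuous(1)])
      show ?thesis unfolding G_def by measurable
    qed
    show "integrable lebesgue (\<lambda>y. (B + 1) * \<bar>d y\<bar>)" using d by auto
    show "AE y in lebesgue. norm (d y * G (k + N) y) \<le> (B + 1) * \<bar>d y\<bar>" for k
    proof (rule AE_I2)
      fix y
      have "\<bar>G (k + N) y - 0\<bar> \<le> B + 1"
      proof (rule avg)
        fix x show "\<bar>Fs (k + N) x - 0\<bar> \<le> B + 1" using N[of "k + N" x] B[of x] by simp
      qed
      then show "norm (d y * G (k + N) y) \<le> (B + 1) * \<bar>d y\<bar>"
        using mult_left_mono[of "\<bar>G (k + N) y\<bar>" "B + 1" "\<bar>d y\<bar>"] by (simp add: abs_mult mult.commute)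
    qed
    show "AE y in lebesgue. (\<lambda>k. d y * G (k + N) y) \<longlonglongrightarrow> d y * F y"
    proof (intro AE_I2 tendsto_mult tendsto_const LIMSEQ_ignore_initial_segment)
      fix y
      show "(\<lambda>k. G k y) \<longlonglongrightarrow> F y"
      proof (rule tendstoI)
        fix e :: real assume e: "e > 0"
        have "isCont F y" using c(2) by (simp add: continuous_on_eq_continuous_at)
        then obtain del where del: "del > 0" "\<And>x. dist x y < del \<Longrightarrow> dist (F x) (F y) < e / 4"
          unfolding continuous_at_eps_delta by (drule_tac spec[of _ "e / 4"]) (use e in auto)
        have "eventually (\<lambda>k. r k < del) sequentially" using r(2) del(1) by (rule order_tendstoD)
        moreover have "eventually (\<lambda>k. \<forall>x. \<bar>Fs k x - F x\<bar> < e / 4) sequentially" using e by (intro u') auto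
        ultimately show "eventually (\<lambda>k. dist (G k y) (F y) < e) sequentially"
        proof eventually_elim
          case (elim k)
          have "\<bar>G k y - F y\<bar> \<le> e / 2"
          proof (rule avg)
            fix x assume "dist y x < r k"
            then have "dist (F x) (F y) < e / 4" using elim(1) by (intro del(2)) (simp add: dist_commute)
            then show "\<bar>Fs k x - F y\<bar> \<le> e / 2"
              using elim(2)[rule_format, of x] unfolding dist_real_def by linarith
          qed
          then show ?case using e by (simp add: dist_real_def)
        qed
      qed
    qed
  qed
  then show ?thesis unfolding eq by (rule LIMSEQ_offset)
qed

lemma set_integral_localize:
  assumes "\<And>y. y \<notin> K \<Longrightarrow> h y = 0" "K \<subseteq> S"
  shows "(LINT y:S|M. d y * h y) = (LINT y|M. (indicator K y *\<^sub>R d y) * (h y :: real))"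
  unfolding set_lebesgue_integral_def
  by (intro Bochner_Integration.integral_cong refl) (use assms in \<open>auto simp: indicator_def\<close>)

text \<open>Translates of \<open>ker\<close> are test functions, so every mollification of
  \<open>d\<close> with small radius vanishes on \<open>K\<close>. Integrated against
  \<open>F\<close>, these mollifications tend to the integral of \<open>d\<close> times
  \<open>F\<close>.\<close>

lemma weakly_zero_continuous:
  fixes d F :: "real^'n::finite \<Rightarrow> real"
  assumes S: "open S" "locally_integrable S d"
    and t: "\<And>\<eta>. test_function S \<eta> \<Longrightarrow> (LINT x:S|lebesgue. d x * \<eta> x) = 0"
    and F: "continuous_on UNIV F" "compact K" "K \<subseteq> S" "\<And>x. x \<notin> K \<Longrightarrow> F x = 0"
  shows "(LINT x:S|lebesgue. d x * F x) = 0"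
proof -
  obtain K1 e where K1: "e > 0" "compact K1" "K1 \<subseteq> S" "\<And>x. x \<in> K \<Longrightarrow> cball x e \<subseteq> K1" "K \<subseteq> K1"
    using compact_neighbourhood[OF F(2) S(1) F(3)] by blast
  define d0 where "d0 x = indicator K1 x *\<^sub>R d x" for x
  define r where "r k = e / real (Suc k)" for k
  have r: "r k > 0" "r k \<le> e" for k using K1(1) by (auto simp: r_def field_simps)
  have r0: "r \<longlonglongrightarrow> 0" unfolding r_def by (rule LIMSEQ_Suc[OF lim_const_over_n])
  have d0: "integrable lebesgue d0"
    using S(2) K1(2,3) unfolding locally_integrable_def set_integrable_def d0_def by auto
  have z: "F x * ((LINT y|lebesgue. d0 y * ker (r k) (y - x)) / ker_mass TYPE('n) (r k)) = 0" for x k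
  proof (cases "x \<in> K")
    case True
    then have sub: "cball x (r k) \<subseteq> K1" using K1(4)[OF True] subset_cball[OF r(2)[of k], of x] by blast
    have "(LINT x':S|lebesgue. d x' * ker (r k) (x' - x)) = (LINT y|lebesgue. d0 y * ker (r k) (y - x))"
      unfolding d0_def
    proof (rule set_integral_localize[OF _ K1(3)])
      fix y assume "y \<notin> K1"
      then have "y \<notin> cball x (r k)" using sub by auto
      then show "ker (r k) (y - x) = 0"
        using r(1)[of k] by (intro ker_zero) (auto simp: dist_norm norm_minus_commute[of x])
    qed
    moreover have "test_function S (\<lambda>y. ker (r k) (y - x))"
      by (rule test_function_ker[OF r(1) order_trans[OF sub K1(3)]])
    ultimately show ?thesis using t by simp
  qed (simp add: F(4))
  have "(\<lambda>k. LINT x|lborel. F x * ((LINT y|lebesgue. d0 y * ker (r k) (y - x)) / ker_mass TYPE('n) (r k)))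
      \<longlonglongrightarrow> (LINT y|lebesgue. d0 y * F y)"
    by (rule mollify_limit[OF d0 F(2) F(4) F(4) F(1) F(1) _ r(1) r0]) (auto intro: uniform_limit_const)
  then have "(LINT y|lebesgue. d0 y * F y) = 0"
    unfolding z by (simp add: LIMSEQ_const_iff)
  moreover have "(LINT x:S|lebesgue. d x * F x) = (LINT y|lebesgue. d0 y * F y)"
    unfolding d0_def
  proof (rule set_integral_localize[OF _ K1(3)])
    fix y assume "y \<notin> K1"
    then have "y \<notin> K" using K1(5) by auto
    then show "F y = 0" by (rule F(4))
  qed
  ultimately show ?thesis by simp
qed

text \<open>The indicator of \<open>C\<close> is the pointwise limit of continuous cutoffs that are
  1 on \<open>C\<close> and fall linearly with the distance from \<open>C\<close>, ever more
  steeply.\<close>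

lemma weakly_zero_compact:
  fixes d :: "real^'n::finite \<Rightarrow> real"
  assumes S: "open S" "locally_integrable S d"
    and t: "\<And>\<eta>. test_function S \<eta> \<Longrightarrow> (LINT x:S|lebesgue. d x * \<eta> x) = 0"
    and C: "compact C" "C \<subseteq> S"
  shows "(LINT x:C|lebesgue. d x) = 0"
proof (cases "C = {}")
  case False
  obtain K1 e where K1: "e > 0" "compact K1" "K1 \<subseteq> S" "\<And>x. x \<in> C \<Longrightarrow> cball x e \<subseteq> K1" "C \<subseteq> K1"
    using compact_neighbourhood[OF C(1) S(1) C(2)] by blast
  define F where "F k x = max 0 (1 - real (Suc k) / e * infdist x C)" for k x
  have cF: "continuous_on UNIV (F k)" for k
    unfolding F_def by (intro continuous_intros)
  have F1: "\<bar>F k x\<bar> \<le> 1" for k x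
    using K1(1) infdist_nonneg[of x C] by (auto simp: F_def)
  have F0: "F k x = 0" if "x \<notin> K1" for k x
  proof -
    have "infdist x C \<ge> e"
      unfolding infdist_def using False
    proof (simp, intro cINF_greatest)
      fix c assume "c \<in> C"
      then have "x \<notin> cball c e" using K1(4)[of c] that by blast
      then show "e \<le> dist x c" by (simp add: dist_commute)
    qed auto
    then have "1 \<le> infdist x C / e" using K1(1) by simp
    also have "\<dots> \<le> real (Suc k) / e * infdist x C"
      using K1(1) infdist_nonneg[of x C] by (auto simp: field_simps)
    finally show ?thesis by (simp add: F_def)
  qed
  define d0 where "d0 x = indicator K1 x *\<^sub>R d x" for x
  have d0: "integrable lebesgue d0"
    using S(2) K1(2,3) unfolding locally_integrable_def set_integrable_def d0_def by auto
  have "(LINT x:S|lebesgue. d x * F k x) = 0" for k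
    by (rule weakly_zero_continuous[OF S t cF K1(2,3) F0])
  moreover have "(LINT x:S|lebesgue. d x * F k x) = (LINT y|lebesgue. d0 y * F k y)" for k
    unfolding d0_def by (rule set_integral_localize[OF F0 K1(3)])
  ultimately have z: "(LINT y|lebesgue. d0 y * F k y) = 0" for k by simp
  have "(\<lambda>k. LINT y|lebesgue. d0 y * F k y) \<longlonglongrightarrow> (LINT y|lebesgue. indicator C y *\<^sub>R d y)"
  proof (rule integral_dominated_convergence[where w = "\<lambda>y. \<bar>d0 y\<bar>"])
    have dm: "d0 \<in> borel_measurable lebesgue" using d0 by auto
    show "(\<lambda>y. d0 y * F k y) \<in> borel_measurable lebesgue" for k
      by (rule borel_measurable_integrable[OF integrable_mult_continuous[OF d0 cF F1]])
    have "set_integrable lebesgue C d" using S(2) C by (auto simp: locally_integrable_def)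
    then show "(\<lambda>y. indicator C y *\<^sub>R d y) \<in> borel_measurable lebesgue"
      unfolding set_integrable_def by auto
    show "integrable lebesgue (\<lambda>y. \<bar>d0 y\<bar>)" using d0 by auto
    show "AE y in lebesgue. norm (d0 y * F k y) \<le> \<bar>d0 y\<bar>" for k
      using F1 by (auto simp: abs_mult mult_left_le intro!: AE_I2)
    show "AE y in lebesgue. (\<lambda>k. d0 y * F k y) \<longlonglongrightarrow> indicator C y *\<^sub>R d y"
    proof (rule AE_I2)
      fix y
      show "(\<lambda>k. d0 y * F k y) \<longlonglongrightarrow> indicator C y *\<^sub>R d y"
      proof (cases "y \<in> C")
        case True
        then have "F k y = 1" "y \<in> K1" for k
          using K1(5) by (auto simp: F_def)
        then show ?thesis using True by (simp add: d0_def)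
      next
        case False
        then have p: "infdist y C > 0"
          using in_closed_iff_infdist_zero[OF compact_imp_closed[OF C(1)] \<open>C \<noteq> {}\<close>, of y]
            infdist_nonneg[of y C] by linarith
        obtain n where n: "real n > e / infdist y C" using reals_Archimedean2 by blast
        have "F k y = 0" if "k \<ge> n" for k
        proof -
          have "e / infdist y C < real (Suc k)" using n that by linarith
          then have "1 < real (Suc k) / e * infdist y C" using p K1(1) by (simp add: field_simps)
          then show ?thesis by (simp add: F_def)
        qed
        then have "eventually (\<lambda>k. d0 y * F k y = 0) sequentially"
          unfolding eventually_sequentially by auto
        then show ?thesis using False by (simp add: tendsto_eventually)
      qed
    qed
  qed
  then show ?thesis
    unfolding z set_lebesgue_integral_def by (simp add: LIMSEQ_const_iff)
qed (simp add: set_lebesgue_integral_def)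

text \<open>The part of \<open>C\<close> where \<open>d\<close> is positive is approximated from
  inside by closed sets. Each of them is compact, so \<open>d\<close> has integral zero over it
  although it is positive there; hence each is null. The opposite inequality follows from the same
  statement for \<open>-d\<close>.\<close>

lemma weakly_zero_imp_AE_nonpos:
  fixes d :: "real^'n::finite \<Rightarrow> real"
  assumes S: "open S" "locally_integrable S d"
    and t: "\<And>\<eta>. test_function S \<eta> \<Longrightarrow> (LINT x:S|lebesgue. d x * \<eta> x) = 0"
    and C: "compact C" "C \<subseteq> S"
  shows "AE x in lebesgue. x \<in> C \<longrightarrow> d x \<le> 0"
proof -
  define A where "A = {x. indicator C x *\<^sub>R d x > 0}"
  have "set_integrable lebesgue C d" using S(2) C by (auto simp: locally_integrable_def)
  then have [measurable]: "(\<lambda>x. indicator C x *\<^sub>R d x) \<in> borel_measurable lebesgue"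
    unfolding set_integrable_def by auto
  have "{x \<in> space lebesgue. indicator C x *\<^sub>R d x > 0} \<in> sets lebesgue" by measurable
  then have A: "A \<in> sets lebesgue" by (simp add: A_def)
  have AC: "A \<subseteq> C" "\<And>x. x \<in> A \<Longrightarrow> d x > 0"
    by (auto simp: A_def indicator_def of_bool_def split: if_splits)
  have small: "emeasure lebesgue A \<le> 0 + ennreal e" if e: "e > 0" for e :: real
  proof -
    obtain T where T: "closed T" "T \<subseteq> A" "emeasure lebesgue (A - T) < ennreal e"
      by (rule sets_lebesgue_inner_closed[OF A e], rule that)
    have cT: "compact T" "T \<subseteq> S"
      using T AC C by (auto intro: bounded_subset compact_imp_bounded simp: compact_eq_bounded_closed)
    have Ts: "T \<in> sets lebesgue" using T(1) by auto
    have i: "integrable lebesgue (\<lambda>x. indicator T x *\<^sub>R d x)"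
      using S(2) cT unfolding locally_integrable_def set_integrable_def by auto
    have "(LINT x|lebesgue. indicator T x *\<^sub>R d x) = 0"
      using weakly_zero_compact[OF S t cT] by (simp add: set_lebesgue_integral_def)
    moreover have nn: "indicator T x *\<^sub>R d x \<ge> 0" for x
      using T(2) AC(2)[of x] by (auto simp: indicator_def)
    ultimately have "AE x in lebesgue. indicator T x *\<^sub>R d x = 0"
      using integral_nonneg_eq_0_iff_AE[OF i] by auto
    then have "AE x in lebesgue. x \<notin> T"
      by eventually_elim (use T(2) AC(2) in \<open>force simp: indicator_def\<close>)
    then have "emeasure lebesgue T = 0"
      by (subst (asm) AE_iff_measurable[of T]) (use Ts in auto)
    moreover have "emeasure lebesgue A \<le> emeasure lebesgue T + emeasure lebesgue (A - T)"
      using T(2) A Ts emeasure_subadditive[of T lebesgue "A - T"] by (simp add: Un_absorb1)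
    ultimately show ?thesis using T(3) by auto
  qed
  have "emeasure lebesgue A \<le> 0" by (rule ennreal_le_epsilon) (rule small)
  then have "A \<in> null_sets lebesgue" using A by (auto simp: null_sets_def)
  then have "AE x in lebesgue. x \<notin> A" by (rule AE_not_in)
  then show ?thesis by eventually_elim (auto simp: A_def indicator_def)
qed

lemma test_function_D:
  assumes "test_function S \<eta>"
  shows "continuous_on UNIV \<eta>" "\<exists>K. compact K \<and> K \<subseteq> S \<and> (\<forall>x. x \<notin> K \<longrightarrow> \<eta> x = 0)"
proof -
  have "Ck_on 0 UNIV \<eta>" using assms unfolding test_function_def smooth_on_def by blast
  then show "continuous_on UNIV \<eta>" by simp
  show "\<exists>K. compact K \<and> K \<subseteq> S \<and> (\<forall>x. x \<notin> K \<longrightarrow> \<eta> x = 0)"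
    using assms closure_subset[of "{x. \<eta> x \<noteq> 0}"] unfolding test_function_def
    by (intro exI[of _ "closure {x. \<eta> x \<noteq> 0}"]) blast
qed

lemma set_integrable_times_continuous:
  fixes w F :: "real^'n::finite \<Rightarrow> real"
  assumes "locally_integrable S w" "continuous_on UNIV F" "compact K" "K \<subseteq> S" "\<And>x. x \<notin> K \<Longrightarrow> F x = 0"
  shows "set_integrable lebesgue S (\<lambda>x. w x * F x)"
proof -
  have i: "integrable lebesgue (\<lambda>x. indicator K x *\<^sub>R w x)"
    using assms(1,3,4) unfolding locally_integrable_def set_integrable_def by blast
  obtain B where "\<And>x. \<bar>F x\<bar> \<le> B" using compact_support_bounded[OF assms(2,3,5)] by blast
  from integrable_mult_continuous[OF i assms(2) this]
  have "integrable lebesgue (\<lambda>x. indicator K x *\<^sub>R w x * F x)" .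
  also have "(\<lambda>x. indicator K x *\<^sub>R w x * F x) = (\<lambda>x. indicator S x *\<^sub>R (w x * F x))"
  proof
    fix x show "indicator K x *\<^sub>R w x * F x = indicator S x *\<^sub>R (w x * F x)"
      using assms(5)[of x] assms(4) by (cases "x \<in> K") (auto simp: subset_iff)
  qed
  finally show ?thesis unfolding set_integrable_def .
qed

text \<open>\<open>weak_deriv\<close> picks an arbitrary representative; this identifies it almost
  everywhere with a derivative that is computed by other means. The two inequalities are obtained on
  the members of a countable compact exhaustion of \<open>S\<close>.\<close>

lemma has_weak_deriv_unique:
  fixes f :: "real^'n::finite \<Rightarrow> real"
  assumes S: "open S" and v: "has_weak_deriv S is f v" and w: "has_weak_deriv S is f w"
  shows "AE x in lebesgue. x \<in> S \<longrightarrow> v x = w x"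
proof -
  have nonpos: "AE x in lebesgue. x \<in> C \<longrightarrow> v x - w x \<le> 0"
    if v: "has_weak_deriv S is f v" and w: "has_weak_deriv S is f w" and C: "compact C" "C \<subseteq> S" for v w C
  proof (rule weakly_zero_imp_AE_nonpos[OF S _ _ C])
    have l: "locally_integrable S v" "locally_integrable S w"
      using v w by (auto simp: has_weak_deriv_def)
    then show "locally_integrable S (\<lambda>x. v x - w x)"
      unfolding locally_integrable_def by (simp add: set_integral_diff(1))
    fix \<eta> assume t: "test_function S \<eta>"
    obtain K where K: "compact K" "K \<subseteq> S" "\<And>x. x \<notin> K \<Longrightarrow> \<eta> x = 0"
      using test_function_D(2)[OF t] by blast
    note si = set_integrable_times_continuous[OF _ test_function_D(1)[OF t] K]
    have "(-1) ^ length is * (LINT x:S|lebesgue. v x * \<eta> x) = (-1) ^ length is * (LINT x:S|lebesgue. w x * \<eta> x)"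
    proof (rule trans[OF sym])
      show "(LINT x:S|lebesgue. f x * partials is \<eta> x) = (-1) ^ length is * (LINT x:S|lebesgue. v x * \<eta> x)"
        using v t unfolding has_weak_deriv_def by blast
      show "(LINT x:S|lebesgue. f x * partials is \<eta> x) = (-1) ^ length is * (LINT x:S|lebesgue. w x * \<eta> x)"
        using w t unfolding has_weak_deriv_def by blast
    qed
    then have "(LINT x:S|lebesgue. v x * \<eta> x) = (LINT x:S|lebesgue. w x * \<eta> x)" by simp
    then show "(LINT x:S|lebesgue. (v x - w x) * \<eta> x) = 0"
      using set_integral_diff(2)[OF si[OF l(1)] si[OF l(2)]] by (simp add: left_diff_distrib)
  qed
  obtain C :: "nat \<Rightarrow> (real^'n) set" where C: "\<And>n. compact (C n)" "\<And>n. C n \<subseteq> S" "\<Union> (range C) = S"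
    by (rule open_Union_compact_subsets[OF S]) (rule that)
  have "AE x in lebesgue. \<forall>n. x \<in> C n \<longrightarrow> v x = w x"
    unfolding AE_all_countable
  proof
    fix n
    show "AE x in lebesgue. x \<in> C n \<longrightarrow> v x = w x"
      using nonpos[OF v w C(1,2), of n] nonpos[OF w v C(1,2), of n] by eventually_elim auto
  qed
  then show ?thesis
    by eventually_elim (use C(3) in blast)
qed


section \<open>Picone's inequality for weak derivatives\<close>

lemma cont_partial_cmult:
  assumes "cont_partial i S f f'"
  shows "cont_partial i S (\<lambda>x. c * f x) (\<lambda>x. c * f' x)"
  using assms unfolding cont_partial_def
  by (auto intro!: continuous_intros derivative_eq_intros)

lemma mollification_partial:
  fixes f :: "real^'n::finite \<Rightarrow> real"
  assumes f: "integrable lborel f" and r: "r > 0"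
  shows "cont_partial i UNIV (\<lambda>x. LINT y|lborel. f y * ker r (x - y)) (\<lambda>x. LINT y|lborel. f y * ker1 i r (x - y))"
    and "cont_partial i UNIV (\<lambda>x. LINT y|lborel. f y * ker1 i r (x - y)) (\<lambda>x. LINT y|lborel. f y * ker2 i r (x - y))"
proof -
  obtain B where B: "\<And>z::real^'n. \<bar>ker r z\<bar> \<le> B" "\<And>z. \<bar>ker1 i r z\<bar> \<le> B" "\<And>z. \<bar>ker2 i r z\<bar> \<le> B"
    by (rule ker_bounded[OF r, of i], rule that)
  have c: "cont_partial i UNIV (ker r) (ker1 i r)" "cont_partial i UNIV (ker1 i r) (ker2 i r)"
    unfolding cont_partial_def using ker_continuous line_ker by blast+
  show "cont_partial i UNIV (\<lambda>x. LINT y|lborel. f y * ker r (x - y)) (\<lambda>x. LINT y|lborel. f y * ker1 i r (x - y))"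
    and "cont_partial i UNIV (\<lambda>x. LINT y|lborel. f y * ker1 i r (x - y)) (\<lambda>x. LINT y|lborel. f y * ker2 i r (x - y))"
    by (rule cont_partial_convolution[OF f c(1) B(1,2)], rule cont_partial_convolution[OF f c(2) B(2,3)])
qed

lemma lebesgue_lborel_integral:
  fixes f :: "'a::euclidean_space \<Rightarrow> real"
  shows "f \<in> borel_measurable borel \<Longrightarrow> (LINT x|lebesgue. f x) = (LINT x|lborel. f x)"
  by (rule integral_completion) simp

text \<open>The kernel centred at \<open>x\<close> is itself an admissible test function. The
  indicators of \<open>K\<close> change nothing, since the kernel vanishes off \<open>K\<close>, but
  they turn locally integrable functions into integrable ones.\<close>

lemma weak_deriv_mollify:
  fixes \<phi> p :: "real^'n::finite \<Rightarrow> real"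
  assumes w: "has_weak_deriv S is \<phi> p" and r: "r > 0"
    and K: "cball x r \<subseteq> K" "compact K" "K \<subseteq> S" and c: "continuous_on K \<phi>"
    and k: "continuous_on UNIV k" "\<And>y. partials is (\<lambda>y. ker r (y - x)) y = k (y - x)"
      "\<And>z. norm z \<ge> r \<Longrightarrow> k z = 0"
  shows "(LINT y|lborel. (indicator K y *\<^sub>R \<phi> y) * k (y - x)) =
    (-1) ^ length is * (LINT y|lebesgue. (indicator K y *\<^sub>R p y) * ker r (y - x))"
proof -
  have far: "norm (y - x) \<ge> r" if "y \<notin> K" for y
  proof -
    have "y \<notin> cball x r" using that K(1) by blast
    then show ?thesis by (simp add: dist_norm norm_minus_commute[of x])
  qed
  have t: "test_function S (\<lambda>y. ker r (y - x))"
    by (rule test_function_ker[OF r order_trans[OF K(1,3)]])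
  have "(LINT y:S|lebesgue. \<phi> y * k (y - x)) = (-1) ^ length is * (LINT y:S|lebesgue. p y * ker r (y - x))"
  proof -
    have "(LINT y:S|lebesgue. \<phi> y * partials is (\<lambda>y. ker r (y - x)) y) =
        (-1) ^ length is * (LINT y:S|lebesgue. p y * ker r (y - x))"
      using w t unfolding has_weak_deriv_def by blast
    then show ?thesis unfolding k(2) .
  qed
  moreover have "(LINT y:S|lebesgue. \<phi> y * k (y - x)) = (LINT y|lebesgue. (indicator K y *\<^sub>R \<phi> y) * k (y - x))"
    by (rule set_integral_localize[OF _ K(3)]) (use far k(3) in blast)
  moreover have "(LINT y:S|lebesgue. p y * ker r (y - x)) = (LINT y|lebesgue. (indicator K y *\<^sub>R p y) * ker r (y - x))"
    by (rule set_integral_localize[OF _ K(3)]) (use far ker_zero(1) r in blast)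
  moreover have "(LINT y|lebesgue. (indicator K y *\<^sub>R \<phi> y) * k (y - x)) = (LINT y|lborel. (indicator K y *\<^sub>R \<phi> y) * k (y - x))"
  proof (rule lebesgue_lborel_integral, rule borel_measurable_times)
    show "(\<lambda>y. indicator K y *\<^sub>R \<phi> y) \<in> borel_measurable borel"
      using borel_measurable_integrable[OF borel_integrable_compact[OF K(2) c]] by simp
    show "(\<lambda>y. k (y - x)) \<in> borel_measurable borel"
      by (intro borel_measurable_continuous_onI continuous_on_compose2[OF k(1)]) (auto intro!: continuous_intros)
  qed
  ultimately show ?thesis by simp
qed

text \<open>Classical functions to which the pointwise form of Picone's inequality applies. They
  converge uniformly to \<open>\<phi>\<close>, but their derivatives are only described as averages
  of the weak ones: this is all that the weak second derivative allows, and it is exactly what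
  \<open>mollify_limit\<close> consumes.\<close>

lemma mollified_sequence:
  fixes \<phi> p q :: "real^'n::finite \<Rightarrow> real"
  assumes S: "open S" and K: "compact K" "K \<subseteq> S"
    and \<phi>: "continuous_on S \<phi>" "\<forall>x\<in>S. \<phi> x > 0"
    and p: "has_weak_deriv S [i] \<phi> p" and q: "has_weak_deriv S [i, i] \<phi> q"
  shows "\<exists>r P P' P'' p0 q0. (\<forall>k::nat. r k > 0) \<and> r \<longlonglongrightarrow> 0 \<and> integrable lebesgue p0 \<and> integrable lebesgue q0 \<and>
     (\<forall>x\<in>K. p0 x = p x \<and> q0 x = q x) \<and>
     (\<forall>k. cont_partial i UNIV (P k) (P' k) \<and> cont_partial i UNIV (P' k) (P'' k) \<and> (\<forall>x\<in>K. P k x > 0)) \<and>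
     uniform_limit K P \<phi> sequentially \<and>
     (\<forall>k. \<forall>x\<in>K. P' k x = (LINT y|lebesgue. p0 y * ker (r k) (y - x)) / ker_mass TYPE('n) (r k) \<and>
        P'' k x = (LINT y|lebesgue. q0 y * ker (r k) (y - x)) / ker_mass TYPE('n) (r k))"
proof -
  obtain K2 e where K2: "e > 0" "compact K2" "K2 \<subseteq> S" "\<And>x. x \<in> K \<Longrightarrow> cball x e \<subseteq> K2" "K \<subseteq> K2"
    using compact_neighbourhood[OF K(1) S K(2)] by blast
  have c2: "continuous_on K2 \<phi>" by (rule continuous_on_subset[OF \<phi>(1) K2(3)])
  \<comment> \<open>Cutting off at \<open>K2\<close> affects no average over a ball of radius at
    most \<open>e\<close> centred in \<open>K\<close>.\<close>
  define f where "f y = indicator K2 y *\<^sub>R \<phi> y" for y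
  have f: "integrable lborel f" unfolding f_def by (rule borel_integrable_compact[OF K2(2) c2])
  define p0 q0 where "p0 y = indicator K2 y *\<^sub>R p y" and "q0 y = indicator K2 y *\<^sub>R q y" for y
  have pq: "integrable lebesgue p0" "integrable lebesgue q0"
    using p q K2(2,3) unfolding has_weak_deriv_def locally_integrable_def set_integrable_def p0_def q0_def by auto
  obtain m where m: "m > 0" "\<And>x. x \<in> K \<Longrightarrow> \<phi> x \<ge> m"
  proof (cases "K = {}")
    case False
    obtain x where x: "x \<in> K" "\<And>y. y \<in> K \<Longrightarrow> \<phi> x \<le> \<phi> y"
      using continuous_attains_inf[OF K(1) False continuous_on_subset[OF \<phi>(1) K(2)]] by blast
    then show ?thesis using that[of "\<phi> x"] \<phi>(2) K(2) by blast
  qed (use that[of 1] in auto)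
  have "uniformly_continuous_on K2 \<phi>" by (rule compact_uniformly_continuous[OF c2 K2(2)])
  then have uc: "\<exists>d>0. \<forall>x\<in>K2. \<forall>y\<in>K2. dist y x < d \<longrightarrow> dist (\<phi> y) (\<phi> x) < z" if "z > 0" for z
    using that unfolding uniformly_continuous_on_def by blast
  define P where "P r x = inverse (ker_mass TYPE('n) r) * (LINT y|lborel. f y * ker r (x - y))" for r x
  define P' where "P' r x = inverse (ker_mass TYPE('n) r) * (LINT y|lborel. f y * ker1 i r (x - y))" for r x
  define P'' where "P'' r x = inverse (ker_mass TYPE('n) r) * (LINT y|lborel. f y * ker2 i r (x - y))" for r x
  have cp: "cont_partial i UNIV (P r) (P' r)" "cont_partial i UNIV (P' r) (P'' r)" if "r > 0" for r
    unfolding P_def P'_def P''_def by (intro cont_partial_cmult mollification_partial f that)+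
  have P'_eq: "P' r x = (LINT y|lebesgue. p0 y * ker r (y - x)) / ker_mass TYPE('n) r"
    if "r > 0" "r \<le> e" "x \<in> K" for r x
  proof -
    have "cball x r \<subseteq> K2" using K2(4)[OF that(3)] subset_cball[OF that(2), of x] by blast
    from weak_deriv_mollify[OF p that(1) this K2(2,3) c2 ker_continuous(2)[of i r] _ ker_zero(2)[OF _ that(1)]]
    have "(LINT y|lborel. f y * ker1 i r (y - x)) = - (LINT y|lebesgue. p0 y * ker r (y - x))"
      by (simp add: f_def p0_def partials_def partial_ker)
    moreover have "ker1 i r (x - y) = - ker1 i r (y - x)" for y
      using ker_minus(2)[of i r "y - x"] by simp
    ultimately show ?thesis by (simp add: P'_def divide_inverse mult.commute)
  qed
  have P''_eq: "P'' r x = (LINT y|lebesgue. q0 y * ker r (y - x)) / ker_mass TYPE('n) r"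
    if "r > 0" "r \<le> e" "x \<in> K" for r x
  proof -
    have "cball x r \<subseteq> K2" using K2(4)[OF that(3)] subset_cball[OF that(2), of x] by blast
    from weak_deriv_mollify[OF q that(1) this K2(2,3) c2 ker_continuous(3)[of i r] _ ker_zero(3)[OF _ that(1)]]
    have "(LINT y|lborel. f y * ker2 i r (y - x)) = (LINT y|lebesgue. q0 y * ker r (y - x))"
      by (simp add: f_def q0_def partials_def partial_ker partial_ker1)
    moreover have "ker2 i r (x - y) = ker2 i r (y - x)" for y
      using ker_minus(3)[of i r "y - x"] by simp
    ultimately show ?thesis by (simp add: P''_def divide_inverse mult.commute)
  qed
  have close: "\<exists>d>0. \<forall>r x. 0 < r \<and> r < d \<and> r \<le> e \<and> x \<in> K \<longrightarrow> \<bar>P r x - \<phi> x\<bar> \<le> z" if z: "z > 0" for z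
  proof -
    obtain d where d: "d > 0" "\<And>x y. x \<in> K2 \<Longrightarrow> y \<in> K2 \<Longrightarrow> dist y x < d \<Longrightarrow> dist (\<phi> y) (\<phi> x) < z"
      using uc[OF z] by blast
    have "\<bar>P r x - \<phi> x\<bar> \<le> z" if r: "0 < r" "r < d" "r \<le> e" and x: "x \<in> K" for r x
    proof -
      obtain B where B: "\<And>z::real^'n. \<bar>ker r z\<bar> \<le> B"
        by (rule ker_bounded[OF r(1)], rule that)
      have "\<bar>(LINT y|lborel. f y * ker r (x - y)) / ker_mass TYPE('n) r - \<phi> x\<bar> \<le> z"
      proof (rule mollify_average[OF r(1) integrable_convolution[OF f ker_continuous(1) B]])
        fix y assume y: "dist x y < r"
        then have "y \<in> cball x e" using r(3) by simp
        then have "y \<in> K2" using K2(4)[OF x] by blast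
        moreover have "x \<in> K2" using x K2(5) by blast
        moreover have "dist y x < d" using y r(2) by (simp add: dist_commute)
        ultimately have "dist (\<phi> y) (\<phi> x) < z" by (intro d(2))
        then show "\<bar>f y - \<phi> x\<bar> \<le> z" using \<open>y \<in> K2\<close> by (simp add: f_def dist_real_def)
      qed
      then show ?thesis by (simp add: P_def divide_inverse mult.commute)
    qed
    then show ?thesis using d(1) by blast
  qed
  \<comment> \<open>With an error of at most half the lower bound \<open>m\<close> of
    \<open>\<phi>\<close>, the mollified functions remain positive on \<open>K\<close>.\<close>
  obtain d0 where d0: "d0 > 0" "\<And>r x. 0 < r \<Longrightarrow> r < d0 \<Longrightarrow> r \<le> e \<Longrightarrow> x \<in> K \<Longrightarrow> \<bar>P r x - \<phi> x\<bar> \<le> m / 2"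
    using close[of "m / 2"] m(1) by auto
  \<comment> \<open>The radii stay below \<open>e\<close>, so that the balls remain in
    \<open>K2\<close>, and strictly below \<open>d0\<close>, whence the factor 1/2.\<close>
  define r where "r k = min e (d0 / 2) / real (Suc k)" for k
  have r: "r k > 0" "r k \<le> e" "r k < d0" for k
  proof -
    show "r k > 0" using K2(1) d0(1) by (simp add: r_def)
    have "min e (d0 / 2) / real (Suc k) \<le> min e (d0 / 2) / 1"
      using K2(1) d0(1) by (intro divide_left_mono) auto
    then have "r k \<le> min e (d0 / 2)" unfolding r_def by (simp only: div_by_1)
    then show "r k \<le> e" "r k < d0" using d0(1) by auto
  qed
  have r0: "r \<longlonglongrightarrow> 0" unfolding r_def by (rule LIMSEQ_Suc[OF lim_const_over_n])
  have pos: "P (r k) x > 0" if "x \<in> K" for k x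
    using d0(2)[OF r(1,3,2) that, of k] m(2)[OF that] m(1) by linarith
  have ul: "uniform_limit K (\<lambda>k. P (r k)) \<phi> sequentially"
  proof (rule uniform_limitI)
    fix z :: real assume "z > 0"
    then obtain d where d: "d > 0" "\<And>r x. 0 < r \<Longrightarrow> r < d \<Longrightarrow> r \<le> e \<Longrightarrow> x \<in> K \<Longrightarrow> \<bar>P r x - \<phi> x\<bar> \<le> z / 2"
      using close[of "z / 2"] by auto
    have "eventually (\<lambda>k. r k < d) sequentially" using r0 d(1) by (rule order_tendstoD)
    then show "eventually (\<lambda>k. \<forall>x\<in>K. dist (P (r k) x) (\<phi> x) < z) sequentially"
    proof eventually_elim
      case (elim k)
      show ?case
      proof
        fix x assume "x \<in> K"
        then have "\<bar>P (r k) x - \<phi> x\<bar> \<le> z / 2" by (rule d(2)[OF r(1) elim r(2)])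
        then show "dist (P (r k) x) (\<phi> x) < z" using \<open>z > 0\<close> by (simp add: dist_real_def)
      qed
    qed
  qed
  show ?thesis
  proof (rule exI[of _ r], rule exI[of _ "\<lambda>k. P (r k)"], rule exI[of _ "\<lambda>k. P' (r k)"], rule exI[of _ "\<lambda>k. P'' (r k)"],
      rule exI[of _ p0], rule exI[of _ q0], intro conjI allI ballI)
    fix x assume "x \<in> K"
    then have "x \<in> K2" using K2(5) by blast
    then show "p0 x = p x" "q0 x = q x" by (simp_all add: p0_def q0_def)
  qed (use r r0 pq cp pos ul P'_eq P''_eq in \<open>auto simp del: scaleR_conv_of_real\<close>)
qed

text \<open>The pointwise inequality holds for every mollification of \<open>\<phi>\<close>. In the
  limit the weights a e^2 / P and a' e^2 / P converge uniformly, because \<open>\<phi>\<close> is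
  bounded below on a compact set, while the derivatives of P converge only after integration against
  such weights.\<close>

lemma weak_picone_partial:
  fixes \<phi> p q :: "real^'n::finite \<Rightarrow> real"
  assumes S: "open S" "compact K" "K \<subseteq> S"
    and \<phi>: "continuous_on S \<phi>" "\<forall>x\<in>S. \<phi> x > 0"
    and p: "has_weak_deriv S [i] \<phi> p" and q: "has_weak_deriv S [i, i] \<phi> q"
    and a: "cont_partial i S a a'" "\<And>x. x \<in> S \<Longrightarrow> a x > 0"
    and e: "cont_partial i S e e'" "\<And>x. x \<in> S \<Longrightarrow> x \<notin> K \<Longrightarrow> e x = 0"
  defines "G \<equiv> \<lambda>x. if x \<in> K then (a x * q x + a' x * p x) * (e x)\<^sup>2 / \<phi> x + a x * (e' x)\<^sup>2 else 0"
  shows "integrable lebesgue G" "integral\<^sup>L lebesgue G \<ge> 0"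
proof -
  obtain K1 where K1: "compact K1" "K1 \<subseteq> S" "K \<subseteq> K1" and nb: "\<exists>d>0. \<forall>x\<in>K. cball x d \<subseteq> K1"
    using compact_neighbourhood[OF S(2,1,3)] by blast
  \<comment> \<open>Picone's inequality lives on an open set, the description of the mollified
    derivatives on a compact one; the interior of \<open>K1\<close> fits both and still contains
    \<open>K\<close>.\<close>
  define T where "T = interior K1"
  have T: "open T" "T \<subseteq> K1" "T \<subseteq> S" "K \<subseteq> T"
  proof -
    show "open T" "T \<subseteq> K1" using interior_subset by (auto simp: T_def)
    then show "T \<subseteq> S" using K1(2) by blast
    show "K \<subseteq> T"
    proof
      fix x assume "x \<in> K"
      then obtain d where "d > 0" "cball x d \<subseteq> K1" using nb by blast
      then show "x \<in> T" unfolding T_def mem_interior_cball by blast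
    qed
  qed
  obtain r P P' P'' p0 q0 where r': "\<forall>k::nat. r k > 0" and r0: "r \<longlonglongrightarrow> 0"
    and pq: "integrable lebesgue p0" "integrable lebesgue q0" and pq': "\<forall>x\<in>K1. p0 x = p x \<and> q0 x = q x"
    and cp: "\<forall>k. cont_partial i UNIV (P k) (P' k) \<and> cont_partial i UNIV (P' k) (P'' k) \<and> (\<forall>x\<in>K1. P k x > 0)"
    and ul: "uniform_limit K1 P \<phi> sequentially"
    and PP: "\<forall>k. \<forall>x\<in>K1. P' k x = (LINT y|lebesgue. p0 y * ker (r k) (y - x)) / ker_mass TYPE('n) (r k) \<and>
        P'' k x = (LINT y|lebesgue. q0 y * ker (r k) (y - x)) / ker_mass TYPE('n) (r k)"
    using mollified_sequence[OF S(1) K1(1,2) \<phi> p q] by (elim exE conjE) (rule that)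
  have r: "\<And>k. r k > 0" using r' by blast
  have P: "cont_partial i UNIV (P k) (P' k)" "cont_partial i UNIV (P' k) (P'' k)" "x \<in> K1 \<Longrightarrow> P k x > 0" for k x
    using cp by blast+
  have P': "P' k x = (LINT y|lebesgue. p0 y * ker (r k) (y - x)) / ker_mass TYPE('n) (r k)"
    and P'': "P'' k x = (LINT y|lebesgue. q0 y * ker (r k) (y - x)) / ker_mass TYPE('n) (r k)"
    if "x \<in> K1" for k x
    using PP that by blast+
  have cf: "continuous_on T a" "continuous_on T a'" "continuous_on T e" "continuous_on T e'" "continuous_on T \<phi>"
    using a(1) e(1) \<phi>(1) T(3) continuous_on_subset by (auto simp: cont_partial_def)
  have cP: "continuous_on T (P k)" "continuous_on T (P' k)" "continuous_on T (P'' k)" for k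
    using P(1,2)[of k] continuous_on_subset[of UNIV _ T] by (auto simp: cont_partial_def)
  have eK: "e x = 0" "e' x = 0" if "x \<in> T" "x \<notin> K" for x
    using e(2) cont_partial_zero_off[OF e(1) S(1) compact_imp_closed[OF S(2)] e(2)] that T(3) by blast+
  have P0: "P k x \<noteq> 0" "\<phi> x \<noteq> 0" if "x \<in> T" for k x
    using P(3)[of x k] \<phi>(2) that T(2,3) by force+
  obtain m where m: "m > 0" "\<And>x. x \<in> K1 \<Longrightarrow> \<phi> x \<ge> m"
  proof (cases "K1 = {}")
    case False
    obtain x where x: "x \<in> K1" "\<And>y. y \<in> K1 \<Longrightarrow> \<phi> x \<le> \<phi> y"
      using continuous_attains_inf[OF K1(1) False continuous_on_subset[OF \<phi>(1) K1(2)]] by blast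
    then show ?thesis using that[of "\<phi> x"] \<phi>(2) K1(2) by blast
  qed (use that[of 1] in auto)
  \<comment> \<open>Used twice below: with \<open>w = a\<close> against the second weak derivative,
    and with \<open>w = a'\<close> against the first.\<close>
  have weight: "(\<lambda>k. LINT x|lborel. (if x \<in> T then w x * (e x)\<^sup>2 / P k x else 0) *
        ((LINT y|lebesgue. d y * ker (r k) (y - x)) / ker_mass TYPE('n) (r k)))
      \<longlonglongrightarrow> (LINT y|lebesgue. d y * (if y \<in> T then w y * (e y)\<^sup>2 / \<phi> y else 0))" (is ?lim)
    and wint: "integrable lebesgue (\<lambda>y. d y * (if y \<in> T then w y * (e y)\<^sup>2 / \<phi> y else 0))" (is ?int)
    if w: "continuous_on T w" and d: "integrable lebesgue d" for w d
  proof -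
    let ?Fs = "\<lambda>k x. if x \<in> T then w x * (e x)\<^sup>2 / P k x else 0"
    let ?F = "\<lambda>x. if x \<in> T then w x * (e x)\<^sup>2 / \<phi> x else 0"
    have z: "?Fs k x = 0" "?F x = 0" if "x \<notin> K" for k x using eK that by auto
    have c: "continuous_on UNIV (?Fs k)" for k
      by (rule continuous_on_extend_zero[OF _ T(1) S(2) T(4)])
        (use P0 eK in \<open>auto intro!: continuous_intros w cf cP\<close>)
    have cF: "continuous_on UNIV ?F"
      by (rule continuous_on_extend_zero[OF _ T(1) S(2) T(4)])
        (use P0 eK in \<open>auto intro!: continuous_intros w cf cP\<close>)
    have uK: "uniform_limit K P \<phi> sequentially" by (rule uniform_limit_on_subset[OF ul K1(3)])
    have "continuous_on K (\<lambda>x. w x * (e x)\<^sup>2)"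
      by (intro continuous_intros continuous_on_subset[OF w T(4)] continuous_on_subset[OF cf(3) T(4)])
    then have bK: "bounded ((\<lambda>x. w x * (e x)\<^sup>2) ` K)"
      by (intro compact_imp_bounded compact_continuous_image S(2))
    have u: "uniform_limit K (\<lambda>k x. w x * (e x)\<^sup>2 / P k x) (\<lambda>x. w x * (e x)\<^sup>2 / \<phi> x) sequentially"
    proof (rule uniform_lim_divide[OF uniform_limit_const uK bK _ m(1)])
      fix x assume "x \<in> K"
      then have "m \<le> \<phi> x" using m(2) K1(3) by blast
      then show "m \<le> norm (\<phi> x)" by simp
    qed
    have u2: "uniform_limit UNIV ?Fs ?F sequentially"
    proof (rule uniform_limitI)
      fix z :: real assume z0: "z > 0"
      from uniform_limitD[OF u this]
      show "eventually (\<lambda>k. \<forall>x\<in>UNIV. dist (?Fs k x) (?F x) < z) sequentially"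
      proof eventually_elim
        case (elim k)
        show ?case
        proof
          fix x show "dist (?Fs k x) (?F x) < z"
          proof (cases "x \<in> K")
            case True
            then show ?thesis using elim T(4) by auto
          next
            case False
            then show ?thesis using z[OF False] z0 by simp
          qed
        qed
      qed
    qed
    show ?lim by (rule mollify_limit[OF d S(2) z(1) z(2) c cF u2 r r0])
    obtain B where "\<And>x. \<bar>?F x\<bar> \<le> B" using compact_support_bounded[OF cF S(2) z(2)] by blast
    then show ?int by (rule integrable_mult_continuous[OF d cF])
  qed
  let ?E = "\<lambda>x. if x \<in> T then a x * (e' x)\<^sup>2 else 0"
  have iE: "integrable lborel ?E"
    by (rule integrable_extend_zero[OF _ T(1) S(2) T(4)])
      (use eK in \<open>auto intro!: continuous_intros cf\<close>)
  let ?f = "\<lambda>w k x. if x \<in> T then w x * (e x)\<^sup>2 / P k x else 0"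
  have i1: "integrable lborel (\<lambda>x. ?f w k x * h x)"
    if "continuous_on T w" "continuous_on T h" for w k h
  proof -
    have "integrable lborel (\<lambda>x. if x \<in> T then w x * (e x)\<^sup>2 / P k x * h x else 0)"
      by (rule integrable_extend_zero[OF _ T(1) S(2) T(4)])
        (use P0 eK in \<open>auto intro!: continuous_intros that cf cP\<close>)
    then show ?thesis by (rule back_subst[where P = "integrable lborel"]) auto
  qed
  have step: "0 \<le> (LINT x|lborel. ?f a k x * ((LINT y|lebesgue. q0 y * ker (r k) (y - x)) / ker_mass TYPE('n) (r k)))
     + (LINT x|lborel. ?f a' k x * ((LINT y|lebesgue. p0 y * ker (r k) (y - x)) / ker_mass TYPE('n) (r k)))
     + integral\<^sup>L lborel ?E" for k
  proof -
    let ?G = "\<lambda>x. if x \<in> T then (a x * P'' k x + a' x * P' k x) * (e x)\<^sup>2 / P k x + a x * (e' x)\<^sup>2 else 0"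
    have "0 \<le> integral\<^sup>L lborel ?G"
    proof (rule picone_partial(2)[OF T(1) S(2) T(4)])
      show "cont_partial i T a a'" "cont_partial i T e e'" "cont_partial i T (P k) (P' k)" "cont_partial i T (P' k) (P'' k)"
        using a(1) e(1) P(1,2) cont_partial_subset T(3) by blast+
      show "a x > 0" "P k x > 0" if "x \<in> T" for x
        using that a(2) P(3) T(2,3) by blast+
      show "e x = 0" if "x \<in> T" "x \<notin> K" for x using eK that by blast
    qed
    also have "?G = (\<lambda>x. ?f a k x * P'' k x + ?f a' k x * P' k x + ?E x)"
      by (rule ext) (auto simp: add_divide_distrib algebra_simps)
    also have "integral\<^sup>L lborel \<dots> = (LINT x|lborel. ?f a k x * P'' k x) + (LINT x|lborel. ?f a' k x * P' k x) + integral\<^sup>L lborel ?E"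
      using i1[OF cf(1) cP(3)] i1[OF cf(2) cP(2)] iE by simp
    also have "(LINT x|lborel. ?f a k x * P'' k x) =
        (LINT x|lborel. ?f a k x * ((LINT y|lebesgue. q0 y * ker (r k) (y - x)) / ker_mass TYPE('n) (r k)))"
      by (intro Bochner_Integration.integral_cong refl) (use P'' T(2) in auto)
    also have "(LINT x|lborel. ?f a' k x * P' k x) =
        (LINT x|lborel. ?f a' k x * ((LINT y|lebesgue. p0 y * ker (r k) (y - x)) / ker_mass TYPE('n) (r k)))"
      by (intro Bochner_Integration.integral_cong refl) (use P' T(2) in auto)
    finally show ?thesis .
  qed
  let ?g = "\<lambda>w x. if x \<in> T then w x * (e x)\<^sup>2 / \<phi> x else 0"
  have lim: "0 \<le> (LINT y|lebesgue. q0 y * ?g a y) + (LINT y|lebesgue. p0 y * ?g a' y) + integral\<^sup>L lborel ?E"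
    by (rule LIMSEQ_le_const[OF tendsto_add[OF tendsto_add[OF weight[OF cf(1) pq(2)] weight[OF cf(2) pq(1)]] tendsto_const]])
      (use step in blast)
  have iE': "integrable lebesgue ?E" "integral\<^sup>L lebesgue ?E = integral\<^sup>L lborel ?E"
    using iE by (simp_all add: integrable_completion integral_completion borel_measurable_integrable)
  have G: "G = (\<lambda>x. q0 x * ?g a x + p0 x * ?g a' x + ?E x)"
  proof
    fix x
    show "G x = q0 x * ?g a x + p0 x * ?g a' x + ?E x"
    proof (cases "x \<in> K")
      case True
      then have "x \<in> T" "x \<in> K1" using T by auto
      then show ?thesis using True pq' by (simp add: G_def add_divide_distrib algebra_simps)
    next
      case False
      then show ?thesis using eK[of x] by (simp add: G_def)
    qed
  qed
  show "integrable lebesgue G" unfolding G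
    using wint[OF cf(1) pq(2)] wint[OF cf(2) pq(1)] iE'(1) by simp
  show "integral\<^sup>L lebesgue G \<ge> 0" unfolding G
    using wint[OF cf(1) pq(2)] wint[OF cf(2) pq(1)] iE' lim by simp
qed


section \<open>Truncations and the Poincare inequality\<close>

lemma Ck_on_2_cont_partial:
  fixes u :: "real^'n::finite \<Rightarrow> real"
  assumes "Ck_on 2 S u" "open S"
  shows "cont_partial i S u (partial i u)" "cont_partial i S (partial i u) (partials [i, i] u)"
proof -
  have d: "u differentiable_on S" "partial i u differentiable_on S" "continuous_on S (partial i (partial i u))"
    using assms(1) by (auto simp: numeral_2_eq_2)
  have line: "((\<lambda>t. f (x + t *\<^sub>R axis i 1)) has_real_derivative partial i f x) (at 0)"
    if "f differentiable_on S" "x \<in> S" for f x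
  proof -
    have "f differentiable (at x)"
      using that assms(2) by (simp add: differentiable_on_eq_differentiable_at)
    then have "(f has_derivative frechet_derivative f (at x)) (at x)"
      by (simp add: frechet_derivative_works)
    from line_has_derivative[OF this] show ?thesis unfolding partial_def .
  qed
  show "cont_partial i S u (partial i u)" "cont_partial i S (partial i u) (partials [i, i] u)"
    unfolding cont_partial_def using d line differentiable_imp_continuous_on by (auto simp: partials_def)
qed

text \<open>A constant on the left joins differentiably at \<open>c\<close> because
  \<open>f'\<close> vanishes there. If moreover \<open>f c = 0\<close>, then
  \<open>f (max c (u x))\<close> is zero wherever \<open>u x \<le> c\<close>, which makes it a
  compactly supported test function.\<close>

lemma DERIV_freeze:
  fixes f f' :: "real \<Rightarrow> real"
  assumes d: "\<And>s. s \<ge> c \<Longrightarrow> (f has_real_derivative f' s) (at s)" and c: "f' c = 0"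
  shows "((\<lambda>s. f (max c s)) has_real_derivative f' (max c s)) (at s)"
proof -
  consider "s > c" | "s < c" | "s = c" by linarith
  then show ?thesis
  proof cases
    case 1
    have "eventually (\<lambda>t. t \<in> {c<..}) (nhds s)" using 1 by (intro eventually_nhds_in_open) auto
    then have ev: "eventually (\<lambda>t. f (max c t) = f t) (nhds s)" by eventually_elim auto
    show ?thesis
      using 1 d[of s] by (subst DERIV_cong_ev[OF refl ev refl]) (simp add: max_def)
  next
    case 2
    have "eventually (\<lambda>t. t \<in> {..<c}) (nhds s)" using 2 by (intro eventually_nhds_in_open) auto
    then have ev: "eventually (\<lambda>t. f (max c t) = f c) (nhds s)" by eventually_elim auto
    show ?thesis
      using 2 c by (subst DERIV_cong_ev[OF refl ev refl]) (simp add: max_def)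
  next
    case 3
    have "(f has_derivative (\<lambda>h. 0 * h)) (at c)"
      using d[OF order_refl] unfolding c has_field_derivative_def .
    then have alt: "\<forall>e>0. \<exists>z>0. \<forall>y. norm (y - c) < z \<longrightarrow> norm (f y - f c - 0 * (y - c)) \<le> e * norm (y - c)"
      unfolding has_derivative_at_alt by blast
    have "((\<lambda>s. f (max c s)) has_derivative (\<lambda>h. 0 * h)) (at c)"
      unfolding has_derivative_at_alt
    proof (intro conjI allI impI)
      fix e :: real assume e: "e > 0"
      then obtain z where z: "z > 0" "\<forall>y. norm (y - c) < z \<longrightarrow> norm (f y - f c - 0 * (y - c)) \<le> e * norm (y - c)"
        using alt by blast
      have "norm (f (max c y) - f (max c c) - 0 * (y - c)) \<le> e * norm (y - c)" if y: "norm (y - c) < z" for y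
      proof (cases "y \<ge> c")
        case True
        then show ?thesis using z(2)[rule_format, OF y] by (simp add: max_def)
      next
        case False
        then show ?thesis using e by (simp add: max_def)
      qed
      then show "\<exists>z>0. \<forall>y. norm (y - c) < z \<longrightarrow> norm (f (max c y) - f (max c c) - 0 * (y - c)) \<le> e * norm (y - c)"
        using z(1) by blast
    qed (auto intro: bounded_linear_mult_right)
    then show ?thesis unfolding 3 has_field_derivative_def max.idem c .
  qed
qed

lemma cont_partial_freeze:
  assumes u: "cont_partial i S u u'"
    and d: "\<And>s. s \<ge> c \<Longrightarrow> (f has_real_derivative f' s) (at s)" and c: "f' c = 0"
    and cont: "continuous_on {c..} f'"
  shows "cont_partial i S (\<lambda>x. f (max c (u x))) (\<lambda>x. f' (max c (u x)) * u' x)"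
proof (rule cont_partial_compose[OF u, of "\<lambda>s. f (max c s)" "\<lambda>s. f' (max c s)"])
  show "((\<lambda>s. f (max c s)) has_real_derivative f' (max c (u x))) (at (u x))" for x
    by (rule DERIV_freeze[OF d c])
  show "continuous_on (u ` S) (\<lambda>s. f' (max c s))"
    by (rule continuous_on_compose2[OF cont]) (auto intro!: continuous_intros)
qed

text \<open>The directional inequality with weight 1, summed over the coordinates. A pointwise lower
  bound on -Laplacian(P) / P thus becomes an integral inequality between a test function and its
  gradient.\<close>

lemma picone:
  fixes P e :: "real^'n::finite \<Rightarrow> real"
  assumes S: "open S" "compact K" "K \<subseteq> S"
    and P: "\<And>i. cont_partial i S P (P' i)" "\<And>i. cont_partial i S (P' i) (P'' i)" "\<And>x. x \<in> S \<Longrightarrow> P x > 0"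
    and e: "\<And>i. cont_partial i S e (e' i)" "\<And>x. x \<in> S \<Longrightarrow> x \<notin> K \<Longrightarrow> e x = 0"
  shows "integrable lborel (\<lambda>x. if x \<in> S then (- (\<Sum>i\<in>UNIV. P'' i x)) * (e x)\<^sup>2 / P x else 0)"
    and "integrable lborel (\<lambda>x. if x \<in> S then (\<Sum>i\<in>UNIV. (e' i x)\<^sup>2) else 0)"
    and "(LINT x|lborel. (if x \<in> S then (- (\<Sum>i\<in>UNIV. P'' i x)) * (e x)\<^sup>2 / P x else 0)) \<le>
      (LINT x|lborel. (if x \<in> S then (\<Sum>i\<in>UNIV. (e' i x)\<^sup>2) else 0))"
proof -
  have c: "continuous_on S P" "continuous_on S (P'' i)" "continuous_on S e" "continuous_on S (e' i)" for i
    using P(1,2)[of i] e(1)[of i] by (auto simp: cont_partial_def)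
  have P0: "\<forall>x\<in>S. P x \<noteq> 0" using P(3) by force
  have e'0: "e' i x = 0" if "x \<in> S" "x \<notin> K" for i x
    by (rule cont_partial_zero_off[OF e(1) S(1) compact_imp_closed[OF S(2)] e(2) that])
  let ?L = "\<lambda>x. if x \<in> S then (- (\<Sum>i\<in>UNIV. P'' i x)) * (e x)\<^sup>2 / P x else 0"
  let ?R = "\<lambda>x. if x \<in> S then (\<Sum>i\<in>UNIV. (e' i x)\<^sup>2) else 0"
  show L: "integrable lborel ?L"
  proof (rule integrable_extend_zero[OF _ S])
    show "continuous_on S (\<lambda>x. (- (\<Sum>i\<in>UNIV. P'' i x)) * (e x)\<^sup>2 / P x)"
      by (intro continuous_intros c P0)
  qed (simp add: e(2))
  show R: "integrable lborel ?R"
  proof (rule integrable_extend_zero[OF _ S])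
    show "continuous_on S (\<lambda>x. \<Sum>i\<in>UNIV. (e' i x)\<^sup>2)" by (intro continuous_intros c)
  qed (simp add: e'0)
  let ?G = "\<lambda>i x. if x \<in> S then (1 * P'' i x + 0 * P' i x) * (e x)\<^sup>2 / P x + 1 * (e' i x)\<^sup>2 else 0"
  have G: "integrable lborel (?G i)" "integral\<^sup>L lborel (?G i) \<ge> 0" for i
    by (rule picone_partial[OF S cont_partial_const _ P(1,2,3) e]; simp)+
  have "0 \<le> (\<Sum>i\<in>UNIV. integral\<^sup>L lborel (?G i))" by (intro sum_nonneg G(2))
  also have "\<dots> = (LINT x|lborel. (\<Sum>i\<in>UNIV. ?G i x))"
    by (rule Bochner_Integration.integral_sum[symmetric]) (rule G(1))
  also have "(\<lambda>x. \<Sum>i\<in>UNIV. ?G i x) = (\<lambda>x. ?R x - ?L x)"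
    by (rule ext) (simp add: sum.distrib sum_distrib_right sum_divide_distrib)
  also have "integral\<^sup>L lborel (\<lambda>x. ?R x - ?L x) = integral\<^sup>L lborel ?R - integral\<^sup>L lborel ?L"
    by (rule Bochner_Integration.integral_diff[OF R L])
  finally show "integral\<^sup>L lborel ?L \<le> integral\<^sup>L lborel ?R" by simp
qed

section \<open>The Poincare inequality through a quadratic comparison function\<close>

lemma cont_partial_norm_sq:
  fixes i :: "'n::finite"
  shows "cont_partial i S (\<lambda>x. (norm x)\<^sup>2) (\<lambda>x. 2 * x $ i)"
  unfolding cont_partial_def
proof (intro conjI ballI)
  fix x :: "real^'n"
  have "((\<lambda>x. x \<bullet> x) has_derivative (\<lambda>h. 2 * (x \<bullet> h))) (at x)"
    by (auto intro!: derivative_eq_intros simp: inner_commute)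
  from line_has_derivative[OF this, of "axis i 1"]
  show "((\<lambda>t. (norm (x + t *\<^sub>R axis i 1))\<^sup>2) has_real_derivative 2 * x $ i) (at 0)"
    by (simp add: dot_square_norm inner_axis)
qed (intro continuous_intros)+

lemma cont_partial_coord:
  fixes i :: "'n::finite"
  shows "cont_partial i S (\<lambda>x. x $ i) (\<lambda>x. 1)"
  unfolding cont_partial_def
proof (intro conjI ballI)
  fix x :: "real^'n"
  from line_has_derivative[OF bounded_linear_imp_has_derivative[OF bounded_linear_vec_nth[of i]], of x "axis i 1"]
  show "((\<lambda>t. (x + t *\<^sub>R axis i 1) $ i) has_real_derivative 1) (at 0)" by (simp add: axis_def)
qed (intro continuous_intros)+

text \<open>For P = \<rho>^2 - |x|^2, -Laplacian(P) is twice the dimension and 0 < P \<le> \<rho>^2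
  on \<open>S\<close>, so the quotient in Picone's inequality is at least 1 / \<rho>^2.\<close>

lemma poincare:
  fixes e :: "real^'n::finite \<Rightarrow> real"
  assumes S: "open S" "compact K" "K \<subseteq> S" and rho: "S \<subseteq> ball 0 \<rho>" "\<rho> > 0"
    and e: "\<And>i. cont_partial i S e (e' i)" "\<And>x. x \<in> S \<Longrightarrow> x \<notin> K \<Longrightarrow> e x = 0"
  shows "integrable lborel (\<lambda>x. if x \<in> S then (e x)\<^sup>2 else 0)"
    and "(LINT x|lborel. (if x \<in> S then (e x)\<^sup>2 else 0)) \<le>
     \<rho>\<^sup>2 * (LINT x|lborel. (if x \<in> S then (\<Sum>i\<in>UNIV. (e' i x)\<^sup>2) else 0))"
proof -
  have ce: "continuous_on S e" using e(1) by (auto simp: cont_partial_def)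
  let ?P = "\<lambda>x :: real^'n. \<rho>\<^sup>2 + (- 1) * (norm x)\<^sup>2"
  have P: "cont_partial i S ?P (\<lambda>x. 0 + (- 1) * (2 * x $ i))" for i
    by (intro cont_partial_add cont_partial_const cont_partial_cmult cont_partial_norm_sq)
  have P1: "cont_partial i S (\<lambda>x. 0 + (- 1) * (2 * x $ i)) (\<lambda>x. 0 + (- 1) * (2 * 1))" for i
    by (intro cont_partial_add cont_partial_const cont_partial_cmult cont_partial_coord)
  have Ppos: "?P x > 0" if "x \<in> S" for x
  proof -
    have "norm x < \<rho>" using that rho(1) by (auto simp: subset_iff)
    then show ?thesis by (simp add: power_strict_mono)
  qed
  note pic = picone[OF S P P1 Ppos e]
  show i: "integrable lborel (\<lambda>x. if x \<in> S then (e x)\<^sup>2 else 0)"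
    by (rule integrable_extend_zero[OF _ S]) (auto intro!: continuous_intros ce simp: e(2))
  have "(LINT x|lborel. (if x \<in> S then (e x)\<^sup>2 else 0)) \<le>
    (LINT x|lborel. \<rho>\<^sup>2 * (if x \<in> S then (- (\<Sum>i\<in>(UNIV::'n set). 0 + (- 1) * (2 * 1))) * (e x)\<^sup>2 / ?P x else 0))"
  proof (rule integral_mono[OF i])
    show "integrable lborel (\<lambda>x. \<rho>\<^sup>2 * (if x \<in> S then (- (\<Sum>i\<in>(UNIV::'n set). 0 + (- 1) * (2 * 1))) * (e x)\<^sup>2 / ?P x else 0))"
      by (intro integrable_mult_right) (use pic(1) in blast)
    fix x
    have "(e x)\<^sup>2 \<le> \<rho>\<^sup>2 * ((- (\<Sum>i\<in>(UNIV::'n set). 0 + (- 1) * (2 * 1))) * (e x)\<^sup>2 / ?P x)" if "x \<in> S"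
    proof -
      have n: "real CARD('n) \<ge> 1" by (simp add: Suc_leI)
      have "(e x)\<^sup>2 * ?P x \<le> (e x)\<^sup>2 * \<rho>\<^sup>2" by (intro mult_left_mono) auto
      also have "\<dots> \<le> 2 * real CARD('n) * ((e x)\<^sup>2 * \<rho>\<^sup>2)"
        using mult_right_mono[of 1 "2 * real CARD('n)" "(e x)\<^sup>2 * \<rho>\<^sup>2"] n by simp
      finally have "(e x)\<^sup>2 \<le> 2 * real CARD('n) * ((e x)\<^sup>2 * \<rho>\<^sup>2) / ?P x"
        using Ppos[OF that] by (simp only: pos_le_divide_eq)
      then show ?thesis by (simp add: mult_ac)
    qed
    then show "(if x \<in> S then (e x)\<^sup>2 else 0) \<le>
        \<rho>\<^sup>2 * (if x \<in> S then (- (\<Sum>i\<in>(UNIV::'n set). 0 + (- 1) * (2 * 1))) * (e x)\<^sup>2 / ?P x else 0)" by simp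
  qed
  also have "\<dots> = \<rho>\<^sup>2 * (LINT x|lborel. (if x \<in> S then (- (\<Sum>i\<in>(UNIV::'n set). 0 + (- 1) * (2 * 1))) * (e x)\<^sup>2 / ?P x else 0))"
    by (rule Bochner_Integration.integral_mult_right_zero)
  also have "\<dots> \<le> \<rho>\<^sup>2 * (LINT x|lborel. (if x \<in> S then (\<Sum>i\<in>UNIV. (e' i x)\<^sup>2) else 0))"
    by (intro mult_left_mono pic(3)) auto
  finally show "(LINT x|lborel. (if x \<in> S then (e x)\<^sup>2 else 0)) \<le>
     \<rho>\<^sup>2 * (LINT x|lborel. (if x \<in> S then (\<Sum>i\<in>UNIV. (e' i x)\<^sup>2) else 0))" .
qed

text \<open>Fatou's lemma. It yields the integrability of the limit as well, which is not known
  beforehand when a truncation is removed.\<close>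

lemma integral_limit_bound:
  fixes f :: "nat \<Rightarrow> 'a \<Rightarrow> real"
  assumes f: "\<And>k. integrable M (f k)" "\<And>k x. f k x \<ge> 0" "\<And>k. integral\<^sup>L M (f k) \<le> C"
    and l: "\<And>x. (\<lambda>k. f k x) \<longlonglongrightarrow> l x" and m: "l \<in> borel_measurable M"
  shows "integrable M l \<and> integral\<^sup>L M l \<le> C"
proof -
  have "integral\<^sup>L M (f 0) \<ge> 0" by (rule integral_nonneg_AE) (simp add: f(2))
  then have C: "C \<ge> 0" using f(3)[of 0] by linarith
  have l0: "l x \<ge> 0" for x by (rule LIMSEQ_le_const[OF l]) (use f(2) in blast)
  have "(\<integral>\<^sup>+x. ennreal (l x) \<partial>M) = (\<integral>\<^sup>+x. liminf (\<lambda>k. ennreal (f k x)) \<partial>M)"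
  proof (rule nn_integral_cong)
    fix x
    have "(\<lambda>k. ennreal (f k x)) \<longlonglongrightarrow> ennreal (l x)" by (rule tendsto_ennrealI[OF l])
    then show "ennreal (l x) = liminf (\<lambda>k. ennreal (f k x))"
      by (simp add: lim_imp_Liminf)
  qed
  also have "\<dots> \<le> liminf (\<lambda>k. \<integral>\<^sup>+x. ennreal (f k x) \<partial>M)"
    by (rule nn_integral_liminf) (use f(1) in measurable)
  also have "\<dots> \<le> liminf (\<lambda>k::nat. ennreal C)"
  proof (rule Liminf_mono, rule always_eventually, rule allI)
    fix k
    have "(\<integral>\<^sup>+x. ennreal (f k x) \<partial>M) = ennreal (integral\<^sup>L M (f k))"
      by (rule nn_integral_eq_integral[OF f(1)]) (use f(2) in auto)
    then show "(\<integral>\<^sup>+x. ennreal (f k x) \<partial>M) \<le> ennreal C" using f(3)[of k] by (simp add: ennreal_leI)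
  qed
  also have "\<dots> = ennreal C" by (simp add: Liminf_const)
  finally have le: "(\<integral>\<^sup>+x. ennreal (l x) \<partial>M) \<le> ennreal C" .
  have int: "integrable M l"
  proof (rule integrableI_nonneg[OF m])
    show "AE x in M. 0 \<le> l x" using l0 by simp
    show "(\<integral>\<^sup>+x. ennreal (l x) \<partial>M) < \<infinity>" using le by (simp add: le_less_trans)
  qed
  have "ennreal (integral\<^sup>L M l) = (\<integral>\<^sup>+x. ennreal (l x) \<partial>M)"
    by (rule nn_integral_eq_integral[symmetric, OF int]) (use l0 in auto)
  then have "ennreal (integral\<^sup>L M l) \<le> ennreal C" using le by simp
  then show ?thesis using int C by (simp add: ennreal_le_iff)
qed


section \<open>Positive solutions\<close>

locale positive_solution =
  fixes S :: "(real^'n::finite) set" and b lam :: real and g :: "real \<Rightarrow> real" and u :: "real^'n \<Rightarrow> real"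
  assumes S: "open S" "bounded S"
    and b: "b > 0" and lam: "lam > 0"
    and g: "continuous_on {0..} g" "\<And>s. s \<ge> 0 \<Longrightarrow> g s \<ge> 0"
    and sol: "classical_solution S b g lam u" and pos: "\<And>x. x \<in> S \<Longrightarrow> u x > 0"
begin

abbreviation "u1 i \<equiv> partial i u"
abbreviation "u2 i \<equiv> partials [i, i] u"
abbreviation "gsq x \<equiv> (\<Sum>i\<in>UNIV. (u1 i x)\<^sup>2)"

lemma u1: "cont_partial i S u (u1 i)" and u2: "cont_partial i S (u1 i) (u2 i)"
  using Ck_on_2_cont_partial sol S(1) by (auto simp: classical_solution_def)

lemma cont_u: "continuous_on S u" "continuous_on S (u1 i)" "continuous_on S (u2 i)"
  using u1[of i] u2[of i] by (auto simp: cont_partial_def)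

lemma cont_gu: "continuous_on S (\<lambda>x. g (u x))"
  by (rule continuous_on_compose2[OF g(1) cont_u(1)]) (use pos in force)

lemma norm_grad: "(norm (grad u x))\<^sup>2 = gsq x"
  unfolding power2_norm_eq_inner grad_def inner_vec_def by (simp add: power2_eq_square)

lemma pde: "x \<in> S \<Longrightarrow> (\<Sum>i\<in>UNIV. u2 i x) + b * gsq x = - lam * g (u x)"
  using sol norm_grad[of x] unfolding classical_solution_def laplacian_def by force

definition level :: "real \<Rightarrow> (real^'n) set" where
  "level c = {x \<in> closure S. u x \<ge> c}"

text \<open>The superlevel set is closed in the compact closure of \<open>S\<close>, and the zero
  boundary values keep it away from the frontier. These sets carry all truncated test
  functions.\<close>

lemma level: assumes "c > 0" shows "compact (level c)" "level c \<subseteq> S"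
proof -
  have cu: "continuous_on (closure S) u" using sol by (simp add: classical_solution_def)
  have "level c = closure S \<inter> u -` {c..}" by (auto simp: level_def)
  then have "closed (level c)"
    using continuous_closed_preimage[OF cu closed_closure closed_atLeast[of c]] by simp
  then show "compact (level c)"
    using S(2) by (auto simp: compact_eq_bounded_closed level_def intro: bounded_subset[OF bounded_closure])
  show "level c \<subseteq> S"
  proof
    fix x assume x: "x \<in> level c"
    show "x \<in> S"
    proof (rule ccontr)
      assume "x \<notin> S"
      then have "x \<in> frontier S" using x S(1) by (simp add: level_def frontier_def interior_open)
      then have "u x = 0" using sol by (simp add: classical_solution_def)
      then show False using x assms by (simp add: level_def)
    qed
  qed
qed

lemma off_level: "x \<in> S \<Longrightarrow> x \<notin> level c \<Longrightarrow> max c (u x) = c"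
  using closure_subset[of S] by (auto simp: level_def)

lemma cont_partial_exp: "cont_partial i S (\<lambda>x. exp (c * u x)) (\<lambda>x. exp (c * u x) * c * u1 i x)"
  by (rule cont_partial_compose[OF u1, of "\<lambda>s. exp (c * s)" "\<lambda>s. exp (c * s) * c"])
    (auto intro!: derivative_eq_intros continuous_intros)

lemma continuous_freeze:
  assumes "continuous_on {c..} f"
  shows "continuous_on S (\<lambda>x. f (max c (u x)))"
  by (rule continuous_on_compose2[OF assms]) (auto intro!: continuous_intros cont_u)

text \<open>The equation in divergence form, \<open>- div (e\<^bsup>b u\<^esup> grad u) = lam e\<^bsup>b u\<^esup> g(u)\<close>, tested with \<open>f(max c u)\<close>.\<close>

lemma energy_identity:
  assumes c: "c > 0"
    and f: "\<And>s. s \<ge> c \<Longrightarrow> (f has_real_derivative f' s) (at s)" "f c = 0" "f' c = 0" "continuous_on {c..} f'"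
  shows "integrable lborel (\<lambda>x. if x \<in> S then exp (b * u x) * f' (max c (u x)) * gsq x else 0)"
    and "integrable lborel (\<lambda>x. if x \<in> S then lam * (exp (b * u x) * g (u x) * f (max c (u x))) else 0)"
    and "(LINT x|lborel. (if x \<in> S then exp (b * u x) * f' (max c (u x)) * gsq x else 0)) =
      (LINT x|lborel. (if x \<in> S then lam * (exp (b * u x) * g (u x) * f (max c (u x))) else 0))"
proof -
  let ?K = "level c"
  note K = level[OF c]
  let ?L = "\<lambda>x. if x \<in> S then exp (b * u x) * f' (max c (u x)) * gsq x else 0"
  let ?R = "\<lambda>x. if x \<in> S then lam * (exp (b * u x) * g (u x) * f (max c (u x))) else 0"
  have cf: "continuous_on {c..} f"
    by (rule DERIV_continuous_on[of _ _ f']) (use f(1) in \<open>auto intro: has_field_derivative_at_within\<close>)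
  note fr = continuous_freeze[OF cf] continuous_freeze[OF f(4)]
  show L: "integrable lborel ?L"
    by (rule integrable_extend_zero[OF _ S(1) K]) (auto intro!: continuous_intros fr cont_u simp: off_level f)
  show R: "integrable lborel ?R"
    by (rule integrable_extend_zero[OF _ S(1) K]) (auto intro!: continuous_intros fr cont_u cont_gu simp: off_level f)
  \<comment> \<open>The derivative of exp(b u) u_i f(max c u) in the shape that the product rule
    delivers. Summed over \<open>i\<close>, the terms containing \<open>f\<close> collapse by the
    equation to - lam exp(b u) g(u) f(max c u).\<close>
  let ?D = "\<lambda>i x. exp (b * u x) * u1 i x * (f' (max c (u x)) * u1 i x)
      + (exp (b * u x) * u2 i x + exp (b * u x) * b * u1 i x * u1 i x) * f (max c (u x))"
  have D: "cont_partial i S (\<lambda>x. exp (b * u x) * u1 i x * f (max c (u x))) (?D i)" for i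
    by (intro cont_partial_mult cont_partial_exp u2 cont_partial_freeze[OF u1 f(1,3,4)])
  have off: "exp (b * u x) * u1 i x * f (max c (u x)) = 0" if "x \<in> S" "x \<notin> ?K" for i x
    using off_level[OF that] f(2) by simp
  note I = integral_partial_extend_zero[OF D S(1) K off]
  have "0 = (\<Sum>i\<in>UNIV. LINT x|lborel. (if x \<in> S then ?D i x else 0))"
    by (subst I(2)) auto
  also have "\<dots> = (LINT x|lborel. (\<Sum>i\<in>UNIV. if x \<in> S then ?D i x else 0))"
    by (rule Bochner_Integration.integral_sum[symmetric]) (rule I(1))
  also have "(\<lambda>x. \<Sum>i\<in>UNIV. if x \<in> S then ?D i x else 0) = (\<lambda>x. ?L x - ?R x)"
  proof
    fix x
    show "(\<Sum>i\<in>UNIV. if x \<in> S then ?D i x else 0) = ?L x - ?R x"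
    proof (cases "x \<in> S")
      case True
      have "(\<Sum>i\<in>UNIV. ?D i x) = (\<Sum>i\<in>UNIV. exp (b * u x) * f' (max c (u x)) * (u1 i x)\<^sup>2
          + exp (b * u x) * f (max c (u x)) * (u2 i x + b * (u1 i x)\<^sup>2))"
        by (intro sum.cong refl) (simp add: algebra_simps power2_eq_square)
      also have "\<dots> = exp (b * u x) * f' (max c (u x)) * gsq x
          + exp (b * u x) * f (max c (u x)) * ((\<Sum>i\<in>UNIV. u2 i x) + b * gsq x)"
        by (simp only: sum.distrib sum_distrib_left[symmetric])
      also have "\<dots> = ?L x - ?R x" using True unfolding pde[OF True] by simp
      finally show ?thesis using True by simp
    qed simp
  qed
  also have "integral\<^sup>L lborel (\<lambda>x. ?L x - ?R x) = integral\<^sup>L lborel ?L - integral\<^sup>L lborel ?R"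
    by (rule Bochner_Integration.integral_diff[OF L R])
  finally show "integral\<^sup>L lborel ?L = integral\<^sup>L lborel ?R" by simp
qed

text \<open>The weight exp(2 b u) puts the linearised operator in divergence form: its derivative
  supplies exactly the drift term 2 b grad u . grad \<phi>. The weighted Picone inequality is summed
  over the coordinates, and stability then bounds the operator applied to \<phi>. The continuous
  minorant \<open>h\<close> keeps the resulting integrand continuous.\<close>

lemma stability_inequality:
  assumes st: "stable_solution S b g' lam u"
    and h: "continuous_on {0<..} h" "\<And>s. s > 0 \<Longrightarrow> h s \<le> g' s"
    and c: "c > 0"
    and f: "\<And>s. s \<ge> c \<Longrightarrow> (f has_real_derivative f' s) (at s)" "f c = 0" "f' c = 0" "continuous_on {c..} f'"
  shows "integrable lborel (\<lambda>x. if x \<in> S then exp (2 * b * u x) * (f' (max c (u x)))\<^sup>2 * gsq x else 0)"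
    and "integrable lborel (\<lambda>x. if x \<in> S then lam * (exp (2 * b * u x) * h (u x) * (f (max c (u x)))\<^sup>2) else 0)"
    and "(LINT x|lborel. (if x \<in> S then lam * (exp (2 * b * u x) * h (u x) * (f (max c (u x)))\<^sup>2) else 0)) \<le>
      (LINT x|lborel. (if x \<in> S then exp (2 * b * u x) * (f' (max c (u x)))\<^sup>2 * gsq x else 0))"
proof -
  let ?K = "level c"
  note K = level[OF c]
  let ?L = "\<lambda>x. if x \<in> S then exp (2 * b * u x) * (f' (max c (u x)))\<^sup>2 * gsq x else 0"
  let ?R = "\<lambda>x. if x \<in> S then lam * (exp (2 * b * u x) * h (u x) * (f (max c (u x)))\<^sup>2) else 0"
  have cf: "continuous_on {c..} f"
    by (rule DERIV_continuous_on[of _ _ f']) (use f(1) in \<open>auto intro: has_field_derivative_at_within\<close>)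
  have chu: "continuous_on S (\<lambda>x. h (u x))"
    by (rule continuous_on_compose2[OF h(1) cont_u(1)]) (use pos in auto)
  note fr = continuous_freeze[OF cf] continuous_freeze[OF f(4)]
  show L: "integrable lborel ?L"
    by (rule integrable_extend_zero[OF _ S(1) K]) (auto intro!: continuous_intros fr cont_u simp: off_level f)
  show R: "integrable lborel ?R"
    by (rule integrable_extend_zero[OF _ S(1) K]) (auto intro!: continuous_intros fr cont_u chu simp: off_level f)
  obtain p \<phi> where \<phi>: "\<phi> \<in> sobolev 2 p S" "continuous_on (closure S) \<phi>" "\<forall>x\<in>closure S. \<phi> x > 0"
    and ineq: "AE x in lebesgue. x \<in> S \<longrightarrow>
           - weak_laplacian S \<phi> x - 2 * b * (grad u x \<bullet> weak_grad S \<phi> x) \<ge> lam * g' (u x) * \<phi> x"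
    using st unfolding stable_solution_def by blast
  have wd: "has_weak_deriv S is \<phi> (weak_deriv S is \<phi>)" if "length is \<le> 2" for "is"
  proof -
    have "\<exists>w. has_weak_deriv S is \<phi> w" using \<phi>(1) that unfolding sobolev_def by blast
    from someI_ex[OF this] show ?thesis unfolding weak_deriv_def .
  qed
  define p q where "p i = weak_deriv S [i] \<phi>" and "q i = weak_deriv S [i, i] \<phi>" for i
  have pq: "has_weak_deriv S [i] \<phi> (p i)" "has_weak_deriv S [i, i] \<phi> (q i)" for i
    using wd[of "[i]"] wd[of "[i, i]"] by (simp_all add: p_def q_def)
  have \<phi>S: "continuous_on S \<phi>" "\<forall>x\<in>S. \<phi> x > 0"
    using \<phi>(2,3) closure_subset[of S] continuous_on_subset by blast+
  let ?a = "\<lambda>x. exp (2 * b * u x)"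
  let ?e = "\<lambda>x. f (max c (u x))"
  let ?e' = "\<lambda>i x. f' (max c (u x)) * u1 i x"
  let ?G = "\<lambda>i x. if x \<in> ?K then (?a x * q i x + (?a x * (2 * b) * u1 i x) * p i x) * (?e x)\<^sup>2 / \<phi> x + ?a x * (?e' i x)\<^sup>2 else 0"
  have G: "integrable lebesgue (?G i)" "integral\<^sup>L lebesgue (?G i) \<ge> 0" for i
    by (rule weak_picone_partial[OF S(1) K \<phi>S pq cont_partial_exp _ cont_partial_freeze[OF u1 f(1,3,4)]];
        simp add: off_level f(2))+
  have iL: "integrable lebesgue ?L" "integral\<^sup>L lebesgue ?L = integral\<^sup>L lborel ?L"
    and iR: "integrable lebesgue ?R" "integral\<^sup>L lebesgue ?R = integral\<^sup>L lborel ?R"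
    using L R by (simp_all add: integrable_completion integral_completion borel_measurable_integrable)
  have "0 \<le> (\<Sum>i\<in>UNIV. integral\<^sup>L lebesgue (?G i))" by (intro sum_nonneg G(2))
  also have "\<dots> = (LINT x|lebesgue. (\<Sum>i\<in>UNIV. ?G i x))"
    by (rule Bochner_Integration.integral_sum[symmetric]) (rule G(1))
  also have "\<dots> \<le> (LINT x|lebesgue. ?L x - ?R x)"
  proof (rule integral_mono_AE)
    show "integrable lebesgue (\<lambda>x. \<Sum>i\<in>UNIV. ?G i x)" by (intro Bochner_Integration.integrable_sum G(1))
    show "integrable lebesgue (\<lambda>x. ?L x - ?R x)" using iL(1) iR(1) by (rule Bochner_Integration.integrable_diff)
    show "AE x in lebesgue. (\<Sum>i\<in>UNIV. ?G i x) \<le> ?L x - ?R x"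
      using ineq
    proof eventually_elim
      case (elim x)
      show ?case
      proof (cases "x \<in> ?K")
        case True
        then have xS: "x \<in> S" using K(2) by blast
        have \<phi>x: "\<phi> x > 0" using \<phi>S(2) xS by blast
        have "(\<Sum>i\<in>UNIV. ?G i x) = (\<Sum>i\<in>UNIV. ?a x * (?e x)\<^sup>2 / \<phi> x * (q i x + 2 * b * (u1 i x * p i x))
            + ?a x * (f' (max c (u x)))\<^sup>2 * (u1 i x)\<^sup>2)"
          using True by (intro sum.cong refl) (simp add: power_mult_distrib field_simps)
        also have "\<dots> = ?a x * (?e x)\<^sup>2 / \<phi> x * ((\<Sum>i\<in>UNIV. q i x) + 2 * b * (\<Sum>i\<in>UNIV. u1 i x * p i x))
            + ?a x * (f' (max c (u x)))\<^sup>2 * gsq x"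
          by (simp only: sum.distrib sum_distrib_left[symmetric])
        also have "(\<Sum>i\<in>UNIV. q i x) + 2 * b * (\<Sum>i\<in>UNIV. u1 i x * p i x) =
            weak_laplacian S \<phi> x + 2 * b * (grad u x \<bullet> weak_grad S \<phi> x)"
          by (simp add: weak_laplacian_def q_def grad_def weak_grad_def inner_vec_def p_def)
        \<comment> \<open>Stability enters here; since \<phi> is positive, \<open>g'\<close> may
          first be lowered to \<open>h\<close>, and the common factor in front is
          nonnegative.\<close>
        also have "?a x * (?e x)\<^sup>2 / \<phi> x * (weak_laplacian S \<phi> x + 2 * b * (grad u x \<bullet> weak_grad S \<phi> x))
            \<le> ?a x * (?e x)\<^sup>2 / \<phi> x * (- lam * h (u x) * \<phi> x)"
        proof (rule mult_left_mono)
          have "lam * h (u x) * \<phi> x \<le> lam * g' (u x) * \<phi> x"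
            using h(2)[OF pos[OF xS]] lam \<phi>x by (intro mult_right_mono mult_left_mono) auto
          then show "weak_laplacian S \<phi> x + 2 * b * (grad u x \<bullet> weak_grad S \<phi> x) \<le> - lam * h (u x) * \<phi> x"
            using elim xS by simp
        qed (use \<phi>x in simp)
        also have "?a x * (?e x)\<^sup>2 / \<phi> x * (- lam * h (u x) * \<phi> x) = - ?R x"
          using \<phi>x xS by simp
        finally show ?thesis using xS by simp
      next
        case False
        then show ?thesis using off_level[of x c] f(2,3) by simp
      qed
    qed
  qed
  also have "\<dots> = integral\<^sup>L lebesgue ?L - integral\<^sup>L lebesgue ?R"
    by (rule Bochner_Integration.integral_diff[OF iL(1) iR(1)])
  finally show "integral\<^sup>L lborel ?R \<le> integral\<^sup>L lborel ?L" using iL(2) iR(2) by simp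
qed

lemma poincare_freeze:
  assumes rho: "S \<subseteq> ball 0 \<rho>" "\<rho> > 0" and c: "c > 0"
    and f: "\<And>s. s \<ge> c \<Longrightarrow> (f has_real_derivative f' s) (at s)" "f c = 0" "f' c = 0" "continuous_on {c..} f'"
  shows "integrable lborel (\<lambda>x. if x \<in> S then (f (max c (u x)))\<^sup>2 else 0)"
    and "integrable lborel (\<lambda>x. if x \<in> S then (f' (max c (u x)))\<^sup>2 * gsq x else 0)"
    and "(LINT x|lborel. (if x \<in> S then (f (max c (u x)))\<^sup>2 else 0)) \<le>
      \<rho>\<^sup>2 * (LINT x|lborel. (if x \<in> S then (f' (max c (u x)))\<^sup>2 * gsq x else 0))"
proof -
  note K = level[OF c]
  note F = cont_partial_freeze[OF u1 f(1,3,4)]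
  have off: "f (max c (u x)) = 0" if "x \<in> S" "x \<notin> level c" for x using off_level[OF that] f(2) by simp
  have eq: "(\<lambda>x. if x \<in> S then (\<Sum>i\<in>UNIV. (f' (max c (u x)) * u1 i x)\<^sup>2) else 0) =
      (\<lambda>x. if x \<in> S then (f' (max c (u x)))\<^sup>2 * gsq x else 0)"
    by (rule ext) (simp add: power_mult_distrib sum_distrib_left)
  note p = poincare[OF S(1) K rho F off]
  show "integrable lborel (\<lambda>x. if x \<in> S then (f (max c (u x)))\<^sup>2 else 0)" by (rule p(1))
  show "(LINT x|lborel. (if x \<in> S then (f (max c (u x)))\<^sup>2 else 0)) \<le>
      \<rho>\<^sup>2 * (LINT x|lborel. (if x \<in> S then (f' (max c (u x)))\<^sup>2 * gsq x else 0))"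
    using p(2) unfolding eq .
  show "integrable lborel (\<lambda>x. if x \<in> S then (f' (max c (u x)))\<^sup>2 * gsq x else 0)"
    by (rule integrable_extend_zero[OF _ S(1) K])
      (auto intro!: continuous_intros continuous_freeze[OF f(4)] cont_u simp: off_level f)
qed

text \<open>Comparison with a fixed bump function through the superharmonic function \<open>e\<^bsup>b u\<^esup> - 1\<close>.\<close>

lemma lam_bound:
  assumes r: "r > 0" "cball x0 r \<subseteq> S"
    and k: "k > 0" "\<And>s. s > 0 \<Longrightarrow> k * (exp (b * s) - 1) \<le> b * exp (b * s) * g s"
  shows "lam * (k * (LINT x|lborel. (ker r (x - x0))\<^sup>2)) \<le>
    (LINT x|lborel. (if x \<in> S then (\<Sum>i\<in>UNIV. (ker1 i r (x - x0))\<^sup>2) else 0))"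
proof -
  \<comment> \<open>The zero summands are left in place so that the three functions match literally
    what the sum, product and constant rules produce.\<close>
  let ?P = "\<lambda>x. exp (b * u x) + (- 1)"
  let ?P' = "\<lambda>i x. exp (b * u x) * b * u1 i x + 0"
  let ?P'' = "\<lambda>i x. exp (b * u x) * b * u2 i x + (exp (b * u x) * 0 + exp (b * u x) * b * u1 i x * b) * u1 i x + 0"
  have P: "cont_partial i S ?P (?P' i)" "cont_partial i S (?P' i) (?P'' i)" for i
    by (intro cont_partial_add cont_partial_mult cont_partial_exp cont_partial_const u2)+
  have Ppos: "?P x > 0" if "x \<in> S" for x using pos[OF that] b by simp
  have e: "cont_partial i S (\<lambda>x. ker r (x - x0)) (\<lambda>x. ker1 i r (x - x0))" for i
  proof -
    have "continuous_on S (\<lambda>x. ker r (x - x0))" "continuous_on S (\<lambda>x. ker1 i r (x - x0))"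
      by (rule continuous_on_compose2[OF ker_continuous(1)], auto intro!: continuous_intros,
          rule continuous_on_compose2[OF ker_continuous(2)], auto intro!: continuous_intros)
    then show ?thesis
      unfolding cont_partial_def using line_ker(1)[of r "_ - x0" i] by (simp add: algebra_simps)
  qed
  have off: "ker r (x - x0) = 0" if "x \<notin> cball x0 r" for x
    using that r(1) by (intro ker_zero) (auto simp: dist_norm norm_minus_commute[of x0])
  note pic = picone[OF S(1) compact_cball r(2) P Ppos e off]
  have ci: "integrable lborel (\<lambda>x. (ker r (x - x0))\<^sup>2)"
  proof (rule integrable_compact_support[OF _ compact_cball[of x0 r]])
    show "continuous_on UNIV (\<lambda>x. (ker r (x - x0))\<^sup>2)"
      by (intro continuous_intros continuous_on_compose2[OF ker_continuous(1)]) auto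
  qed (simp add: off)
  have "lam * (k * (LINT x|lborel. (ker r (x - x0))\<^sup>2)) = (LINT x|lborel. lam * k * (ker r (x - x0))\<^sup>2)"
    by simp
  also have "\<dots> \<le> (LINT x|lborel. (if x \<in> S then (- (\<Sum>i\<in>UNIV. ?P'' i x)) * (ker r (x - x0))\<^sup>2 / ?P x else 0))"
  proof (rule integral_mono)
    show "integrable lborel (\<lambda>x. lam * k * (ker r (x - x0))\<^sup>2)" using ci by simp
    show "integrable lborel (\<lambda>x. if x \<in> S then (- (\<Sum>i\<in>UNIV. ?P'' i x)) * (ker r (x - x0))\<^sup>2 / ?P x else 0)"
      by (rule pic(1))
    fix x
    show "lam * k * (ker r (x - x0))\<^sup>2 \<le> (if x \<in> S then (- (\<Sum>i\<in>UNIV. ?P'' i x)) * (ker r (x - x0))\<^sup>2 / ?P x else 0)"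
    proof (cases "x \<in> S")
      case True
      have "(\<Sum>i\<in>UNIV. ?P'' i x) = (\<Sum>i\<in>UNIV. b * exp (b * u x) * (u2 i x + b * (u1 i x)\<^sup>2))"
        by (intro sum.cong refl) (simp add: algebra_simps power2_eq_square)
      also have "\<dots> = b * exp (b * u x) * ((\<Sum>i\<in>UNIV. u2 i x) + b * gsq x)"
        by (simp only: sum.distrib sum_distrib_left[symmetric])
      also have "\<dots> = - lam * (b * exp (b * u x) * g (u x))"
        unfolding pde[OF True] by simp
      finally have s: "- (\<Sum>i\<in>UNIV. ?P'' i x) = lam * (b * exp (b * u x) * g (u x))" by simp
      \<comment> \<open>After division by \<open>?P\<close>, the quotient -Laplacian(P) / P is at
        least \<open>lam * k\<close> on \<open>S\<close>, which turns Picone's inequality into a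
        bound on \<open>lam\<close>.\<close>
      have "lam * (k * ?P x) \<le> lam * (b * exp (b * u x) * g (u x))"
        using k(2)[OF pos[OF True]] lam by (intro mult_left_mono) auto
      then have "lam * k \<le> lam * (b * exp (b * u x) * g (u x)) / ?P x"
        using Ppos[OF True] by (simp add: pos_le_divide_eq mult.assoc)
      from mult_right_mono[OF this, of "(ker r (x - x0))\<^sup>2"]
      show ?thesis unfolding s using True by simp
    next
      case False
      then have "x \<notin> cball x0 r" using r(2) by blast
      then show ?thesis using False off by simp
    qed
  qed
  also have "\<dots> \<le> (LINT x|lborel. (if x \<in> S then (\<Sum>i\<in>UNIV. (ker1 i r (x - x0))\<^sup>2) else 0))"
    by (rule pic(3))
  finally show ?thesis .
qed

end


section \<open>The truncated test functions\<close>

text \<open>The truncation level enters the test functions only through \<open>e = wt b c\<close>: in the variable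
  \<open>w = wt b s\<close> one has \<open>cutR = (w - e)\<^sup>2 / w\<close>, and \<open>cutQ\<close> is the primitive of \<open>(d cutR / dw)\<^sup>2\<close>
  vanishing at \<open>e\<close>.\<close>

definition wt :: "real \<Rightarrow> real \<Rightarrow> real" where
  "wt b s = (1 - exp (- (b * s))) / b"

definition cutR :: "real \<Rightarrow> real \<Rightarrow> real \<Rightarrow> real" where
  "cutR b c s = wt b s - 2 * wt b c + (wt b c)\<^sup>2 / wt b s"

definition cutQ :: "real \<Rightarrow> real \<Rightarrow> real \<Rightarrow> real" where
  "cutQ b c s = wt b s + 2 * (wt b c)\<^sup>2 / wt b s - (wt b c) ^ 4 / (3 * wt b s ^ 3) - 8 * wt b c / 3"

definition cutD :: "real \<Rightarrow> real \<Rightarrow> real \<Rightarrow> real" where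
  "cutD b c s = 1 - (wt b c)\<^sup>2 / (wt b s)\<^sup>2"

lemma wt_DERIV: "b > 0 \<Longrightarrow> (wt b has_real_derivative exp (- (b * s))) (at s)"
  unfolding wt_def by (auto intro!: derivative_eq_intros)

lemma wt_pos: "b > 0 \<Longrightarrow> s > 0 \<Longrightarrow> wt b s > 0"
  by (simp add: wt_def)

lemma wt_mono: "b > 0 \<Longrightarrow> s \<le> t \<Longrightarrow> wt b s \<le> wt b t"
  by (simp add: wt_def divide_right_mono)

lemma wt_le_self: "b > 0 \<Longrightarrow> wt b s \<le> s"
  using exp_ge_add_one_self[of "- (b * s)"] by (simp add: wt_def field_simps)

lemma wt_le: "b > 0 \<Longrightarrow> wt b s \<le> 1 / b"
  by (simp add: wt_def divide_right_mono)

lemma wt_continuous: "b > 0 \<Longrightarrow> continuous_on A (wt b)"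
  unfolding wt_def by (intro continuous_intros) auto

lemma cutR_DERIV:
  assumes "b > 0" "s > 0"
  shows "(cutR b c has_real_derivative cutD b c s * exp (- (b * s))) (at s)"
proof -
  have w: "wt b s > 0" using wt_pos[OF assms] .
  have "((\<lambda>s. wt b s - 2 * wt b c + (wt b c)\<^sup>2 / wt b s) has_real_derivative
      exp (- (b * s)) - 0 + (0 * wt b s - (wt b c)\<^sup>2 * exp (- (b * s))) / (wt b s * wt b s)) (at s)"
    using w by (intro DERIV_add DERIV_diff DERIV_divide wt_DERIV[OF assms(1)] DERIV_const) auto
  also have "exp (- (b * s)) - 0 + (0 * wt b s - (wt b c)\<^sup>2 * exp (- (b * s))) / (wt b s * wt b s)
      = cutD b c s * exp (- (b * s))"
    unfolding cutD_def by (simp add: left_diff_distrib power2_eq_square)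
  finally show ?thesis unfolding cutR_def[abs_def] .
qed

lemma cutQ_DERIV:
  assumes "b > 0" "s > 0"
  shows "(cutQ b c has_real_derivative (cutD b c s)\<^sup>2 * exp (- (b * s))) (at s)"
proof -
  have w: "wt b s > 0" using wt_pos[OF assms] .
  let ?w = "wt b s" let ?e = "wt b c" let ?E = "exp (- (b * s))"
  have p: "((\<lambda>s. wt b s ^ 3) has_real_derivative (3 * ?w\<^sup>2 * ?E)) (at s)"
    using DERIV_power[OF wt_DERIV[OF assms(1)], of 3 s] by (simp add: mult_ac)
  have "((\<lambda>s. wt b s + 2 * ?e\<^sup>2 / wt b s - ?e ^ 4 / (3 * wt b s ^ 3) - 8 * ?e / 3) has_real_derivative
      ?E + (0 * ?w - 2 * ?e\<^sup>2 * ?E) / (?w * ?w)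
      - (0 * (3 * ?w ^ 3) - ?e ^ 4 * (3 * (3 * ?w\<^sup>2 * ?E))) / ((3 * ?w ^ 3) * (3 * ?w ^ 3)) - 0) (at s)"
    using w by (intro DERIV_add DERIV_diff DERIV_divide DERIV_cmult p wt_DERIV[OF assms(1)] DERIV_const) auto
  also have "?E + (0 * ?w - 2 * ?e\<^sup>2 * ?E) / (?w * ?w)
      - (0 * (3 * ?w ^ 3) - ?e ^ 4 * (3 * (3 * ?w\<^sup>2 * ?E))) / ((3 * ?w ^ 3) * (3 * ?w ^ 3)) - 0
      = (cutD b c s)\<^sup>2 * ?E"
    unfolding cutD_def using w by (simp add: field_simps power2_eq_square power3_eq_cube power4_eq_xxxx)
  finally show ?thesis unfolding cutQ_def[abs_def] .
qed

lemma cut_at: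
  assumes "b > 0" "c > 0"
  shows "cutR b c c = 0" "cutQ b c c = 0" "cutD b c c = 0"
  using wt_pos[OF assms] by (simp_all add: cutR_def cutQ_def cutD_def field_simps power2_eq_square power3_eq_cube power4_eq_xxxx)

lemma cutD_continuous:
  assumes "b > 0" "c > 0"
  shows "continuous_on {c..} (\<lambda>s. cutD b c s * exp (- (b * s)))" "continuous_on {c..} (\<lambda>s. (cutD b c s)\<^sup>2 * exp (- (b * s)))"
proof -
  have "wt b s \<noteq> 0" if "s \<in> {c..}" for s using wt_pos[of b s] assms that by auto
  then show "continuous_on {c..} (\<lambda>s. cutD b c s * exp (- (b * s)))" "continuous_on {c..} (\<lambda>s. (cutD b c s)\<^sup>2 * exp (- (b * s)))"
    unfolding cutD_def by (auto intro!: continuous_intros wt_continuous assms)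
qed

lemma cutR_eq: "wt b s > 0 \<Longrightarrow> cutR b c s = (wt b s - wt b c)\<^sup>2 / wt b s"
  by (simp add: cutR_def field_simps power2_eq_square)

text \<open>With e = \<open>wt b c\<close> and w = \<open>wt b s\<close>, the positive correction 2
  e^2 / w is at most 2 e, hence is outweighed by the constant 8 e / 3 that normalises the
  primitive.\<close>

lemma cutQ_le:
  assumes "b > 0" "0 < c" "c \<le> s"
  shows "cutQ b c s \<le> wt b s"
proof -
  have w: "0 < wt b c" "wt b c \<le> wt b s" using wt_pos[of b c] wt_mono[of b c s] assms by auto
  have "(wt b c)\<^sup>2 / wt b s \<le> wt b c"
    using w by (simp add: pos_divide_le_eq power2_eq_square)
  moreover have "(wt b c) ^ 4 / (3 * wt b s ^ 3) \<ge> 0" using w by simp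
  moreover have "2 * (wt b c)\<^sup>2 / wt b s = 2 * ((wt b c)\<^sup>2 / wt b s)" by simp
  ultimately show ?thesis using w(1) unfolding cutQ_def by linarith
qed

text \<open>For t = \<open>wt b c / wt b s\<close> one has cutR^2 / w = (1 - t)^4 w, while cutQ
  \<le> w. Bernoulli's inequality gives (1 - t)^4 \<ge> 1 - 4 t, and the smallness assumption, t
  \<le> d / (8 (1 + d)), makes the loss from truncation cost at most half of the margin
  \<open>d\<close>.\<close>

lemma cutR_ge:
  assumes b: "b > 0" and c: "0 < c" "c \<le> s" and d: "d > 0"
    and small: "8 * (1 + d) * wt b c \<le> d * wt b s"
  shows "(1 + d / 2) * cutQ b c s \<le> (1 + d) * ((cutR b c s)\<^sup>2 / wt b s)"
proof -
  have w: "0 < wt b c" "wt b c \<le> wt b s" using wt_pos[of b c] wt_mono[of b c s] b c by auto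
  define t where "t = wt b c / wt b s"
  have t: "0 \<le> t" "t \<le> 1" "8 * (1 + d) * t \<le> d"
    using w small by (auto simp: t_def pos_divide_le_eq mult_ac)
  have "1 + real 4 * (- t) \<le> (1 + (- t)) ^ 4" by (rule Bernoulli_inequality) (use t in auto)
  then have B: "1 - 4 * t \<le> (1 - t) ^ 4" by simp
  have "(1 + d / 2) \<le> (1 + d) * (1 - 4 * t)" using t(3) by (simp add: algebra_simps)
  also have "\<dots> \<le> (1 + d) * (1 - t) ^ 4" using B d by (intro mult_left_mono) auto
  finally have 1: "1 + d / 2 \<le> (1 + d) * (1 - t) ^ 4" .
  have wt: "wt b c = t * wt b s" using w by (simp add: t_def)
  have "(cutR b c s)\<^sup>2 / wt b s = (1 - t) ^ 4 * wt b s"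
  proof -
    have ws: "wt b s > 0" using w by linarith
    have "cutR b c s = (1 - t)\<^sup>2 * wt b s"
      unfolding cutR_eq[OF ws] wt using ws by (simp add: field_simps power2_eq_square)
    then show ?thesis using ws by (simp add: power2_eq_square power4_eq_xxxx)
  qed
  then have "(1 + d) * ((cutR b c s)\<^sup>2 / wt b s) = (1 + d) * (1 - t) ^ 4 * wt b s" by simp
  moreover have "(1 + d / 2) * cutQ b c s \<le> (1 + d / 2) * wt b s"
    using cutQ_le[OF b c] d by (intro mult_left_mono) auto
  moreover have "(1 + d / 2) * wt b s \<le> (1 + d) * (1 - t) ^ 4 * wt b s"
    using 1 w by (intro mult_right_mono) auto
  ultimately show ?thesis by linarith
qed

text \<open>For large \<open>s\<close>, the identity exp(b s) - 1 = b exp(b s) w reduces the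
  right-hand side to (1 + d) exp(b s) g(s) cutR^2 / w, and \<open>cutR_ge\<close> applies. For s <
  s1 the left integrand is at most the subtracted constant, because cutQ \<le> w \<le> 1 / b and
  \<open>g\<close> is no larger than at \<open>s1\<close>.\<close>

lemma cut_comparison:
  assumes b: "b > 0" and c: "0 < c" "c \<le> s" "c \<le> s1" and d: "d > 0"
    and small: "8 * (1 + d) * wt b c \<le> d * wt b s1"
    and g: "g s \<ge> 0" "g s1 \<ge> 0" "s \<le> s1 \<Longrightarrow> g s \<le> g s1"
    and h: "h s \<ge> 0" "s \<ge> s1 \<Longrightarrow> h s = (1 + d) * g s * b / (exp (b * s) - 1)"
  shows "(1 + d / 2) * (exp (b * s) * g s * cutQ b c s) - (1 + d / 2) * (exp (b * s1) * g s1 / b)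
      \<le> exp (2 * b * s) * h s * (cutR b c s)\<^sup>2"
proof (cases "s \<ge> s1")
  case True
  have s: "s > 0" using c by linarith
  have "8 * (1 + d) * wt b c \<le> d * wt b s"
    using small wt_mono[OF b True] d by (smt (verit) mult_left_mono)
  from cutR_ge[OF b c(1,2) d this]
  have "exp (b * s) * g s * ((1 + d / 2) * cutQ b c s) \<le> exp (b * s) * g s * ((1 + d) * ((cutR b c s)\<^sup>2 / wt b s))"
    using g(1) by (intro mult_left_mono) auto
  also have "\<dots> = exp (2 * b * s) * h s * (cutR b c s)\<^sup>2"
  proof -
    have e: "exp (b * s) - 1 = exp (b * s) * (b * wt b s)"
      using b by (simp add: wt_def exp_minus field_simps)
    have "exp (2 * b * s) = exp (b * s) * exp (b * s)" by (simp add: exp_add[symmetric])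
    then show ?thesis
      using b wt_pos[OF b s] unfolding h(2)[OF True] e by (simp add: field_simps)
  qed
  finally have "(1 + d / 2) * (exp (b * s) * g s * cutQ b c s) \<le> exp (2 * b * s) * h s * (cutR b c s)\<^sup>2"
    by (simp add: mult_ac)
  moreover have "(1 + d / 2) * (exp (b * s1) * g s1 / b) \<ge> 0"
    using d b g(2) by simp
  ultimately show ?thesis by linarith
next
  case False
  have "exp (b * s) * g s * cutQ b c s \<le> exp (b * s) * g s * (1 / b)"
    using cutQ_le[OF b c(1,2)] wt_le[OF b, of s] g(1) by (intro mult_left_mono) auto
  also have "\<dots> \<le> exp (b * s1) * g s1 * (1 / b)"
    using False b g by (intro mult_right_mono mult_mono) auto
  finally have "(1 + d / 2) * (exp (b * s) * g s * cutQ b c s) \<le> (1 + d / 2) * (exp (b * s1) * g s1 / b)"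
    using d by (intro mult_left_mono) auto
  moreover have "exp (2 * b * s) * h s * (cutR b c s)\<^sup>2 \<ge> 0" using h(1) by simp
  ultimately show ?thesis by linarith
qed


section \<open>Uniform bounds\<close>

context positive_solution
begin

lemma gsq_continuous: "continuous_on S gsq"
  by (intro continuous_intros cont_u)

lemma gsq_nonneg: "gsq x \<ge> 0"
  by (intro sum_nonneg) simp

lemma borel_measurable_if_S:
  assumes "continuous_on S f"
  shows "(\<lambda>x. if x \<in> S then f x else (0::real)) \<in> borel_measurable borel"
proof -
  have "(\<lambda>x. if x \<in> S then f x else (0::real)) = (\<lambda>x. indicator S x *\<^sub>R f x)" by auto
  then show ?thesis
    using borel_measurable_continuous_on_indicator[OF _ assms] S(1) by simp
qed

text \<open>Let I be the truncated gradient integral. The energy identity expresses I through cutQ,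
  and stability bounds the cutR integral by the same I. The pointwise comparison then gives (1 + d /
  2) I \<le> I + const, and the surplus d / 2 leaves a bound on I that does not involve
  \<open>c\<close>.\<close>

lemma truncated_gradient_bound:
  assumes st: "stable_solution S b g' lam u" and c: "0 < c" "c \<le> s1" and d: "d > 0"
    and small: "8 * (1 + d) * wt b c \<le> d * wt b s1"
    and gm: "\<And>s t. 0 \<le> s \<Longrightarrow> s \<le> t \<Longrightarrow> g s \<le> g t"
    and h: "continuous_on {0<..} h" "\<And>s. s > 0 \<Longrightarrow> h s \<le> g' s" "\<And>s. s > 0 \<Longrightarrow> h s \<ge> 0"
      "\<And>s. s \<ge> s1 \<Longrightarrow> h s = (1 + d) * g s * b / (exp (b * s) - 1)"
    and L: "lam \<le> L"
  shows "integrable lborel (\<lambda>x. if x \<in> S then (cutD b c (max c (u x)))\<^sup>2 * gsq x else 0)"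
    and "(LINT x|lborel. (if x \<in> S then (cutD b c (max c (u x)))\<^sup>2 * gsq x else 0)) \<le>
      2 / d * (L * ((1 + d / 2) * (exp (b * s1) * g s1 / b)) * measure lborel S)"
proof -
  let ?M = "(1 + d / 2) * (exp (b * s1) * g s1 / b)"
  let ?I = "\<lambda>x. if x \<in> S then (cutD b c (max c (u x)))\<^sup>2 * gsq x else 0"
  let ?A = "\<lambda>x. if x \<in> S then lam * (exp (b * u x) * g (u x) * cutQ b c (max c (u x))) else 0"
  let ?B = "\<lambda>x. if x \<in> S then lam * (exp (2 * b * u x) * h (u x) * (cutR b c (max c (u x)))\<^sup>2) else 0"
  have s1: "s1 > 0" using c by linarith
  note cut = cut_at[OF b c(1)]
  have Qd: "\<And>s. s \<ge> c \<Longrightarrow> (cutQ b c has_real_derivative (cutD b c s)\<^sup>2 * exp (- (b * s))) (at s)"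
    and Rd: "\<And>s. s \<ge> c \<Longrightarrow> (cutR b c has_real_derivative cutD b c s * exp (- (b * s))) (at s)"
    using cutQ_DERIV[OF b] cutR_DERIV[OF b] c(1) by auto
  have z: "(cutD b c c)\<^sup>2 * exp (- (b * c)) = 0" "cutD b c c * exp (- (b * c)) = 0" using cut(3) by auto
  note E = energy_identity[OF c(1) Qd cut(2) z(1) cutD_continuous(2)[OF b c(1)]]
  note T = stability_inequality[OF st h(1,2) c(1) Rd cut(1) z(2) cutD_continuous(1)[OF b c(1)]]
  \<comment> \<open>The two gradient integrands coincide, as Q' = R'^2 was designed to ensure. Below
    level \<open>c\<close> the exponentials do not cancel, but there \<open>cutD\<close> is
    zero.\<close>
  have e1: "exp (b * u x) * ((cutD b c (max c (u x)))\<^sup>2 * exp (- (b * max c (u x)))) * gsq x = (cutD b c (max c (u x)))\<^sup>2 * gsq x"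
    and e2: "exp (2 * b * u x) * (cutD b c (max c (u x)) * exp (- (b * max c (u x))))\<^sup>2 * gsq x = (cutD b c (max c (u x)))\<^sup>2 * gsq x" for x
  proof -
    show "exp (b * u x) * ((cutD b c (max c (u x)))\<^sup>2 * exp (- (b * max c (u x)))) * gsq x = (cutD b c (max c (u x)))\<^sup>2 * gsq x"
    proof (cases "u x \<ge> c")
      case True
      then show ?thesis by (simp add: max_absorb2 exp_minus)
    next
      case False
      then show ?thesis using cut(3) by (simp add: max_absorb1)
    qed
    show "exp (2 * b * u x) * (cutD b c (max c (u x)) * exp (- (b * max c (u x))))\<^sup>2 * gsq x = (cutD b c (max c (u x)))\<^sup>2 * gsq x"
    proof (cases "u x \<ge> c")
      case True
      have "exp (2 * b * u x) = (exp (b * u x))\<^sup>2" by (simp add: power2_eq_square exp_add[symmetric])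
      then show ?thesis using True by (simp add: max_absorb2 exp_minus power_mult_distrib power_inverse)
    next
      case False
      then show ?thesis using cut(3) by (simp add: max_absorb1)
    qed
  qed
  show I: "integrable lborel ?I" using E(1) unfolding e1 .
  have IA: "integral\<^sup>L lborel ?I = integral\<^sup>L lborel ?A" using E(3) unfolding e1 .
  have BI: "integral\<^sup>L lborel ?B \<le> integral\<^sup>L lborel ?I" using T(3) unfolding e2 .
  have fin: "emeasure lborel S < \<infinity>" by (rule emeasure_bounded_finite[OF S(2)])
  have iS: "integrable lborel (indicator S :: _ \<Rightarrow> real)"
    using S(1) fin by (intro integrable_real_indicator) auto
  have le: "integral\<^sup>L lborel (\<lambda>x. (1 + d / 2) * ?A x - lam * ?M * indicator S x) \<le> integral\<^sup>L lborel ?B"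
  proof (rule integral_mono)
    show "integrable lborel (\<lambda>x. (1 + d / 2) * ?A x - lam * ?M * indicator S x)"
      by (intro Bochner_Integration.integrable_diff integrable_mult_right E(2) iS)
    show "integrable lborel ?B" by (rule T(2))
    fix x
    show "(1 + d / 2) * ?A x - lam * ?M * indicator S x \<le> ?B x"
    proof (cases "x \<in> S")
      case True
      have ux: "u x > 0" by (rule pos[OF True])
      have "(1 + d / 2) * (exp (b * u x) * g (u x) * cutQ b c (max c (u x))) - ?M
          \<le> exp (2 * b * u x) * h (u x) * (cutR b c (max c (u x)))\<^sup>2"
      proof (cases "u x \<ge> c")
        case True
        have "(1 + d / 2) * (exp (b * u x) * g (u x) * cutQ b c (u x)) - ?M
            \<le> exp (2 * b * u x) * h (u x) * (cutR b c (u x))\<^sup>2"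
          by (rule cut_comparison[OF b c(1) True c(2) d small]) (use g(2) gm h ux s1 in auto)
        then show ?thesis using True by (simp add: max_absorb2)
      next
        case False
        have "?M \<ge> 0" using d b g(2)[of s1] s1 by simp
        then show ?thesis using False cut by (simp add: max_absorb1)
      qed
      from mult_left_mono[OF this, of lam] True lam show ?thesis by (simp add: algebra_simps)
    qed simp
  qed
  have "integral\<^sup>L lborel (\<lambda>x. (1 + d / 2) * ?A x - lam * ?M * indicator S x) =
      (1 + d / 2) * integral\<^sup>L lborel ?A - lam * ?M * measure lborel S"
  proof -
    have "integral\<^sup>L lborel (\<lambda>x. (1 + d / 2) * ?A x - lam * ?M * indicator S x) =
        integral\<^sup>L lborel (\<lambda>x. (1 + d / 2) * ?A x) - integral\<^sup>L lborel (\<lambda>x. lam * ?M * indicator S x)"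
      by (intro Bochner_Integration.integral_diff integrable_mult_right E(2) iS)
    then show ?thesis by simp
  qed
  then have "(1 + d / 2) * integral\<^sup>L lborel ?I - lam * ?M * measure lborel S \<le> integral\<^sup>L lborel ?I"
    using order_trans[OF le BI] unfolding IA by (simp only:)
  moreover have "lam * ?M * measure lborel S \<le> L * ?M * measure lborel S"
    using L d b g(2)[of s1] s1 by (intro mult_right_mono) auto
  moreover have "x \<le> 2 / d * z" if "(1 + d / 2) * x - y \<le> x" "y \<le> z" for x y z :: real
  proof -
    have "d / 2 * x \<le> z" using that by (simp add: algebra_simps)
    then show ?thesis using d by (simp add: field_simps)
  qed
  ultimately show "integral\<^sup>L lborel ?I \<le> 2 / d * (L * ?M * measure lborel S)" by blast
qed

text \<open>The previous bound is uniform in the truncation level and \<open>cutD\<close> tends to 1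
  at every point of \<open>S\<close>, so Fatou's lemma removes the truncation.\<close>

lemma gradient_bound:
  assumes st: "stable_solution S b g' lam u" and d: "d > 0" and s1: "s1 > 0"
    and gm: "\<And>s t. 0 \<le> s \<Longrightarrow> s \<le> t \<Longrightarrow> g s \<le> g t"
    and h: "continuous_on {0<..} h" "\<And>s. s > 0 \<Longrightarrow> h s \<le> g' s" "\<And>s. s > 0 \<Longrightarrow> h s \<ge> 0"
      "\<And>s. s \<ge> s1 \<Longrightarrow> h s = (1 + d) * g s * b / (exp (b * s) - 1)"
    and L: "lam \<le> L"
  shows "integrable lborel (\<lambda>x. if x \<in> S then gsq x else 0) \<and>
    (LINT x|lborel. (if x \<in> S then gsq x else 0)) \<le>
      2 / d * (L * ((1 + d / 2) * (exp (b * s1) * g s1 / b)) * measure lborel S)"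
proof -
  \<comment> \<open>Since \<open>wt b c \<le> c\<close>, every level up to \<open>c0\<close> meets
    the smallness condition of the truncated estimate.\<close>
  define c0 where "c0 = min s1 (d * wt b s1 / (8 * (1 + d)))"
  have c0: "c0 > 0" "c0 \<le> s1" "c0 \<le> d * wt b s1 / (8 * (1 + d))"
    using s1 d wt_pos[OF b s1] by (auto simp: c0_def)
  define c where "c k = c0 / real (Suc k)" for k
  have c: "0 < c k" "c k \<le> c0" for k
  proof -
    have "c0 / real (Suc k) \<le> c0 / 1" using c0(1) by (intro divide_left_mono) auto
    then show "0 < c k" "c k \<le> c0" using c0(1) by (simp_all add: c_def del: of_nat_Suc)
  qed
  have cl: "c \<longlonglongrightarrow> 0" unfolding c_def by (rule LIMSEQ_Suc[OF lim_const_over_n])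
  have cs: "c k \<le> s1" for k using c(2)[of k] c0(2) by linarith
  have small: "8 * (1 + d) * wt b (c k) \<le> d * wt b s1" for k
  proof -
    have "wt b (c k) \<le> d * wt b s1 / (8 * (1 + d))"
      using wt_le_self[OF b, of "c k"] c(2)[of k] c0(3) by linarith
    then show ?thesis using d by (simp add: pos_le_divide_eq mult_ac)
  qed
  note B = truncated_gradient_bound[OF st c(1) cs d small gm h L]
  show ?thesis
  proof (rule integral_limit_bound[OF B(1) _ B(2)])
    show "(if x \<in> S then (cutD b (c k) (max (c k) (u x)))\<^sup>2 * gsq x else 0) \<ge> 0" for k x
      using gsq_nonneg[of x] by simp
    show "(\<lambda>x. if x \<in> S then gsq x else 0) \<in> borel_measurable lborel"
      using borel_measurable_if_S[OF gsq_continuous] by simp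
    fix x
    show "(\<lambda>k. if x \<in> S then (cutD b (c k) (max (c k) (u x)))\<^sup>2 * gsq x else 0) \<longlonglongrightarrow> (if x \<in> S then gsq x else 0)"
    proof (cases "x \<in> S")
      case True
      have ux: "u x > 0" by (rule pos[OF True])
      have cw: "isCont (wt b) y" for y using DERIV_isCont[OF wt_DERIV[OF b]] .
      have "(\<lambda>k. wt b (c k)) \<longlonglongrightarrow> wt b 0" by (rule isCont_tendsto_compose[OF cw cl])
      then have 1: "(\<lambda>k. wt b (c k)) \<longlonglongrightarrow> 0" by (simp add: wt_def)
      have "(\<lambda>k. max (c k) (u x)) \<longlonglongrightarrow> max 0 (u x)" by (intro tendsto_max cl tendsto_const)
      then have "(\<lambda>k. max (c k) (u x)) \<longlonglongrightarrow> u x" using ux by simp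
      then have 2: "(\<lambda>k. wt b (max (c k) (u x))) \<longlonglongrightarrow> wt b (u x)" by (rule isCont_tendsto_compose[OF cw])
      have "(\<lambda>k. (1 - (wt b (c k))\<^sup>2 / (wt b (max (c k) (u x)))\<^sup>2)\<^sup>2 * gsq x) \<longlonglongrightarrow> (1 - 0\<^sup>2 / (wt b (u x))\<^sup>2)\<^sup>2 * gsq x"
        using wt_pos[OF b ux] by (intro tendsto_intros 1 2) auto
      then show ?thesis using True by (simp add: cutD_def)
    qed simp
  qed
qed

text \<open>The Poincare inequality is applied to a truncation of \<open>u\<close> itself and passed
  to the limit by Fatou's lemma. Its slope lies between 0 and 1, so its gradient is controlled by
  that of \<open>u\<close>.\<close>

lemma L2_bound:
  assumes i: "integrable lborel (\<lambda>x. if x \<in> S then gsq x else 0)"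
    and rho: "S \<subseteq> ball 0 \<rho>" "\<rho> > 0"
  shows "integrable lborel (\<lambda>x. if x \<in> S then (u x)\<^sup>2 else 0) \<and>
    (LINT x|lborel. (if x \<in> S then (u x)\<^sup>2 else 0)) \<le> \<rho>\<^sup>2 * (LINT x|lborel. (if x \<in> S then gsq x else 0))"
proof -
  define c where "c k = 1 / real (Suc k)" for k
  have c: "c k > 0" for k by (simp add: c_def)
  have cl: "c \<longlonglongrightarrow> 0" unfolding c_def by (rule LIMSEQ_Suc[OF lim_const_over_n])
  \<comment> \<open>This is (s - c)^2 / s, the profile of \<open>cutR\<close> in the variable
    \<open>s\<close> instead of \<open>wt b s\<close>.\<close>
  let ?f = "\<lambda>c s :: real. s - 2 * c + c\<^sup>2 / s" and ?f' = "\<lambda>c s :: real. 1 - c\<^sup>2 / s\<^sup>2"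
  have d: "(?f c has_real_derivative ?f' c s) (at s)" if "s \<ge> c" "c > 0" for c s
    using that by (auto intro!: derivative_eq_intros simp: field_simps power2_eq_square)
  have z: "?f c c = 0" "?f' c c = 0" if "c > 0" for c :: real
    using that by (simp_all add: power2_eq_square)
  have cont: "continuous_on {c..} (?f' c)" if "c > 0" for c :: real
    using that by (auto intro!: continuous_intros)
  have P: "integrable lborel (\<lambda>x. if x \<in> S then (?f (c k) (max (c k) (u x)))\<^sup>2 else 0)"
    "integrable lborel (\<lambda>x. if x \<in> S then (?f' (c k) (max (c k) (u x)))\<^sup>2 * gsq x else 0)"
    "(LINT x|lborel. (if x \<in> S then (?f (c k) (max (c k) (u x)))\<^sup>2 else 0)) \<le>
      \<rho>\<^sup>2 * (LINT x|lborel. (if x \<in> S then (?f' (c k) (max (c k) (u x)))\<^sup>2 * gsq x else 0))" for k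
    using poincare_freeze[of \<rho> "c k" "?f (c k)" "?f' (c k)", OF rho c[of k] d[OF _ c] z(1)[OF c] z(2)[OF c] cont[OF c]]
    by blast+
  show ?thesis
  proof (rule integral_limit_bound[OF P(1)])
    show "(if x \<in> S then (?f (c k) (max (c k) (u x)))\<^sup>2 else 0) \<ge> 0" for k x by simp
    show "(\<lambda>x. if x \<in> S then (u x)\<^sup>2 else 0) \<in> borel_measurable lborel"
      using borel_measurable_if_S[of "\<lambda>x. (u x)\<^sup>2"] cont_u(1) by (auto intro!: continuous_intros)
    show "(LINT x|lborel. (if x \<in> S then (?f (c k) (max (c k) (u x)))\<^sup>2 else 0)) \<le>
        \<rho>\<^sup>2 * (LINT x|lborel. (if x \<in> S then gsq x else 0))" for k
    proof (rule order_trans[OF P(3)], rule mult_left_mono, rule integral_mono[OF P(2) i])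
      fix x
      have "0 \<le> ?f' (c k) (max (c k) (u x))" "?f' (c k) (max (c k) (u x)) \<le> 1"
      proof -
        have "(c k)\<^sup>2 \<le> (max (c k) (u x))\<^sup>2" using c[of k] by (intro power_mono) auto
        moreover have "(max (c k) (u x))\<^sup>2 > 0" using c[of k] by (auto simp: max_def)
        ultimately show "0 \<le> ?f' (c k) (max (c k) (u x))" by (simp add: pos_divide_le_eq)
      qed simp
      then have "(?f' (c k) (max (c k) (u x)))\<^sup>2 \<le> 1" by (simp add: power_le_one)
      then show "(if x \<in> S then (?f' (c k) (max (c k) (u x)))\<^sup>2 * gsq x else 0) \<le> (if x \<in> S then gsq x else 0)"
        using mult_right_mono[OF _ gsq_nonneg[of x], of _ 1] by simp
    qed simp
    fix x
    show "(\<lambda>k. if x \<in> S then (?f (c k) (max (c k) (u x)))\<^sup>2 else 0) \<longlonglongrightarrow> (if x \<in> S then (u x)\<^sup>2 else 0)"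
    proof (cases "x \<in> S")
      case True
      have ux: "u x > 0" by (rule pos[OF True])
      have "(\<lambda>k. max (c k) (u x)) \<longlonglongrightarrow> max 0 (u x)" by (intro tendsto_max cl tendsto_const)
      then have m: "(\<lambda>k. max (c k) (u x)) \<longlonglongrightarrow> u x" using ux by simp
      have "(\<lambda>k. (?f (c k) (max (c k) (u x)))\<^sup>2) \<longlonglongrightarrow> (u x - 2 * 0 + 0\<^sup>2 / u x)\<^sup>2"
        using ux by (intro tendsto_intros m cl) auto
      then show ?thesis using True by simp
    qed simp
  qed
qed

end

section \<open>Monotonicity and growth of the nonlinearity\<close>

lemma mean_value_within:
  fixes g g' :: "real \<Rightarrow> real"
  assumes g: "\<forall>s\<ge>0. (g has_real_derivative g' s) (at s within {0..})" and st: "0 \<le> s" "s < t"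
  shows "\<exists>x. s < x \<and> x < t \<and> g t - g s = (t - s) * g' x"
proof -
  have "\<exists>x\<in>{s<..<t}. g t - g s = (\<lambda>h. g' x * h) (t - s)"
  proof (rule mvt_simple[OF st(2)])
    fix x assume "s \<le> x" "x \<le> t"
    then have "x \<ge> 0" using st(1) by linarith
    then have "(g has_real_derivative g' x) (at x within {0..})" using g by blast
    then have "(g has_real_derivative g' x) (at x within {s..t})"
      by (rule has_field_derivative_subset) (use st(1) in auto)
    then show "(g has_derivative (\<lambda>h. g' x * h)) (at x within {s..t})"
      by (simp add: has_field_derivative_def)
  qed
  then show ?thesis by (auto simp: mult.commute)
qed

text \<open>Near 0 the one-sided derivative gives g(s) \<ge> g'(0) s / 2, to be set against exp(b s)
  - 1 \<le> b s exp(b s). Away from 0, \<open>g\<close> is bounded below by monotonicity, and exp(b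
  s) - 1 \<le> exp(b s). The smaller of the two constants serves throughout.\<close>

lemma exp_growth_bound:
  fixes g g' :: "real \<Rightarrow> real"
  assumes b: "b > 0" and g: "\<forall>s\<ge>0. (g has_real_derivative g' s) (at s within {0..})"
    and g0: "\<forall>s\<ge>0. g s \<ge> 0" and g': "\<forall>s\<ge>0. g' s > 0"
    and mono: "\<And>s t. 0 \<le> s \<Longrightarrow> s \<le> t \<Longrightarrow> g s \<le> g t"
  shows "\<exists>k>0. \<forall>s>0. k * (exp (b * s) - 1) \<le> b * exp (b * s) * g s"
proof -
  let ?q = "g' 0 / 2"
  have q: "0 < ?q" "?q < g' 0" using g' by auto
  have "((\<lambda>s. (g s - g 0) / (s - 0)) \<longlongrightarrow> g' 0) (at 0 within {0..})"
    using g by (auto simp: has_field_derivative_iff)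
  from order_tendstoD(1)[OF this q(2)]
  obtain z where z: "z > 0" "\<And>s. s \<ge> 0 \<Longrightarrow> s \<noteq> 0 \<Longrightarrow> dist s 0 < z \<Longrightarrow> ?q < (g s - g 0) / (s - 0)"
    unfolding eventually_at by auto
  have near: "?q * s \<le> g s" if "0 < s" "s < z" for s
  proof -
    have "?q < (g s - g 0) / s" using z(2)[of s] that by simp
    then have "?q * s < g s - g 0" using that(1) by (simp add: pos_less_divide_eq)
    then show ?thesis using g0 by force
  qed
  let ?k = "min ?q (b * g (z / 2))"
  have "?q * (z / 2) \<le> g (z / 2)" using near[of "z / 2"] z(1) by simp
  moreover have "?q * (z / 2) > 0" using q(1) z(1) by (intro mult_pos_pos) auto
  ultimately have gz: "g (z / 2) > 0" by linarith
  have "?k * (exp (b * s) - 1) \<le> b * exp (b * s) * g s" if s: "s > 0" for s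
  proof (cases "s < z")
    case True
    have "1 - b * s \<le> exp (- (b * s))" using exp_ge_add_one_self[of "- (b * s)"] by simp
    from mult_left_mono[OF this, of "exp (b * s)"]
    have e: "exp (b * s) - 1 \<le> exp (b * s) * (b * s)"
      by (simp add: exp_minus right_diff_distrib)
    have "?k * (exp (b * s) - 1) \<le> ?q * (exp (b * s) - 1)" using b s by (intro mult_right_mono) auto
    also have "\<dots> \<le> ?q * (exp (b * s) * (b * s))" using e q(1) by (intro mult_left_mono) auto
    also have "\<dots> = b * exp (b * s) * (?q * s)" by simp
    also have "\<dots> \<le> b * exp (b * s) * g s" using near[OF s True] b by (intro mult_left_mono) auto
    finally show ?thesis .
  next
    case False
    have "?k * (exp (b * s) - 1) \<le> (b * g (z / 2)) * (exp (b * s) - 1)" using b s by (intro mult_right_mono) auto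
    also have "\<dots> \<le> (b * g (z / 2)) * exp (b * s)" using b gz by (intro mult_left_mono) auto
    also have "\<dots> \<le> (b * g s) * exp (b * s)"
      using mono[of "z / 2" s] False z(1) b by (intro mult_right_mono mult_left_mono) auto
    finally show ?thesis by (simp add: mult_ac)
  qed
  moreover have "?k > 0" using q(1) b gz by simp
  ultimately show ?thesis by blast
qed

section \<open>Classical partial derivatives as weak derivatives\<close>

lemma cont_partial_has_weak_deriv:
  fixes f :: "real^'n::finite \<Rightarrow> real"
  assumes S: "open S" and f: "cont_partial i S f f'"
  shows "has_weak_deriv S [i] f f'"
proof -
  have c: "continuous_on S f" "continuous_on S f'" using f by (auto simp: cont_partial_def)
  have loc: "locally_integrable S h" if "continuous_on S h" for h
    unfolding locally_integrable_def
  proof (intro allI impI)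
    fix K assume K: "compact K \<and> K \<subseteq> S"
    then have "integrable lborel (\<lambda>x. indicator K x *\<^sub>R h x)"
      by (intro borel_integrable_compact continuous_on_subset[OF that]) auto
    then show "set_integrable lebesgue K h"
      unfolding set_integrable_def by (simp add: integrable_completion borel_measurable_integrable)
  qed
  have "(LINT x:S|lebesgue. f x * partials [i] \<eta> x) = (-1) ^ length [i] * (LINT x:S|lebesgue. f' x * \<eta> x)"
    if t: "test_function S \<eta>" for \<eta>
  proof -
    have "Ck_on 2 UNIV \<eta>" using t by (auto simp: test_function_def smooth_on_def)
    from Ck_on_2_cont_partial(1)[OF this open_UNIV]
    have e: "cont_partial i S \<eta> (partial i \<eta>)" by (rule cont_partial_subset) simp
    obtain K where K: "compact K" "K \<subseteq> S" "\<And>x. x \<notin> K \<Longrightarrow> \<eta> x = 0"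
      using test_function_D(2)[OF t] by blast
    have ce: "continuous_on S \<eta>" "continuous_on S (partial i \<eta>)" using e by (auto simp: cont_partial_def)
    have e0: "partial i \<eta> x = 0" if "x \<in> S" "x \<notin> K" for x
      by (rule cont_partial_zero_off[OF e S compact_imp_closed[OF K(1)] K(3) that])
    have 0: "(LINT x|lborel. (if x \<in> S then f x * partial i \<eta> x + f' x * \<eta> x else 0)) = 0"
      by (rule integral_partial_extend_zero(2)[OF cont_partial_mult[OF f e] S K(1,2)]) (simp add: K(3))
    have i1: "integrable lborel (\<lambda>x. if x \<in> S then f x * partial i \<eta> x else 0)"
      and i2: "integrable lborel (\<lambda>x. if x \<in> S then f' x * \<eta> x else 0)"
      by (rule integrable_extend_zero[OF _ S K(1,2)]; auto intro!: continuous_intros c ce simp: K(3) e0)+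
    have "(\<lambda>x. if x \<in> S then f x * partial i \<eta> x + f' x * \<eta> x else 0) =
        (\<lambda>x. (if x \<in> S then f x * partial i \<eta> x else 0) + (if x \<in> S then f' x * \<eta> x else 0))" by auto
    then have s: "(LINT x|lborel. (if x \<in> S then f x * partial i \<eta> x else 0)) = - (LINT x|lborel. (if x \<in> S then f' x * \<eta> x else 0))"
      using 0 Bochner_Integration.integral_add[OF i1 i2] by simp
    have conv: "(LINT x:S|lebesgue. h x) = (LINT x|lborel. (if x \<in> S then h x else 0))"
      if "integrable lborel (\<lambda>x. if x \<in> S then h x else 0)" for h :: "real^'n \<Rightarrow> real"
    proof -
      have "(LINT x:S|lebesgue. h x) = (LINT x|lebesgue. (if x \<in> S then h x else 0))"
        unfolding set_lebesgue_integral_def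
        by (intro Bochner_Integration.integral_cong refl) auto
      also have "\<dots> = (LINT x|lborel. (if x \<in> S then h x else 0))"
        by (rule integral_completion) (rule borel_measurable_integrable[OF that])
      finally show ?thesis .
    qed
    show ?thesis
      using s conv[OF i1] conv[OF i2] by (simp add: partials_def)
  qed
  then show ?thesis
    unfolding has_weak_deriv_def using loc[OF c(1)] loc[OF c(2)] by blast
qed


section \<open>The main estimate\<close>

text \<open>\<open>H1_norm\<close> is formed with a chosen weak gradient. The classical partial
  derivatives are weak derivatives, so by uniqueness the choice agrees with them almost everywhere
  and the norm becomes the integrals that have been estimated.\<close>

lemma (in positive_solution) sobolev_norm:
  assumes i: "integrable lborel (\<lambda>x. if x \<in> S then gsq x else 0)"
    "integrable lborel (\<lambda>x. if x \<in> S then (u x)\<^sup>2 else 0)"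
  shows "u \<in> sobolev 1 2 S"
    and "H1_norm S u = sqrt ((LINT x|lborel. (if x \<in> S then (u x)\<^sup>2 else 0)) + (LINT x|lborel. (if x \<in> S then gsq x else 0)))"
proof -
  have wd: "has_weak_deriv S [j] u (u1 j)" for j
    by (rule cont_partial_has_weak_deriv[OF S(1) u1])
  have set_eq: "(\<lambda>x. indicator S x *\<^sub>R f x) = (\<lambda>x. if x \<in> S then f x else (0::real))" for f
    by auto
  have Lp: "f \<in> Lp_space 2 S" if f: "continuous_on S f" "integrable lborel (\<lambda>x. if x \<in> S then (f x)\<^sup>2 else 0)" for f
  proof -
    have "(\<lambda>x. if x \<in> S then f x else 0) \<in> borel_measurable lebesgue"
      by (rule measurable_completion) (simp add: borel_measurable_if_S[OF f(1)])
    moreover have "\<bar>f x\<bar> powr 2 = (f x)\<^sup>2" for x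
      by simp
    moreover have "integrable lebesgue (\<lambda>x. if x \<in> S then (f x)\<^sup>2 else 0)"
      using f(2) by (simp add: integrable_completion borel_measurable_integrable)
    ultimately show ?thesis
      by (simp only: Lp_space_def set_borel_measurable_def set_integrable_def set_eq mem_Collect_eq simp_thms)
  qed
  have Lu: "u \<in> Lp_space 2 S" by (rule Lp[OF cont_u(1) i(2)])
  have Lu1: "u1 j \<in> Lp_space 2 S" for j
  proof (rule Lp[OF cont_u(2)])
    show "integrable lborel (\<lambda>x. if x \<in> S then (u1 j x)\<^sup>2 else 0)"
    proof (rule Bochner_Integration.integrable_bound[OF i(1)])
      show "(\<lambda>x. if x \<in> S then (u1 j x)\<^sup>2 else 0) \<in> borel_measurable lborel"
        using borel_measurable_if_S[of "\<lambda>x. (u1 j x)\<^sup>2"] cont_u(2) by (auto intro!: continuous_intros)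
      have "(u1 j x)\<^sup>2 \<le> gsq x" for x
        by (rule member_le_sum) auto
      then show "AE x in lborel. norm (if x \<in> S then (u1 j x)\<^sup>2 else 0) \<le> norm (if x \<in> S then gsq x else 0)"
        by (auto intro!: AE_I2 order_trans[OF _ abs_ge_self])
    qed
  qed
  have w0: "has_weak_deriv S [] u u"
  proof -
    have "locally_integrable S u" using wd unfolding has_weak_deriv_def by blast
    then show ?thesis by (simp add: has_weak_deriv_def partials_def)
  qed
  have "\<exists>w\<in>Lp_space 2 S. has_weak_deriv S is u w" if l: "length is \<le> 1" for "is"
  proof (cases "is")
    case Nil
    then show ?thesis using w0 Lu by blast
  next
    case (Cons j js)
    then have "is = [j]" using l by simp
    then show ?thesis using wd Lu1 by blast
  qed
  then show "u \<in> sobolev 1 2 S" using Lu unfolding sobolev_def by blast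
  have "AE x in lebesgue. \<forall>j. x \<in> S \<longrightarrow> weak_deriv S [j] u x = u1 j x"
  proof (subst AE_all_countable, rule allI)
    fix j
    have "has_weak_deriv S [j] u (weak_deriv S [j] u)"
      unfolding weak_deriv_def by (rule someI[of "has_weak_deriv S [j] u"]) (rule wd)
    from has_weak_deriv_unique[OF S(1) this wd]
    show "AE x in lebesgue. x \<in> S \<longrightarrow> weak_deriv S [j] u x = u1 j x" .
  qed
  then have ae: "AE x in lebesgue. indicator S x *\<^sub>R (norm (weak_grad S u x))\<^sup>2 = (if x \<in> S then gsq x else 0)"
  proof eventually_elim
    case (elim x)
    have "weak_grad S u x = grad u x" if "x \<in> S"
      using elim that by (simp add: weak_grad_def grad_def)
    then show ?case by (simp add: norm_grad)
  qed
  have m: "(\<lambda>x. if x \<in> S then gsq x else 0) \<in> borel_measurable lebesgue"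
    by (rule measurable_completion) (simp add: borel_measurable_if_S[OF gsq_continuous])
  have "(LINT x:S|lebesgue. (norm (weak_grad S u x))\<^sup>2) = (LINT x|lebesgue. (if x \<in> S then gsq x else 0))"
    unfolding set_lebesgue_integral_def
  proof (rule integral_cong_AE[OF _ m ae])
    \<comment> \<open>Lebesgue measure is complete, so measurability passes from the classical
      gradient to the chosen weak one along equality almost everywhere.\<close>
    show "(\<lambda>x. indicator S x *\<^sub>R (norm (weak_grad S u x))\<^sup>2) \<in> borel_measurable lebesgue"
      by (rule borel_measurable_AE[OF m]) (use ae in eventually_elim, rule sym)
  qed
  also have "\<dots> = (LINT x|lborel. (if x \<in> S then gsq x else 0))"
    by (rule integral_completion) (rule borel_measurable_integrable[OF i(1)])
  finally have G: "(LINT x:S|lebesgue. (norm (weak_grad S u x))\<^sup>2) = (LINT x|lborel. (if x \<in> S then gsq x else 0))" .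
  have "(LINT x:S|lebesgue. (u x)\<^sup>2) = (LINT x|lborel. (if x \<in> S then (u x)\<^sup>2 else 0))"
    unfolding set_lebesgue_integral_def set_eq
    by (rule integral_completion) (rule borel_measurable_integrable[OF i(2)])
  then show "H1_norm S u = sqrt ((LINT x|lborel. (if x \<in> S then (u x)\<^sup>2 else 0)) + (LINT x|lborel. (if x \<in> S then gsq x else 0)))"
    unfolding H1_norm_def G by simp
qed

text \<open>The minorant \<open>h\<close> replaces \<open>g'\<close>, which need not be measurable.\<close>

lemma continuous_minorant:
  fixes g g' :: "real \<Rightarrow> real"
  assumes b: "b > 0" and g: "continuous_on {0..} g" "\<And>s. s \<ge> 0 \<Longrightarrow> g s \<ge> 0" "\<And>s. s > 0 \<Longrightarrow> g s > 0"
    and g': "\<forall>s\<ge>0. g' s > 0"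
    and L: "Liminf at_top (\<lambda>s. ereal (g' s * (exp (b * s) - 1) / (b * g s))) > 1"
  shows "\<exists>d s1 h. d > 0 \<and> s1 > 0 \<and> continuous_on {0<..} h \<and> (\<forall>s>0. h s \<le> g' s \<and> h s \<ge> 0) \<and>
    (\<forall>s\<ge>s1. h s = (1 + d) * g s * b / (exp (b * s) - 1))"
proof -
  \<comment> \<open>A real number strictly between 1 and the liminf, so that the margin
    \<open>d = z - 1\<close> is finite even if the liminf is infinite.\<close>
  obtain z where z: "1 < ereal z" "ereal z < Liminf at_top (\<lambda>s. ereal (g' s * (exp (b * s) - 1) / (b * g s)))"
    using ereal_dense2[OF L] by blast
  from less_LiminfD[OF z(2)]
  obtain N where N: "\<And>s. s \<ge> N \<Longrightarrow> z < g' s * (exp (b * s) - 1) / (b * g s)"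
    unfolding eventually_at_top_linorder by auto
  define d where "d = z - 1"
  have d: "d > 0" using z(1) by (simp add: d_def)
  define s0 where "s0 = max N 1"
  \<comment> \<open>The last factor is a continuous ramp: \<open>h\<close> is zero up to
    \<open>s0\<close>, where nothing better than positivity of \<open>g'\<close> is known, and
    equals the full quotient from \<open>s0 + 1\<close> on.\<close>
  define h where "h s = (1 + d) * g s * b / (exp (b * s) - 1) * min 1 (max 0 (s - s0))" for s
  have e: "exp (b * s) - 1 > 0" if "s > 0" for s using b that by simp
  have hc: "continuous_on {0<..} h"
    unfolding h_def using e by (intro continuous_intros continuous_on_subset[OF g(1)]) force+
  note hc
  moreover have "h s \<le> g' s \<and> h s \<ge> 0" if s: "s > 0" for s
  proof -
    have q: "(1 + d) * g s * b / (exp (b * s) - 1) \<ge> 0"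
      using d g(2)[of s] b e[OF s] s by simp
    show ?thesis
    proof (cases "s \<le> s0")
      case True
      then show ?thesis using g' s by (simp add: h_def less_imp_le)
    next
      case False
      then have "z < g' s * (exp (b * s) - 1) / (b * g s)" using N[of s] by (simp add: s0_def)
      then have "z * (b * g s) < g' s * (exp (b * s) - 1)"
        using b g(3)[OF s] by (simp add: pos_less_divide_eq)
      then have "(1 + d) * g s * b / (exp (b * s) - 1) \<le> g' s"
        using e[OF s] by (simp add: pos_divide_le_eq d_def mult_ac)
      moreover have "h s \<le> (1 + d) * g s * b / (exp (b * s) - 1) * 1"
        unfolding h_def using q by (intro mult_left_mono) auto
      moreover have "h s \<ge> 0" unfolding h_def using q by (intro mult_nonneg_nonneg) auto
      ultimately show ?thesis by linarith
    qed
  qed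
  moreover have "h s = (1 + d) * g s * b / (exp (b * s) - 1)" if "s \<ge> s0 + 1" for s
    using that by (simp add: h_def)
  moreover have "s0 + 1 > 0" by (simp add: s0_def)
  ultimately have "d > 0 \<and> s0 + 1 > 0 \<and> continuous_on {0<..} h \<and> (\<forall>s>0. h s \<le> g' s \<and> h s \<ge> 0) \<and>
      (\<forall>s\<ge>s0 + 1. h s = (1 + d) * g s * b / (exp (b * s) - 1))"
    using d by simp
  then show ?thesis by (intro exI)
qed

theorem proposition7p1:
  fixes \<Omega> :: "(real^'n::finite) set"
    and b :: real
    and g g' :: "real \<Rightarrow> real"
  assumes "smooth_bounded_domain \<Omega>"
    and "b > 0"
    and "\<forall>s\<ge>0. (g has_real_derivative g' s) (at s within {0..})"
    and "\<forall>s\<ge>0. g s \<ge> 0"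
    and "\<forall>s\<ge>0. g' s > 0"
    and "Liminf at_top (\<lambda>s. ereal (g' s * (exp (b * s) - 1) / (b * g s))) > 1"
  shows "\<exists>C. \<forall>lam u. lam > 0 \<and> classical_solution \<Omega> b g lam u \<and> (\<forall>x\<in>\<Omega>. u x > 0) \<and>
                     stable_solution \<Omega> b g' lam u
               \<longrightarrow> u \<in> sobolev 1 2 \<Omega> \<and> H1_norm \<Omega> u \<le> C"
proof -
  have dom: "open \<Omega>" "bounded \<Omega>" "\<Omega> \<noteq> {}"
    using assms(1) by (auto simp: smooth_bounded_domain_def)
  have gs: "g s < g t" if st: "0 \<le> s" "s < t" for s t
  proof -
    obtain x where x: "s < x" "g t - g s = (t - s) * g' x"
      using mean_value_within[OF assms(3) st] by blast
    then have "(t - s) * g' x > 0" using assms(5) st by (intro mult_pos_pos) auto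
    then show ?thesis using x(2) by linarith
  qed
  have gm: "g s \<le> g t" if "0 \<le> s" "s \<le> t" for s t
    using gs[of s t] that by (cases "s = t") auto
  have gpos: "g s > 0" if "s > 0" for s
    using gs[of 0 s] that assms(4)[rule_format, of 0] by linarith
  have gc: "continuous_on {0..} g"
    by (rule DERIV_continuous_on[of _ _ g']) (use assms(3) in auto)
  have g0: "g s \<ge> 0" if "s \<ge> 0" for s using assms(4) that by blast
  obtain d s1 h where d: "d > 0" "s1 > 0" and h: "continuous_on {0<..} h" "\<forall>s>0. h s \<le> g' s \<and> h s \<ge> 0"
      "\<forall>s\<ge>s1. h s = (1 + d) * g s * b / (exp (b * s) - 1)"
    using continuous_minorant[OF assms(2) gc g0 gpos assms(5,6)] by blast
  obtain k where k: "k > 0" "\<forall>s>0. k * (exp (b * s) - 1) \<le> b * exp (b * s) * g s"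
    using exp_growth_bound[OF assms(2-5) gm] by blast
  obtain x0 where "x0 \<in> \<Omega>" using dom(3) by blast
  then obtain r where r: "r > 0" "cball x0 r \<subseteq> \<Omega>" using dom(1) open_contains_cball by blast
  obtain \<rho> where rho: "\<Omega> \<subseteq> ball 0 \<rho>" "\<rho> > 0"
    using bounded_subset_ballD[OF dom(2), of 0] by blast
  \<comment> \<open>\<open>L\<close> bounds every admissible \<open>lam\<close>, and
    \<open>C\<close> the corresponding gradient integral. Both are built only from the domain,
    \<open>b\<close>, \<open>g\<close> and choices made before any solution is fixed.\<close>
  define A where "A = k * (LINT x|lborel. (ker r (x - x0))\<^sup>2)"
  define L where "L = (LINT x|lborel. (if x \<in> \<Omega> then (\<Sum>i\<in>UNIV. (ker1 i r (x - x0))\<^sup>2) else 0)) / A"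
  define C where "C = 2 / d * (L * ((1 + d / 2) * (exp (b * s1) * g s1 / b)) * measure lborel \<Omega>)"
  have A: "A > 0"
  proof -
    have off: "ker r (x - x0) = 0" if "x \<notin> cball x0 r" for x
      using that r(1) by (intro ker_zero) (auto simp: dist_norm norm_minus_commute[of x0])
    have i: "integrable lborel (\<lambda>x. (ker r (x - x0))\<^sup>2)"
    proof (rule integrable_compact_support[OF _ compact_cball[of x0 r]])
      show "continuous_on UNIV (\<lambda>x. (ker r (x - x0))\<^sup>2)"
        by (intro continuous_intros continuous_on_compose2[OF ker_continuous(1)]) auto
    qed (simp add: off)
    have "(LINT x|lborel. (ker r (x - x0))\<^sup>2) \<noteq> 0"
    proof
      assume "(LINT x|lborel. (ker r (x - x0))\<^sup>2) = 0"
      then have "AE x in lborel. (ker r (x - x0))\<^sup>2 = 0"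
        using integral_nonneg_eq_0_iff_AE[OF i] by simp
      then have "AE x in lborel. x \<notin> ball x0 r"
      proof eventually_elim
        case (elim x)
        show ?case
        proof
          assume "x \<in> ball x0 r"
          then have "ker r (x - x0) > 0" by (intro ker_pos) (simp add: dist_norm norm_minus_commute[of x0])
          then show False using elim by simp
        qed
      qed
      then have "emeasure lborel (ball x0 r) = 0"
        by (subst (asm) AE_iff_measurable[of "ball x0 r"]) auto
      then show False using content_ball_pos[OF r(1), of x0] by (simp add: measure_def)
    qed
    moreover have "(LINT x|lborel. (ker r (x - x0))\<^sup>2) \<ge> 0" by (rule integral_nonneg_AE) simp
    ultimately have "(LINT x|lborel. (ker r (x - x0))\<^sup>2) > 0" by linarith
    then show ?thesis unfolding A_def using k(1) by (intro mult_pos_pos)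
  qed
  \<comment> \<open>The summand \<open>C\<close> accounts for the gradient, and \<rho>^2 times it,
    by the Poincare inequality, for the function itself.\<close>
  have "u \<in> sobolev 1 2 \<Omega> \<and> H1_norm \<Omega> u \<le> sqrt (\<rho>\<^sup>2 * C + C)"
    if u: "lam > 0" "classical_solution \<Omega> b g lam u" "\<forall>x\<in>\<Omega>. u x > 0" "stable_solution \<Omega> b g' lam u" for lam u
  proof -
    interpret positive_solution \<Omega> b lam g u
      by unfold_locales (use dom assms(2) u gc g0 in auto)
    have "lam * A \<le> L * A"
      using lam_bound[OF r k(1)] k(2) A by (simp add: A_def L_def)
    then have lL: "lam \<le> L" using A by simp
    note G = gradient_bound[OF u(4) d gm h(1) _ _ _ lL, folded C_def]
    have G: "integrable lborel (\<lambda>x. if x \<in> \<Omega> then gsq x else 0)" "(LINT x|lborel. (if x \<in> \<Omega> then gsq x else 0)) \<le> C"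
      using G h(2,3) by auto
    note U = L2_bound[OF G(1) rho]
    note N = sobolev_norm[OF G(1) conjunct1[OF U]]
    have "\<rho>\<^sup>2 * (LINT x|lborel. (if x \<in> \<Omega> then gsq x else 0)) \<le> \<rho>\<^sup>2 * C"
      using G(2) by (intro mult_left_mono) auto
    then have "H1_norm \<Omega> u \<le> sqrt (\<rho>\<^sup>2 * C + C)"
      unfolding N(2) using conjunct2[OF U] G(2) by (intro real_sqrt_le_mono) linarith
    then show ?thesis using N(1) by blast
  qed
  then show ?thesis by blast
qed

end
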